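(* Let $D=\mathbb{R}^d/\mathbb{Z}^d$, $T_*>0$, and let $V$ be a smooth solution on $[0,T_*]\times D$ of the Euler equations with initial condition $P_0$, where $P_0$ is a divergence-free vector field on $D$ of zero spatial mean; i.e. $V$ is smooth and divergence-free in space, $\partial_tV^i+\partial_j(V^iV^j)$ is the spatial gradient of a function on $[0,T_*]\times D$, and $V(0,\cdot)=P_0$. For $0<T\le T_*$, let $A$ (with $\varphi$ a scalar function on $[0,T]\times D$) be the unique solution on $[0,T]\times D$ of the linear final-value problem $$\partial_tA_i+(\delta_{ij}+\partial_jA_i+\partial_iA_j)V^j+\partial_i\varphi=0,\qquad \partial^jA_j=0,\qquad A(T,\cdot)=0.$$ If $T$ is small enough (i.e. for all $0<T\le T_0$, for some $T_0>0$ depending on $V$), the symmetric-matrix-valued field $\delta_{ij}+\partial_jA_i+\partial_iA_j$ stays uniformly bounded away from zero on $[0,T]\times D$ (i.e. is $\ge c\,\mathbb{I}_d$ for some constant $c>0$), and then the pair $(E,B)$ defined by $$E_i=\partial_tA_i+\partial_i\varphi,\qquad B_{ij}=\tfrac12(\partial_jA_i+\partial_iA_j)$$ is a maximizer of the concave maximization problem $$\sup_{(E,B)\in\mathcal{EB}_{2,\infty}}\;\Big(-K[E,B]-\int_{[0,T]\times D}P_0\cdot E\Big),$$ while $V$ can be recovered on $[0,T]\times D$ as $V=-(\mathbb{I}_d+2B)^{-1}E$.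
   Context: Summation over repeated lower and upper indices is implied; indices are raised and lowered with $\delta$; $\partial^k=\delta^{kj}\partial_j$, $\bigtriangleup=\delta^{ij}\partial_i\partial_j$; $\mathbb{I}_d$ is the $d\times d$ identity matrix; $(-\bigtriangleup)^{-1}$ acts on zero-mean functions (or distributions) on the torus $D$. $P_0$ is regarded as a time-independent field on $[0,T]\times D$. The class $\mathcal{EB}_{2,\infty}$: the set of all pairs $(E,B)$ with $E\in L^2([0,T]\times D;\mathbb{R}^d)$ and $B\in L^\infty([0,T]\times D)$ valued in the symmetric $d\times d$ matrices, subject to the constraint $$B(T,\cdot)=0,\qquad \partial_tB_{ij}=\tfrac12(\partial_jE_i+\partial_iE_j)+\partial_i\partial_j(-\bigtriangleup)^{-1}\partial^kE_k,$$ understood in the weak sense: for all smooth functions $\zeta$ on $[0,T]$ vanishing at $t=0$ and all smooth functions $\psi$ on $D$ valued in the symmetric $d\times d$ matrices, $$\int_{[0,T]\times D}B_{ij}(t,x)\zeta'(t)\psi^{ij}(x)-E_k(t,x)\zeta(t)\left(\partial_j\psi^{kj}+\partial^k(-\bigtriangleup)^{-1}\partial_i\partial_j\psi^{ij}\right)(x)=0.$$ The functional $K$: for $(E,B)\in\mathcal{EB}_{2,\infty}$, $$K[E,B]=\sup_{M\ge Z\otimes Z}\;\frac12\int_{[0,T]\times D}2E_iZ^i-(\delta_{ij}+2B_{ij})M^{ij}\;\in[0,+\infty],$$ where the supremum is over all pairs $(Z,M)$ of continuous functions on $[0,T]\times D$, valued respectively in $\mathbb{R}^d$ and in the symmetric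 $d\times d$ matrices, with $M\ge Z\otimes Z$ pointwise in the sense of symmetric matrices. (Less precisely, $K[E,B]=\frac12\int_{[0,T]\times D}E\cdot(\mathbb{I}_d+2B)^{-1}\cdot E$.) *)

theory Defs
  imports "HOL-Analysis.Analysis"
begin

(* Functions on the torus D = R^d / Z^d are Z^d-periodic functions on real^'n, where
   d = CARD('n). Integrals over D are Lebesgue integrals over the unit cube.
   A field on [0,T] x D is a curried function of t and x; its values for t outside
   {0..T} are irrelevant. *)

definition periodic :: "(real^'n \<Rightarrow> 'b) \<Rightarrow> bool" where
  "periodic f \<longleftrightarrow> (\<forall>x i. f (x + axis i 1) = f x)"

definition cube :: "(real^'n) set" where
  "cube = {x. \<forall>i. 0 \<le> x $ i \<and> x $ i \<le> 1}"

definition slab :: "real \<Rightarrow> (real \<times> (real^'n)) set" where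
  "slab T = {0..T} \<times> cube"


(* Smoothness up to the boundary: derivatives are taken within S, so that they are one-sided
   at the end points when S = {0..T} or S = {0..T} x UNIV. On these sets (T > 0), and on
   S = UNIV, derivatives within S are unique. *)

primrec Ck_on :: "nat \<Rightarrow> 'a::euclidean_space set \<Rightarrow> ('a \<Rightarrow> 'b::real_normed_vector) \<Rightarrow> bool" where
  "Ck_on 0 S f \<longleftrightarrow> continuous_on S f"
| "Ck_on (Suc k) S f \<longleftrightarrow> f differentiable_on S \<and>
     (\<forall>b\<in>Basis. Ck_on k S (\<lambda>x. frechet_derivative f (at x within S) b))"

definition smooth_on :: "'a::euclidean_space set \<Rightarrow> ('a \<Rightarrow> 'b::real_normed_vector) \<Rightarrow> bool" where
  "smooth_on S f \<longleftrightarrow> (\<forall>k. Ck_on k S f)"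

definition smooth_field :: "real \<Rightarrow> (real \<Rightarrow> real^'n \<Rightarrow> 'b::real_normed_vector) \<Rightarrow> bool" where
  "smooth_field T u \<longleftrightarrow>
     smooth_on ({0..T} \<times> UNIV) (\<lambda>(t, x). u t x) \<and> (\<forall>t\<in>{0..T}. periodic (u t))"

definition continuous_field :: "real \<Rightarrow> (real \<Rightarrow> real^'n \<Rightarrow> 'b::real_normed_vector) \<Rightarrow> bool" where
  "continuous_field T u \<longleftrightarrow>
     continuous_on ({0..T} \<times> UNIV) (\<lambda>(t, x). u t x) \<and> (\<forall>t\<in>{0..T}. periodic (u t))"


definition dt :: "real \<Rightarrow> (real \<Rightarrow> real^'n \<Rightarrow> 'b::real_normed_vector) \<Rightarrow> real \<Rightarrow> real^'n \<Rightarrow> 'b" where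
  "dt T u t x = vector_derivative (\<lambda>s. u s x) (at t within {0..T})"

definition partial :: "'n \<Rightarrow> (real^'n \<Rightarrow> real) \<Rightarrow> real^'n \<Rightarrow> real" where
  "partial i f x = frechet_derivative f (at x) (axis i 1)"

definition grad :: "(real^'n \<Rightarrow> real) \<Rightarrow> real^'n \<Rightarrow> real^'n" where
  "grad f x = (\<chi> i. partial i f x)"

definition divergence :: "(real^'n \<Rightarrow> real^'n) \<Rightarrow> real^'n \<Rightarrow> real" where
  "divergence u x = (\<Sum>i\<in>UNIV. partial i (\<lambda>y. u y $ i) x)"

definition div_mat :: "(real^'n \<Rightarrow> real^'n^'n) \<Rightarrow> real^'n \<Rightarrow> real^'n" where
  "div_mat m x = (\<chi> i. \<Sum>j\<in>UNIV. partial j (\<lambda>y. m y $ i $ j) x)"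

definition laplacian :: "(real^'n \<Rightarrow> real) \<Rightarrow> real^'n \<Rightarrow> real" where
  "laplacian f x = (\<Sum>i\<in>UNIV. partial i (partial i f) x)"

definition sym_grad :: "(real^'n \<Rightarrow> real^'n) \<Rightarrow> real^'n \<Rightarrow> real^'n^'n" where
  "sym_grad a x =
     (\<chi> i j. (partial j (\<lambda>y. a y $ i) x + partial i (\<lambda>y. a y $ j) x) / 2)"

(* The relation u = (-Laplacian)^{-1} f for smooth f on D. A solution u exists
   exactly when f has zero mean, and it is then unique. *)
definition is_inv_neg_laplacian :: "(real^'n \<Rightarrow> real) \<Rightarrow> (real^'n \<Rightarrow> real) \<Rightarrow> bool" where
  "is_inv_neg_laplacian f u \<longleftrightarrow>
     smooth_on UNIV u \<and> periodic u \<and> (LINT x:cube|lborel. u x) = 0 \<and>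
     (\<forall>x. - laplacian u x = f x)"


definition outer :: "real^'n \<Rightarrow> real^'n \<Rightarrow> real^'n^'n" where
  "outer v w = (\<chi> i j. v $ i * w $ j)"

definition symmetric_matrix :: "real^'n^'n \<Rightarrow> bool" where
  "symmetric_matrix M \<longleftrightarrow> transpose M = M"

definition loewner_le :: "real^'n^'n \<Rightarrow> real^'n^'n \<Rightarrow> bool" where
  "loewner_le M N \<longleftrightarrow> (\<forall>v. v \<bullet> (M *v v) \<le> v \<bullet> (N *v v))"


definition L2_field :: "real \<Rightarrow> (real \<Rightarrow> real^'n \<Rightarrow> 'b::euclidean_space) \<Rightarrow> bool" where
  "L2_field T u \<longleftrightarrow>
     set_borel_measurable lborel (slab T) (\<lambda>(t, x). u t x) \<and>
     set_integrable lborel (slab T) (\<lambda>(t, x). (norm (u t x))\<^sup>2) \<and>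
     (\<forall>t\<in>{0..T}. periodic (u t))"

definition Linf_field :: "real \<Rightarrow> (real \<Rightarrow> real^'n \<Rightarrow> 'b::euclidean_space) \<Rightarrow> bool" where
  "Linf_field T u \<longleftrightarrow>
     set_borel_measurable lborel (slab T) (\<lambda>(t, x). u t x) \<and>
     (\<exists>C. AE (t, x) in lborel. (t, x) \<in> slab T \<longrightarrow> norm (u t x) \<le> C) \<and>
     (\<forall>t\<in>{0..T}. periodic (u t))"

(* Weak form of B(T) = 0 and
     d_t B_ij = (d_j E_i + d_i E_j)/2 + d_i d_j (-Laplacian)^{-1} d^k E_k.
   In weak_constraint, theta is (-Laplacian)^{-1} d_i d_j psi^ij. The inner product of
   real^'n^'n is the full contraction B_ij psi^ij. *)
definition weak_constraint ::
  "real \<Rightarrow> (real \<Rightarrow> real^'n \<Rightarrow> real^'n) \<Rightarrow> (real \<Rightarrow> real^'n \<Rightarrow> real^'n^'n) \<Rightarrow> bool" where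
  "weak_constraint T E B \<longleftrightarrow>
     (\<forall>\<zeta> \<psi> \<theta>.
        smooth_on {0..T} \<zeta> \<and> \<zeta> 0 = 0 \<and>
        smooth_on UNIV \<psi> \<and> periodic \<psi> \<and> (\<forall>x. symmetric_matrix (\<psi> x)) \<and>
        is_inv_neg_laplacian (divergence (div_mat \<psi>)) \<theta> \<longrightarrow>
        (LINT (t, x):slab T|lborel.
           vector_derivative \<zeta> (at t within {0..T}) * (B t x \<bullet> \<psi> x)
           - \<zeta> t * (E t x \<bullet> (div_mat \<psi> x + grad \<theta> x))) = 0)"

definition EB ::
  "real \<Rightarrow> ((real \<Rightarrow> real^'n \<Rightarrow> real^'n) \<times> (real \<Rightarrow> real^'n \<Rightarrow> real^'n^'n)) set" where
  "EB T = {(E, B). L2_field T E \<and> Linf_field T B \<and>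
     (\<forall>t\<in>{0..T}. \<forall>x. symmetric_matrix (B t x)) \<and> weak_constraint T E B}"

definition admissible_ZM ::
  "real \<Rightarrow> ((real \<Rightarrow> real^'n \<Rightarrow> real^'n) \<times> (real \<Rightarrow> real^'n \<Rightarrow> real^'n^'n)) set" where
  "admissible_ZM T = {(Z, M). continuous_field T Z \<and> continuous_field T M \<and>
     (\<forall>t\<in>{0..T}. \<forall>x. symmetric_matrix (M t x) \<and> loewner_le (outer (Z t x) (Z t x)) (M t x))}"

definition K ::
  "real \<Rightarrow> (real \<Rightarrow> real^'n \<Rightarrow> real^'n) \<Rightarrow> (real \<Rightarrow> real^'n \<Rightarrow> real^'n^'n) \<Rightarrow> ereal" where
  "K T E B = (SUP (Z, M)\<in>admissible_ZM T.
     ereal (1/2 * (LINT (t, x):slab T|lborel.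
        2 * (E t x \<bullet> Z t x) - (mat 1 + 2 *\<^sub>R B t x) \<bullet> M t x)))"

definition objective ::
  "real \<Rightarrow> (real^'n \<Rightarrow> real^'n) \<Rightarrow>
   (real \<Rightarrow> real^'n \<Rightarrow> real^'n) \<times> (real \<Rightarrow> real^'n \<Rightarrow> real^'n^'n) \<Rightarrow> ereal" where
  "objective T P0 = (\<lambda>(E, B). - K T E B - ereal (LINT (t, x):slab T|lborel. P0 x \<bullet> E t x))"


definition euler_solution ::
  "real \<Rightarrow> (real^'n \<Rightarrow> real^'n) \<Rightarrow> (real \<Rightarrow> real^'n \<Rightarrow> real^'n) \<Rightarrow> bool" where
  "euler_solution T P0 V \<longleftrightarrow>
     smooth_field T V \<and>
     (\<forall>t\<in>{0..T}. \<forall>x. divergence (V t) x = 0) \<and>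
     (\<exists>q. \<forall>t\<in>{0..T}. periodic (q t) \<and>
        (\<forall>x. q t differentiable at x \<and>
             dt T V t x + div_mat (\<lambda>y. outer (V t y) (V t y)) x = grad (q t) x)) \<and>
     V 0 = P0"

(* phi is determined only up to a function of time, so no regularity in time is imposed
   on it. *)
definition final_value_solution ::
  "real \<Rightarrow> (real \<Rightarrow> real^'n \<Rightarrow> real^'n) \<Rightarrow> (real \<Rightarrow> real^'n \<Rightarrow> real^'n) \<Rightarrow>
   (real \<Rightarrow> real^'n \<Rightarrow> real) \<Rightarrow> bool" where
  "final_value_solution T V A \<phi> \<longleftrightarrow>
     smooth_field T A \<and>
     (\<forall>t\<in>{0..T}. periodic (\<phi> t) \<and> (\<forall>x. \<phi> t differentiable at x)) \<and>
     (\<forall>t\<in>{0..T}. \<forall>x.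
        dt T A t x + (mat 1 + 2 *\<^sub>R sym_grad (A t) x) *v V t x + grad (\<phi> t) x = 0 \<and>
        divergence (A t) x = 0) \<and>
     (\<forall>x. A T x = 0)"

end

theory Submission
  imports Defs
begin

text \<open>The final-value problem has the explicit solution \<open>A = (T - t) V\<close>: up to gradients,
  \<open>V \<cdot> \<nabla>V\<close> is \<open>- \<partial>\<^sub>t V\<close> by the Euler equations, and \<open>(\<nabla>V)\<^sup>T V = \<nabla>(|V|\<^sup>2 / 2)\<close> vanishes. Uniqueness is
  an energy estimate. Hence \<open>B\<close> is of size \<open>T\<close>, which gives positivity for small \<open>T\<close>.

  For maximality, testing \<open>K\<close> with \<open>(Z, M) = (-V, V \<otimes> V)\<close> and the weak constraint with the time
  primitive of \<open>V \<otimes> V\<close> bounds the objective on the whole class by half the space-time integral of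
  \<open>|V|\<^sup>2\<close>. Since \<open>E = -(I + 2B)V\<close> and \<open>I + 2B\<close> is positive, completing the square in \<open>K\<close> shows that
  \<open>(E, B)\<close> attains this bound.\<close>

section \<open>Calculus of functions smooth up to the boundary\<close>

text \<open>The nonlocal operator in the constraint never has to be constructed. The divergence of
  the Euler equation at a fixed time shows that the mean of \<open>q\<close> minus \<open>q\<close>
  is the inverse negative Laplacian applied to the double divergence of V \<otimes> V. With V
  \<otimes> V as spatial test field, the multiplier of E in the weak constraint is therefore just
  the negative time derivative of V. Since the time test functions vanish at 0, the outcome is that
  B . (V \<otimes> V) + E . (V - P0) has integral zero, and this is what absorbs the P0 term of the
  objective.

  Uniqueness also serves maximality: the claim concerns an arbitrary solution A, while smallness of
  B is visible only on (T - t) V.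

  The potential \<phi> is merely differentiable in x and carries no regularity in t. It enters only
  through its spatial gradient, which the equation expresses by smooth fields.

  Smallness of B is measured entry by entry against 1/(4d). Then B . N is at most a quarter of the
  trace of N for every positive semidefinite N, so I + 2B keeps at least half of the
  identity.\<close>

definition axis_accessible :: "'a::euclidean_space set \<Rightarrow> bool" where
  "axis_accessible S \<longleftrightarrow>
     (\<forall>x\<in>S. \<forall>i\<in>Basis. \<forall>e>0. \<exists>d. 0 < \<bar>d\<bar> \<and> \<bar>d\<bar> < e \<and> x + d *\<^sub>R i \<in> S)"

lemma axis_accessible_UNIV: "axis_accessible UNIV"
  unfolding axis_accessible_def
proof (intro ballI allI impI)
  fix x i :: 'a and e :: real assume "0 < e"
  then show "\<exists>d. 0 < \<bar>d\<bar> \<and> \<bar>d\<bar> < e \<and> x + d *\<^sub>R i \<in> UNIV"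
    by (intro exI[of _ "e / 2"]) auto
qed

lemma axis_accessible_Icc:
  assumes "0 < T"
  shows "axis_accessible {0..T::real}"
  unfolding axis_accessible_def
proof (intro ballI allI impI)
  fix x i e :: real assume x: "x \<in> {0..T}" and "i \<in> Basis" and e: "e > 0"
  then have i: "i = 1" by simp
  show "\<exists>d. 0 < \<bar>d\<bar> \<and> \<bar>d\<bar> < e \<and> x + d *\<^sub>R i \<in> {0..T}"
  proof (cases "x \<le> T / 2")
    case True
    then show ?thesis using x e assms i by (intro exI[of _ "min (e/2) (T/2)"]) auto
  next
    case False
    then show ?thesis using x e assms i by (intro exI[of _ "- min (e/2) (T/2)"]) auto
  qed
qed

lemma axis_accessible_Times:
  assumes "axis_accessible S" "axis_accessible S'"
  shows "axis_accessible (S \<times> S')"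
  unfolding axis_accessible_def
proof (intro ballI allI impI)
  fix p :: "'a \<times> 'b" and i :: "'a \<times> 'b" and e :: real
  assume p: "p \<in> S \<times> S'" and i: "i \<in> Basis" and e: "e > 0"
  obtain x y where xy: "p = (x, y)" "x \<in> S" "y \<in> S'" using p by auto
  from i consider u where "u \<in> Basis" "i = (u, 0)" | v where "v \<in> Basis" "i = (0, v)"
    by (auto simp: Basis_prod_def)
  then show "\<exists>d. 0 < \<bar>d\<bar> \<and> \<bar>d\<bar> < e \<and> p + d *\<^sub>R i \<in> S \<times> S'"
  proof cases
    case 1
    then obtain d where "0 < \<bar>d\<bar>" "\<bar>d\<bar> < e" "x + d *\<^sub>R u \<in> S"
      using assms(1) xy(2) e unfolding axis_accessible_def by blast
    then show ?thesis using 1 xy by (intro exI[of _ d]) auto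
  next
    case 2
    then obtain d where "0 < \<bar>d\<bar>" "\<bar>d\<bar> < e" "y + d *\<^sub>R v \<in> S'"
      using assms(2) xy(3) e unfolding axis_accessible_def by blast
    then show ?thesis using 2 xy by (intro exI[of _ d]) auto
  qed
qed

lemma axis_accessible_slab: "0 < T \<Longrightarrow> axis_accessible ({0..T::real} \<times> (UNIV :: (real^'n) set))"
  by (intro axis_accessible_Times axis_accessible_Icc axis_accessible_UNIV)

text \<open>A derivative within S is determined once every point of S can be approached inside S
  along each basis direction; this is the purpose of \<open>axis_accessible\<close>. The increments
  may have either sign, so the end points of {0..T} qualify. Hence any derivative that can be
  exhibited is the one picked by \<open>frechet_derivative\<close>.\<close>

lemma frechet_derivative_within_eq:
  assumes "axis_accessible S" "x \<in> S" "(f has_derivative f') (at x within S)"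
  shows "frechet_derivative f (at x within S) = f'"
proof -
  have "(f has_derivative frechet_derivative f (at x within S)) (at x within S)"
    using assms(3) differentiableI frechet_derivative_works by blast
  then show ?thesis
    using assms unfolding axis_accessible_def
    by (intro frechet_derivative_unique_within[of f _ x S]) auto
qed

text \<open>Agreement on S alone suffices, because uniqueness makes the derivatives chosen for
  \<open>f\<close> and \<open>g\<close> coincide at every point of S, so the induction can pass to
  them.\<close>

lemma Ck_on_cong:
  assumes "axis_accessible S" "\<And>x. x \<in> S \<Longrightarrow> f x = g x" "Ck_on k S f"
  shows "Ck_on k S g"
  using assms(2,3)
proof (induction k arbitrary: f g)
  case 0
  then show ?case by (metis Ck_on.simps(1) continuous_on_cong)
next
  case (Suc k)
  have der: "(g has_derivative frechet_derivative f (at x within S)) (at x within S)" if "x \<in> S" for x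
  proof (rule has_derivative_transform[OF that])
    show "(f has_derivative frechet_derivative f (at x within S)) (at x within S)"
      using Suc.prems(2) that frechet_derivative_works by (auto simp: differentiable_on_def)
  qed (use Suc.prems(1) in auto)
  have "g differentiable_on S"
    using der by (auto simp: differentiable_on_def differentiable_def)
  moreover have "Ck_on k S (\<lambda>x. frechet_derivative g (at x within S) b)" if "b \<in> Basis" for b
  proof (rule Suc.IH)
    show "Ck_on k S (\<lambda>x. frechet_derivative f (at x within S) b)"
      using Suc.prems(2) that by simp
  qed (use frechet_derivative_within_eq[OF assms(1) _ der] in auto)
  ultimately show ?case by simp
qed

text \<open>Removes the choice operator: an explicit derivative \<open>f'\<close> may stand in for
  the chosen one. Closure under linear and bilinear operations and under affine substitution is
  proved by induction on k through this rule.\<close>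

lemma Ck_on_SucI:
  assumes "axis_accessible S" "\<And>x. x \<in> S \<Longrightarrow> (f has_derivative f' x) (at x within S)"
    and "\<And>b. b \<in> Basis \<Longrightarrow> Ck_on k S (\<lambda>x. f' x b)"
  shows "Ck_on (Suc k) S f"
proof -
  have "f differentiable_on S"
    using assms(2) by (auto simp: differentiable_on_def differentiable_def)
  moreover have "Ck_on k S (\<lambda>x. frechet_derivative f (at x within S) b)" if "b \<in> Basis" for b
    by (rule Ck_on_cong[OF assms(1) _ assms(3)[OF that]])
       (simp add: frechet_derivative_within_eq[OF assms(1) _ assms(2)])
  ultimately show ?thesis by simp
qed

lemma Ck_on_SucD_derivative:
  assumes "Ck_on (Suc k) S f" "x \<in> S"
  shows "(f has_derivative frechet_derivative f (at x within S)) (at x within S)"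
  using assms frechet_derivative_works by (auto simp: differentiable_on_def)

lemma Ck_on_Suc_imp: "Ck_on (Suc k) S f \<Longrightarrow> Ck_on k S f"
  by (induction k arbitrary: f) (auto simp: differentiable_imp_continuous_on)

lemma Ck_on_imp_continuous: "Ck_on k S f \<Longrightarrow> continuous_on S f"
  by (induction k) (auto simp: differentiable_imp_continuous_on)

lemma Ck_on_const: "axis_accessible S \<Longrightarrow> Ck_on k S (\<lambda>x. c)"
proof (induction k arbitrary: c)
  case (Suc k)
  show ?case by (rule Ck_on_SucI[where f' = "\<lambda>x b. 0", OF Suc.prems]) (use Suc in auto)
qed simp

lemma Ck_on_bounded_linear:
  assumes "bounded_linear L" "axis_accessible S"
  shows "Ck_on k S f \<Longrightarrow> Ck_on k S (\<lambda>x. L (f x))"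
proof (induction k arbitrary: f)
  case 0
  then show ?case using bounded_linear.continuous_on[OF assms(1)] by auto
next
  case (Suc k)
  show ?case
  proof (rule Ck_on_SucI[OF assms(2)])
    fix x assume "x \<in> S"
    from Ck_on_SucD_derivative[OF Suc.prems this]
    show "((\<lambda>x. L (f x)) has_derivative (\<lambda>b. L (frechet_derivative f (at x within S) b))) (at x within S)"
      by (rule bounded_linear.has_derivative[OF assms(1)])
  qed (use Suc in auto)
qed

lemma Ck_on_add:
  assumes "axis_accessible S"
  shows "Ck_on k S f \<Longrightarrow> Ck_on k S g \<Longrightarrow> Ck_on k S (\<lambda>x. f x + g x)"
proof (induction k arbitrary: f g)
  case 0
  then show ?case by (auto intro: continuous_on_add)
next
  case (Suc k)
  show ?case
  proof (rule Ck_on_SucI[OF assms])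
    fix x assume "x \<in> S"
    from has_derivative_add[OF Ck_on_SucD_derivative[OF Suc.prems(1) this]
        Ck_on_SucD_derivative[OF Suc.prems(2) this]]
    show "((\<lambda>x. f x + g x) has_derivative (\<lambda>b. frechet_derivative f (at x within S) b
       + frechet_derivative g (at x within S) b)) (at x within S)" .
  qed (use Suc in auto)
qed

lemma Ck_on_sum:
  assumes "axis_accessible S" "finite I" "\<And>i. i \<in> I \<Longrightarrow> Ck_on k S (f i)"
  shows "Ck_on k S (\<lambda>x. \<Sum>i\<in>I. f i x)"
  using assms(2,3) by (induction I rule: finite_induct) (auto intro: Ck_on_const Ck_on_add assms(1))

lemma Ck_on_bounded_bilinear:
  fixes f :: "'d::euclidean_space \<Rightarrow> 'a::real_normed_vector" and g :: "'d \<Rightarrow> 'b::real_normed_vector"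
  assumes "bounded_bilinear pr" "axis_accessible S"
  shows "Ck_on k S f \<Longrightarrow> Ck_on k S g \<Longrightarrow> Ck_on k S (\<lambda>x. pr (f x) (g x))"
proof (induction k arbitrary: f g)
  case 0
  then show ?case using bounded_bilinear.continuous_on[OF assms(1)] by auto
next
  case (Suc k)
  show ?case
  proof (rule Ck_on_SucI[OF assms(2)])
    fix x assume "x \<in> S"
    from bounded_bilinear.FDERIV[OF assms(1) Ck_on_SucD_derivative[OF Suc.prems(1) this]
        Ck_on_SucD_derivative[OF Suc.prems(2) this]]
    show "((\<lambda>x. pr (f x) (g x)) has_derivative (\<lambda>b. pr (f x) (frechet_derivative g (at x within S) b)
       + pr (frechet_derivative f (at x within S) b) (g x))) (at x within S)" .
  next
    fix b :: 'd assume "b \<in> Basis"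
    then show "Ck_on k S (\<lambda>x. pr (f x) (frechet_derivative g (at x within S) b)
       + pr (frechet_derivative f (at x within S) b) (g x))"
      using Suc by (intro Ck_on_add[OF assms(2)] Suc.IH) (auto intro: Ck_on_Suc_imp)
  qed
qed

text \<open>Affine inner maps cover time slices, fields constant in time and restriction to smaller
  sets. They spare the higher chain rule: the derivative in direction e is a combination of the
  directional derivatives of F with coefficients \<open>L e \<bullet> b\<close> that do not depend
  on the point, so the induction hypothesis applies to each summand.\<close>

lemma Ck_on_compose_affine:
  fixes L :: "'c::euclidean_space \<Rightarrow> 'a::euclidean_space" and F :: "'a \<Rightarrow> 'b::real_normed_vector"
  assumes L: "bounded_linear L" and S: "axis_accessible S'" "\<And>y. y \<in> S' \<Longrightarrow> c + L y \<in> S"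
  shows "Ck_on k S F \<Longrightarrow> Ck_on k S' (\<lambda>y. F (c + L y))"
proof (induction k arbitrary: F)
  case 0
  have "continuous_on S' (\<lambda>y. c + L y)"
    using bounded_linear.continuous_on[OF L continuous_on_id] by (intro continuous_intros) auto
  then show ?case using 0 S(2) by (auto intro: continuous_on_compose2[of S F S'])
next
  case (Suc k)
  define D where "D p = frechet_derivative F (at p within S)" for p
  have DF: "(F has_derivative D p) (at p within S)" if "p \<in> S" for p
    using Ck_on_SucD_derivative[OF Suc.prems that] by (simp add: D_def)
  have sum: "D p (L e) = (\<Sum>b\<in>Basis. (L e \<bullet> b) *\<^sub>R D p b)" if "p \<in> S" for p e
  proof -
    interpret bounded_linear "D p" using DF[OF that] by (rule has_derivative_bounded_linear)
    have "D p (L e) = D p (\<Sum>b\<in>Basis. (L e \<bullet> b) *\<^sub>R b)" by (simp add: euclidean_representation)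
    also have "\<dots> = (\<Sum>b\<in>Basis. (L e \<bullet> b) *\<^sub>R D p b)" by (simp add: sum scaleR)
    finally show ?thesis .
  qed
  show ?case
  proof (rule Ck_on_SucI[OF S(1)])
    fix y assume y: "y \<in> S'"
    have "((\<lambda>y. c + L y) has_derivative L) (at y within S')"
      using has_derivative_add[OF has_derivative_const[of c]
          bounded_linear.has_derivative[OF L has_derivative_ident]] by simp
    from has_derivative_in_compose2[OF DF _ y this]
    show "((\<lambda>y. F (c + L y)) has_derivative (\<lambda>e. D (c + L y) (L e))) (at y within S')"
      using S(2) by auto
  next
    fix e :: 'c assume "e \<in> Basis"
    have "Ck_on k S' (\<lambda>y. \<Sum>b\<in>Basis. (L e \<bullet> b) *\<^sub>R D (c + L y) b)"
      using Suc by (intro Ck_on_sum S(1) Ck_on_bounded_linear[OF bounded_linear_scaleR_right]) (auto simp: D_def)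
    then show "Ck_on k S' (\<lambda>y. D (c + L y) (L e))"
      by (rule Ck_on_cong[OF S(1), rotated]) (simp add: sum S(2))
  qed
qed

lemma smooth_on_SucI:
  assumes "axis_accessible S" "\<And>x. x \<in> S \<Longrightarrow> (f has_derivative f' x) (at x within S)"
    and "\<And>b. b \<in> Basis \<Longrightarrow> smooth_on S (\<lambda>x. f' x b)"
  shows "smooth_on S f"
  unfolding smooth_on_def
proof
  fix k
  show "Ck_on k S f"
    by (rule Ck_on_Suc_imp, rule Ck_on_SucI[OF assms(1,2)]) (use assms(3) in \<open>auto simp: smooth_on_def\<close>)
qed

lemma smooth_on_has_derivative:
  "smooth_on S f \<Longrightarrow> x \<in> S \<Longrightarrow>
    (f has_derivative frechet_derivative f (at x within S)) (at x within S)"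
  unfolding smooth_on_def using Ck_on_SucD_derivative by blast

lemma smooth_on_frechet_derivative:
  assumes "axis_accessible S" "smooth_on S f"
  shows "smooth_on S (\<lambda>x. frechet_derivative f (at x within S) v)"
  unfolding smooth_on_def
proof
  fix k
  have ck: "Ck_on (Suc k) S f" using assms(2) by (simp add: smooth_on_def)
  have "Ck_on k S (\<lambda>x. \<Sum>b\<in>Basis. (v \<bullet> b) *\<^sub>R frechet_derivative f (at x within S) b)"
    using ck by (intro Ck_on_sum assms(1) Ck_on_bounded_linear[OF bounded_linear_scaleR_right]) auto
  then show "Ck_on k S (\<lambda>x. frechet_derivative f (at x within S) v)"
  proof (rule Ck_on_cong[OF assms(1), rotated])
    fix x assume "x \<in> S"
    then interpret bounded_linear "frechet_derivative f (at x within S)"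
      using smooth_on_has_derivative[OF assms(2)] has_derivative_bounded_linear by blast
    have "frechet_derivative f (at x within S) v = frechet_derivative f (at x within S) (\<Sum>b\<in>Basis. (v \<bullet> b) *\<^sub>R b)"
      by (simp add: euclidean_representation)
    also have "\<dots> = (\<Sum>b\<in>Basis. (v \<bullet> b) *\<^sub>R frechet_derivative f (at x within S) b)"
      by (simp add: sum scaleR)
    finally show "(\<Sum>b\<in>Basis. (v \<bullet> b) *\<^sub>R frechet_derivative f (at x within S) b) =
      frechet_derivative f (at x within S) v" by simp
  qed
qed

lemma smooth_on_imp_continuous: "smooth_on S f \<Longrightarrow> continuous_on S f"
  unfolding smooth_on_def using Ck_on_imp_continuous by blast

lemma smooth_on_cong:
  "axis_accessible S \<Longrightarrow> (\<And>x. x \<in> S \<Longrightarrow> f x = g x) \<Longrightarrow> smooth_on S f \<Longrightarrow> smooth_on S g"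
  unfolding smooth_on_def using Ck_on_cong by blast

lemma smooth_on_const: "axis_accessible S \<Longrightarrow> smooth_on S (\<lambda>x. c)"
  by (simp add: smooth_on_def Ck_on_const)

lemma smooth_on_bounded_linear:
  "bounded_linear L \<Longrightarrow> axis_accessible S \<Longrightarrow> smooth_on S f \<Longrightarrow> smooth_on S (\<lambda>x. L (f x))"
  by (simp add: smooth_on_def Ck_on_bounded_linear)

lemma smooth_on_add:
  "axis_accessible S \<Longrightarrow> smooth_on S f \<Longrightarrow> smooth_on S g \<Longrightarrow> smooth_on S (\<lambda>x. f x + g x)"
  by (simp add: smooth_on_def Ck_on_add)

lemma smooth_on_minus:
  "axis_accessible S \<Longrightarrow> smooth_on S f \<Longrightarrow> smooth_on S (\<lambda>x. - f x)"
  using smooth_on_bounded_linear[OF bounded_linear_minus[OF bounded_linear_ident]] by blast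

lemma smooth_on_diff:
  "axis_accessible S \<Longrightarrow> smooth_on S f \<Longrightarrow> smooth_on S g \<Longrightarrow> smooth_on S (\<lambda>x. f x - g x)"
  using smooth_on_add[OF _ _ smooth_on_minus] by fastforce

lemma smooth_on_sum:
  "axis_accessible S \<Longrightarrow> finite I \<Longrightarrow> (\<And>i. i \<in> I \<Longrightarrow> smooth_on S (f i)) \<Longrightarrow> smooth_on S (\<lambda>x. \<Sum>i\<in>I. f i x)"
  by (simp add: smooth_on_def Ck_on_sum)

lemma smooth_on_bounded_bilinear:
  "bounded_bilinear pr \<Longrightarrow> axis_accessible S \<Longrightarrow> smooth_on S f \<Longrightarrow> smooth_on S g \<Longrightarrow>
    smooth_on S (\<lambda>x. pr (f x) (g x))"
  by (simp add: smooth_on_def Ck_on_bounded_bilinear)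

lemma smooth_on_compose_affine:
  fixes L :: "'c::euclidean_space \<Rightarrow> 'a::euclidean_space"
  shows "bounded_linear L \<Longrightarrow> axis_accessible S' \<Longrightarrow> (\<And>y. y \<in> S' \<Longrightarrow> c + L y \<in> S) \<Longrightarrow> smooth_on S F \<Longrightarrow>
    smooth_on S' (\<lambda>y. F (c + L y))"
  unfolding smooth_on_def using Ck_on_compose_affine by blast

text \<open>Since derivatives are taken within the set, shrinking the set changes them formally;
  restriction is handled as substitution of the identity map.\<close>

lemma smooth_on_subset:
  "smooth_on S f \<Longrightarrow> axis_accessible S' \<Longrightarrow> S' \<subseteq> S \<Longrightarrow> smooth_on S' f"
  using smooth_on_compose_affine[OF bounded_linear_ident, of S' 0 S f] by auto

lemma smooth_on_bounded_linear_self: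
  "bounded_linear L \<Longrightarrow> axis_accessible S \<Longrightarrow> smooth_on S L"
  by (rule smooth_on_SucI[where f' = "\<lambda>x. L"]) (auto intro: bounded_linear_imp_has_derivative smooth_on_const)

section \<open>Periodic functions on the unit cube\<close>

lemma partial_eq: "(f has_derivative f') (at x) \<Longrightarrow> partial i f x = f' (axis i 1)"
  by (simp add: partial_def frechet_derivative_at[symmetric])

lemma has_derivative_partial:
  fixes f :: "real^'n \<Rightarrow> real"
  assumes "f differentiable at x"
  shows "(f has_derivative (\<lambda>h. \<Sum>i\<in>UNIV. h $ i * partial i f x)) (at x)"
proof -
  have d: "(f has_derivative frechet_derivative f (at x)) (at x)"
    using assms frechet_derivative_works by blast
  interpret bounded_linear "frechet_derivative f (at x)" using d by (rule has_derivative_bounded_linear)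
  have "frechet_derivative f (at x) h = (\<Sum>i\<in>UNIV. h $ i * partial i f x)" for h
  proof -
    have "frechet_derivative f (at x) h = frechet_derivative f (at x) (\<Sum>i\<in>UNIV. (h $ i) *\<^sub>R axis i 1)"
      using basis_expansion[of h] by (simp add: scalar_mult_eq_scaleR)
    then show ?thesis by (simp add: sum scaleR partial_def)
  qed
  then have "frechet_derivative f (at x) = (\<lambda>h. \<Sum>i\<in>UNIV. h $ i * partial i f x)" by (rule ext)
  with d show ?thesis by metis
qed

lemma partial_const [simp]: "partial i (\<lambda>x. c) x = 0"
  by (simp add: partial_def)

lemma partial_add:
  assumes "f differentiable at x" "g differentiable at x"
  shows "partial i (\<lambda>x. f x + g x) x = partial i f x + partial i g x"
  using partial_eq[OF has_derivative_add[OF assms(1)[THEN frechet_derivative_works[THEN iffD1]] assms(2)[THEN frechet_derivative_works[THEN iffD1]]]] by (simp add: partial_def)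

lemma partial_diff:
  assumes "f differentiable at x" "g differentiable at x"
  shows "partial i (\<lambda>x. f x - g x) x = partial i f x - partial i g x"
  using partial_eq[OF has_derivative_diff[OF assms(1)[THEN frechet_derivative_works[THEN iffD1]] assms(2)[THEN frechet_derivative_works[THEN iffD1]]]] by (simp add: partial_def)

lemma partial_mult:
  assumes "f differentiable at x" "g differentiable at x"
  shows "partial i (\<lambda>x. f x * g x) x = f x * partial i g x + partial i f x * g x"
  using partial_eq[OF has_derivative_mult[OF assms(1)[THEN frechet_derivative_works[THEN iffD1]] assms(2)[THEN frechet_derivative_works[THEN iffD1]]]] by (simp add: partial_def)

lemma partial_minus:
  assumes "f differentiable at x"
  shows "partial i (\<lambda>x. - f x) x = - partial i f x"
  using partial_eq[OF has_derivative_minus[OF assms[THEN frechet_derivative_works[THEN iffD1]]]] by (simp add: partial_def)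

lemma partial_cmult:
  assumes "f differentiable at x"
  shows "partial i (\<lambda>x. c * f x) x = c * partial i f x"
  using partial_mult[of "\<lambda>x. c" x f i] assms by simp

lemma partial_sum:
  assumes "finite I" "\<And>j. j \<in> I \<Longrightarrow> f j differentiable at x"
  shows "partial i (\<lambda>x. \<Sum>j\<in>I. f j x) x = (\<Sum>j\<in>I. partial i (f j) x)"
proof -
  have "((\<lambda>x. \<Sum>j\<in>I. f j x) has_derivative (\<lambda>h. \<Sum>j\<in>I. frechet_derivative (f j) (at x) h)) (at x)"
    using assms(2) frechet_derivative_works by (intro has_derivative_sum) blast
  from partial_eq[OF this] show ?thesis by (simp add: partial_def)
qed

text \<open>Differentiability plays no part: a translation by a lattice vector carries the possible
  derivatives at one point exactly to those at the other, so the choice operator picks the same map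
  at both, even when there is none.\<close>

lemma periodic_partial:
  fixes f :: "real^'n \<Rightarrow> real"
  assumes "periodic f"
  shows "periodic (partial j f)"
proof -
  have "frechet_derivative f (at (x + axis i 1)) = frechet_derivative f (at x)" for x :: "real^'n" and i
  proof -
    have f: "f (y + axis i 1) = f y" "f (y - axis i 1) = f y" for y
      using assms[unfolded periodic_def] by (metis diff_add_cancel)+
    have "(f has_derivative D) (at (x + axis i 1)) \<longleftrightarrow> (f has_derivative D) (at x)" for D
    proof
      assume "(f has_derivative D) (at (x + axis i 1))"
      from has_derivative_compose[where f = "\<lambda>y. y + axis i 1" and f' = "\<lambda>h. h" and s = UNIV, OF has_derivative_add_const[OF has_derivative_ident] this]
      show "(f has_derivative D) (at x)" using f by simp
    next
      assume "(f has_derivative D) (at x)"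
      then have "(f has_derivative D) (at ((x + axis i 1) - axis i 1))" by simp
      from has_derivative_compose[where f = "\<lambda>y. y - axis i 1" and f' = "\<lambda>h. h" and s = UNIV, OF has_derivative_add_const[OF has_derivative_ident, of "- axis i 1", unfolded add_uminus_conv_diff] this]
      show "(f has_derivative D) (at (x + axis i 1))" using f by simp
    qed
    then show ?thesis by (simp add: frechet_derivative_def)
  qed
  then show ?thesis by (simp add: periodic_def partial_def)
qed

lemma periodic_int_shift:
  assumes "periodic f"
  shows "f (x + of_int k *\<^sub>R axis i 1) = f x"
proof (induction k rule: int_induct[where k = 0])
  case base
  then show ?case by simp
next
  case (step1 k)
  then show ?case using assms[unfolded periodic_def, rule_format, of "x + of_int k *\<^sub>R axis i 1" i]
    by (simp add: algebra_simps)
next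
  case (step2 k)
  then show ?case using assms[unfolded periodic_def, rule_format, of "x + of_int (k - 1) *\<^sub>R axis i 1" i]
    by (simp add: algebra_simps)
qed

text \<open>The representative is the vector of fractional parts, reached by integer shifts in one
  coordinate after another.\<close>

lemma periodic_reduce_to_cube:
  fixes x :: "real^'n"
  obtains y where "y \<in> cube" "\<And>f. periodic f \<Longrightarrow> f y = f x"
proof -
  let ?y = "\<lambda>I. x + (\<Sum>i\<in>I. of_int (- \<lfloor>x $ i\<rfloor>) *\<^sub>R axis i 1)"
  have per: "f (?y I) = f x" if "finite I" "periodic f" for I and f :: "real^'n \<Rightarrow> 'c"
    using that(1)
  proof (induction I rule: finite_induct)
    case (insert i I)
    have "f (?y (insert i I)) = f (?y I + of_int (- \<lfloor>x $ i\<rfloor>) *\<^sub>R axis i 1)"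
      using insert.hyps by (simp add: algebra_simps)
    with insert.IH show ?case using periodic_int_shift[OF that(2)] by metis
  qed simp
  have "?y UNIV = (\<chi> i. frac (x $ i))"
    by (simp add: vec_eq_iff frac_def axis_def if_distrib sum.delta cong: if_cong)
  then have "?y UNIV \<in> cube" by (simp add: cube_def less_imp_le[OF frac_lt_1])
  with per[of UNIV] show thesis by (intro that[of "?y UNIV"]) auto
qed

lemma cube_eq_cbox: "(cube :: (real^'n) set) = cbox 0 1"
  by (auto simp: cube_def mem_box_cart)

lemma box_01_nonempty: "box 0 (1::real^'n) \<noteq> {}"
proof -
  have "(\<chi> i. 1/2) \<in> box 0 (1::real^'n)" by (simp add: mem_box_cart)
  then show ?thesis by blast
qed

lemma integrable_continuous_cube:
  fixes f :: "real^'n \<Rightarrow> 'b::euclidean_space"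
  shows "continuous_on UNIV f \<Longrightarrow> f integrable_on cube"
  by (metis cube_eq_cbox continuous_on_subset integrable_continuous top_greatest)

text \<open>The box that is stretched to length 1 + s in direction k is cut in two ways, at height 1
  and at height s. Each cut leaves a unit cube, original or translated, and a slab of thickness s.
  The two slabs differ by one period, so the integrals over the two cubes agree.\<close>

lemma integral_cube_translate:
  fixes f :: "real^'n \<Rightarrow> real"
  assumes "periodic f" "continuous_on UNIV f" "0 \<le> s" "s \<le> 1"
  shows "integral cube (\<lambda>x. f (x + s *\<^sub>R axis k 1)) = integral cube f"
proof -
  let ?e = "axis k 1 :: real^'n"
  have int: "f integrable_on cbox a b" for a b
    using assms(2) continuous_on_subset integrable_continuous by blast
  have e: "?e \<in> Basis" "\<And>x. x \<bullet> ?e = x $ k" by (auto simp: inner_axis)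
  have "integral (cbox 0 1) (\<lambda>x. f (x + s *\<^sub>R ?e)) = integral (cbox (s *\<^sub>R ?e) (1 + s *\<^sub>R ?e)) f"
    using integral_shift_cbox[of "s *\<^sub>R ?e" "s *\<^sub>R ?e" "1 + s *\<^sub>R ?e" f] by simp
  moreover have "integral (cbox 0 (1 + s *\<^sub>R ?e)) f =
     integral (cbox 0 1) f + integral (cbox ?e (1 + s *\<^sub>R ?e)) f"
  proof -
    have "cbox 0 (1 + s *\<^sub>R ?e) \<inter> {x. x \<bullet> ?e \<le> 1} = cbox 0 1"
      "cbox 0 (1 + s *\<^sub>R ?e) \<inter> {x. x \<bullet> ?e \<ge> 1} = cbox ?e (1 + s *\<^sub>R ?e)"
      using assms(3) unfolding e(2) interval_split_cart(1)[unfolded interval_cbox_cart] interval_split_cart(2)[unfolded interval_cbox_cart]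
      by (auto intro!: arg_cong2[of _ _ _ _ cbox] simp: vec_eq_iff axis_def)
    then show ?thesis using integral_split[OF int e(1), of 0 "1 + s *\<^sub>R ?e" 1] by simp
  qed
  moreover have "integral (cbox 0 (1 + s *\<^sub>R ?e)) f =
     integral (cbox 0 (1 + s *\<^sub>R ?e - ?e)) f + integral (cbox (s *\<^sub>R ?e) (1 + s *\<^sub>R ?e)) f"
  proof -
    have "cbox 0 (1 + s *\<^sub>R ?e) \<inter> {x. x \<bullet> ?e \<le> s} = cbox 0 (1 + s *\<^sub>R ?e - ?e)"
      "cbox 0 (1 + s *\<^sub>R ?e) \<inter> {x. x \<bullet> ?e \<ge> s} = cbox (s *\<^sub>R ?e) (1 + s *\<^sub>R ?e)"
      using assms(3,4) unfolding e(2) interval_split_cart(1)[unfolded interval_cbox_cart] interval_split_cart(2)[unfolded interval_cbox_cart]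
      by (auto intro!: arg_cong2[of _ _ _ _ cbox] simp: vec_eq_iff axis_def)
    then show ?thesis using integral_split[OF int e(1), of 0 "1 + s *\<^sub>R ?e" s] by simp
  qed
  moreover have "integral (cbox ?e (1 + s *\<^sub>R ?e)) f = integral (cbox 0 (1 + s *\<^sub>R ?e - ?e)) f"
    using integral_shift_cbox[of ?e ?e "1 + s *\<^sub>R ?e" f] assms(1) by (simp add: periodic_def)
  ultimately show ?thesis by (simp add: cube_eq_cbox)
qed

text \<open>The regularity that integration by parts on the torus requires. A class below smoothness
  is used because \<phi> is only assumed differentiable in x; continuity of its partial derivatives
  is read off from the equation.\<close>

definition C1_periodic :: "(real^'n \<Rightarrow> real) \<Rightarrow> bool" where
  "C1_periodic f \<longleftrightarrow> periodic f \<and> (\<forall>x. f differentiable at x) \<and> (\<forall>i. continuous_on UNIV (partial i f))"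

lemma C1_periodicD:
  assumes "C1_periodic f"
  shows "periodic f" "f differentiable at x" "continuous_on UNIV f" "continuous_on UNIV (partial i f)"
    "f integrable_on cube" "partial i f integrable_on cube"
proof -
  show "periodic f" "f differentiable at x" and d: "continuous_on UNIV (partial i f)"
    using assms by (auto simp: C1_periodic_def)
  show c: "continuous_on UNIV f"
    using assms by (auto simp: C1_periodic_def continuous_on_eq_continuous_at differentiable_imp_continuous_within)
  show "f integrable_on cube" "partial i f integrable_on cube"
    using c d integrable_continuous_cube by auto
qed

lemma C1_periodic_const: "C1_periodic (\<lambda>x :: real^'n. c)"
proof -
  have "partial i (\<lambda>x. c) = (\<lambda>x. 0)" for i :: 'n by (rule ext) simp
  then show ?thesis by (simp add: C1_periodic_def periodic_def)
qed

lemma C1_periodic_add: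
  assumes f: "C1_periodic f" and g: "C1_periodic g"
  shows "C1_periodic (\<lambda>x. f x + g x)"
proof -
  note F = C1_periodicD[OF f] and G = C1_periodicD[OF g]
  have "partial i (\<lambda>x. f x + g x) = (\<lambda>x. partial i f x + partial i g x)" for i
    using F(2) G(2) by (intro ext partial_add) auto
  then show ?thesis using F G by (auto simp: C1_periodic_def periodic_def intro!: continuous_intros)
qed

lemma C1_periodic_mult:
  assumes f: "C1_periodic f" and g: "C1_periodic g"
  shows "C1_periodic (\<lambda>x. f x * g x)"
proof -
  note F = C1_periodicD[OF f] and G = C1_periodicD[OF g]
  have "partial i (\<lambda>x. f x * g x) = (\<lambda>x. f x * partial i g x + partial i f x * g x)" for i
    using F(2) G(2) by (intro ext partial_mult) auto
  then show ?thesis using F G by (auto simp: C1_periodic_def periodic_def intro!: continuous_intros)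
qed

lemma C1_periodic_cmult: "C1_periodic f \<Longrightarrow> C1_periodic (\<lambda>x. c * f x)"
  using C1_periodic_mult[OF C1_periodic_const] .

lemma C1_periodic_sum:
  "finite I \<Longrightarrow> (\<And>i. i \<in> I \<Longrightarrow> C1_periodic (f i)) \<Longrightarrow> C1_periodic (\<lambda>x. \<Sum>i\<in>I. f i x)"
  by (induction I rule: finite_induct) (auto intro: C1_periodic_const C1_periodic_add)

text \<open>The integral over the cube of the translate by s in direction k does not depend on s;
  differentiating under the integral at s = 0 gives the claim. The derivative is one-sided because
  translation invariance was proved for s in [0,1].\<close>

lemma integral_partial_eq_0:
  fixes f :: "real^'n \<Rightarrow> real"
  assumes "C1_periodic f"
  shows "integral cube (partial k f) = 0"
proof -
  note F = C1_periodicD[OF assms]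
  let ?e = "axis k 1 :: real^'n"
  have der: "((\<lambda>s. f (x + s *\<^sub>R ?e)) has_vector_derivative partial k f (x + s *\<^sub>R ?e)) (at s within {0..1})" for x s
  proof -
    have "(f has_derivative frechet_derivative f (at (x + s *\<^sub>R ?e))) (at (x + s *\<^sub>R ?e))"
      using F(2) frechet_derivative_works by blast
    from has_derivative_compose[where f = "\<lambda>s. x + s *\<^sub>R ?e" and f' = "\<lambda>h. h *\<^sub>R ?e" and s = "{0..1}", OF _ this]
    have "((\<lambda>s. f (x + s *\<^sub>R ?e)) has_derivative (\<lambda>h. frechet_derivative f (at (x + s *\<^sub>R ?e)) (h *\<^sub>R ?e))) (at s within {0..1})"
      using has_derivative_add[OF has_derivative_const has_derivative_scaleR_left[OF has_derivative_ident]]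
      by fastforce
    moreover have "linear (frechet_derivative f (at (x + s *\<^sub>R ?e)))"
      using F(2) linear_frechet_derivative by blast
    ultimately show ?thesis
      by (simp add: has_vector_derivative_def partial_def linear_cmul)
  qed
  have A: "((\<lambda>s. integral (cbox 0 1) (\<lambda>x. f (x + s *\<^sub>R ?e))) has_vector_derivative
      integral (cbox 0 1) (\<lambda>x. partial k f (x + 0 *\<^sub>R ?e))) (at 0 within {0..1})"
  proof (rule leibniz_rule_vector_derivative)
    show "continuous_on ({0..1} \<times> cbox 0 1) (\<lambda>(s, x). partial k f (x + s *\<^sub>R ?e))"
      unfolding case_prod_unfold
      by (rule continuous_on_compose2[OF F(4)]) (auto intro!: continuous_intros)
    show "(\<lambda>x. f (x + s *\<^sub>R ?e)) integrable_on cbox 0 1" for s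
      by (rule integrable_continuous, rule continuous_on_compose2[OF F(3)]) (auto intro!: continuous_intros)
  qed (use der in auto)
  have B: "integral cube f = integral (cbox 0 1) (\<lambda>x. f (x + s *\<^sub>R ?e))" if "s \<in> {0..1}" for s
    using integral_cube_translate[OF F(1,3), of s k] that by (simp add: cube_eq_cbox)
  have "((\<lambda>s::real. integral cube f) has_vector_derivative integral cube (partial k f)) (at (0::real) within {0..1})"
    using has_vector_derivative_transform[OF _ B A] by (simp add: cube_eq_cbox)
  from vector_derivative_unique_within_closed_interval[where a = 0 and b = "1::real", unfolded box_real, OF _ _ this has_vector_derivative_const]
  show ?thesis by simp
qed

lemma integral_by_parts_torus:
  assumes f: "C1_periodic f" and g: "C1_periodic g"
  shows "integral cube (\<lambda>x. f x * partial k g x) = - integral cube (\<lambda>x. partial k f x * g x)"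
proof -
  note F = C1_periodicD[OF f] and G = C1_periodicD[OF g]
  have "0 = integral cube (\<lambda>x. f x * partial k g x + partial k f x * g x)"
    using integral_partial_eq_0[OF C1_periodic_mult[OF f g], of k] partial_mult[OF F(2) G(2)]
    by (metis (mono_tags, lifting) integral_cong)
  also have "\<dots> = integral cube (\<lambda>x. f x * partial k g x) + integral cube (\<lambda>x. partial k f x * g x)"
    using F G by (intro integral_add integrable_continuous_cube continuous_intros) auto
  finally show ?thesis by simp
qed

lemma integral_inner_grad:
  fixes u :: "real^'n \<Rightarrow> real^'n"
  assumes u: "\<And>i. C1_periodic (\<lambda>x. u x $ i)" and f: "C1_periodic f"
  shows "integral cube (\<lambda>x. u x \<bullet> grad f x) = - integral cube (\<lambda>x. divergence u x * f x)"
proof -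
  note F = C1_periodicD[OF f] and U = C1_periodicD[OF u]
  have "integral cube (\<lambda>x. u x \<bullet> grad f x) = (\<Sum>i\<in>UNIV. integral cube (\<lambda>x. u x $ i * partial i f x))"
    unfolding inner_vec_def grad_def inner_real_def vec_lambda_beta using F U
    by (intro integral_sum integrable_continuous_cube continuous_on_mult) auto
  also have "\<dots> = (\<Sum>i\<in>UNIV. - integral cube (\<lambda>x. partial i (\<lambda>x. u x $ i) x * f x))"
    using integral_by_parts_torus[OF u f] by simp
  also have "\<dots> = - integral cube (\<lambda>x. divergence u x * f x)"
    unfolding divergence_def sum_distrib_right sum_negf using F U
    by (intro arg_cong[of _ _ uminus] integral_sum[symmetric] integrable_continuous_cube continuous_intros) auto
  finally show ?thesis .
qed

text \<open>The orthogonality of gradients and divergence-free fields, by which the potentials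
  \<phi> and \<theta> drop out of the integrals below.\<close>

lemma integral_inner_grad_div_free:
  assumes "\<And>i. C1_periodic (\<lambda>x. u x $ i)" "C1_periodic f" "\<And>x. divergence u x = 0"
  shows "integral cube (\<lambda>x. u x \<bullet> grad f x) = 0"
  using integral_inner_grad[OF assms(1,2)] assms(3) by simp

lemma integral_cube_eq_0_imp:
  assumes "continuous_on UNIV f" "\<And>x. 0 \<le> f x" "periodic f" "integral cube f = (0::real)"
  shows "f x = 0"
proof -
  obtain y where y: "y \<in> cube" "f y = f x" using periodic_reduce_to_cube assms(3) by metis
  have "(f has_integral 0) (cbox 0 1)"
    using assms(4) integrable_continuous_cube[OF assms(1)] by (metis cube_eq_cbox integrable_integral)
  then have "f y = 0"
    using has_integral_0_cbox_imp_0[of 0 1 f y] assms(1,2) y(1) box_01_nonempty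
    by (auto simp: cube_eq_cbox intro: continuous_on_subset)
  with y show ?thesis by simp
qed

section \<open>Smooth fields on the slab\<close>

lemma smooth_fieldD:
  assumes "smooth_field T u"
  shows "smooth_on ({0..T} \<times> UNIV) (\<lambda>(t, x). u t x)" "t \<in> {0..T} \<Longrightarrow> periodic (u t)"
  using assms by (auto simp: smooth_field_def)

lemma smooth_field_has_derivative:
  fixes u :: "real \<Rightarrow> real^'n \<Rightarrow> 'b::real_normed_vector"
  assumes u: "smooth_field T u" and t: "t \<in> {0..T}"
  shows "(u t has_derivative (\<lambda>h. frechet_derivative (\<lambda>(t, x). u t x) (at (t, x) within {0..T} \<times> UNIV) (0, h))) (at x)"
proof -
  have "((\<lambda>y. (t, y)) has_derivative (\<lambda>h. (0, h))) (at x within UNIV)"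
    by (intro has_derivative_Pair has_derivative_const has_derivative_ident)
  from has_derivative_in_compose2[OF smooth_on_has_derivative[OF smooth_fieldD(1)[OF u]] _ _ this]
  show ?thesis using t by (auto simp: image_subset_iff)
qed

lemma smooth_field_has_vector_derivative_aux:
  fixes u :: "real \<Rightarrow> real^'n \<Rightarrow> 'b::real_normed_vector"
  assumes u: "smooth_field T u" and t: "t \<in> {0..T}"
  shows "((\<lambda>s. u s x) has_vector_derivative
    frechet_derivative (\<lambda>(t, x). u t x) (at (t, x) within {0..T} \<times> UNIV) (1, 0)) (at t within {0..T})"
proof -
  let ?D = "frechet_derivative (\<lambda>(t, x). u t x) (at (t, x) within {0..T} \<times> UNIV)"
  note D = smooth_on_has_derivative[OF smooth_fieldD(1)[OF u]]
  have "((\<lambda>s. (s, x)) has_derivative (\<lambda>h. (h, 0))) (at t within {0..T})"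
    by (intro has_derivative_Pair has_derivative_const has_derivative_ident)
  from has_derivative_in_compose2[OF D _ t this]
  have "((\<lambda>s. u s x) has_derivative (\<lambda>h. ?D (h, 0))) (at t within {0..T})" by auto
  moreover have "?D (h, 0) = h *\<^sub>R ?D (1, 0)" for h
  proof -
    have "(t, x) \<in> {0..T} \<times> UNIV" using t by simp
    from linear_cmul[OF has_derivative_linear[OF D[OF this]], of h "(1, 0)"]
    show ?thesis by simp
  qed
  then have "(\<lambda>h. ?D (h, 0)) = (\<lambda>h. h *\<^sub>R ?D (1, 0))" by (rule ext)
  ultimately show ?thesis by (simp only: has_vector_derivative_def)
qed

lemma dt_eq:
  assumes "0 < T" "t \<in> {0..T}" "((\<lambda>s. u s x) has_vector_derivative D) (at t within {0..T})"
  shows "dt T u t x = D"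
  unfolding dt_def using assms vector_derivative_within_cbox[of 0 T t "\<lambda>s. u s x" D] by simp

lemma smooth_field_has_vector_derivative:
  assumes "0 < T" "smooth_field T u" "t \<in> {0..T}"
  shows "((\<lambda>s. u s x) has_vector_derivative dt T u t x) (at t within {0..T})"
  using smooth_field_has_vector_derivative_aux[OF assms(2,3)] dt_eq[OF assms(1,3)] by metis

text \<open>The time derivative is the joint derivative in direction (1, 0), one-sided at the ends
  of the interval. The two agree only for t in {0..T}, hence the use of
  \<open>smooth_on_cong\<close>.\<close>

lemma smooth_field_dt:
  fixes u :: "real \<Rightarrow> real^'n \<Rightarrow> 'b::real_normed_vector"
  assumes T: "0 < T" and u: "smooth_field T u"
  shows "smooth_field T (dt T u)"
  unfolding smooth_field_def
proof (intro conjI ballI)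
  show "smooth_on ({0..T} \<times> UNIV) (\<lambda>(t, x). dt T u t x)"
  proof (rule smooth_on_cong[OF axis_accessible_slab[OF T] _ smooth_on_frechet_derivative[OF axis_accessible_slab[OF T] smooth_fieldD(1)[OF u]]])
    fix p :: "real \<times> (real^'n)" assume "p \<in> {0..T} \<times> UNIV"
    then show "frechet_derivative (\<lambda>(t, x). u t x) (at p within {0..T} \<times> UNIV) (1, 0) = (case p of (t, x) \<Rightarrow> dt T u t x)"
      using dt_eq[where u = u, OF T _ smooth_field_has_vector_derivative_aux[OF u]] by (auto split: prod.split)
  qed
next
  fix t assume t: "t \<in> {0..T}"
  have "dt T u t (x + axis i 1) = dt T u t x" for x i
  proof (rule dt_eq[OF T t], rule has_vector_derivative_transform[OF t _ smooth_field_has_vector_derivative[OF T u t, of x]])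
    show "u s (x + axis i 1) = u s x" if "s \<in> {0..T}" for s
      using smooth_fieldD(2)[OF u that] by (simp add: periodic_def)
  qed
  then show "periodic (dt T u t)" by (simp add: periodic_def)
qed

lemma smooth_field_partial:
  fixes u :: "real \<Rightarrow> real^'n \<Rightarrow> real"
  assumes T: "0 < T" and u: "smooth_field T u"
  shows "smooth_field T (\<lambda>t. partial i (u t))"
  unfolding smooth_field_def
proof (intro conjI ballI)
  show "smooth_on ({0..T} \<times> UNIV) (\<lambda>(t, x). partial i (u t) x)"
  proof (rule smooth_on_cong[OF axis_accessible_slab[OF T] _ smooth_on_frechet_derivative[OF axis_accessible_slab[OF T] smooth_fieldD(1)[OF u]]])
    fix p :: "real \<times> (real^'n)" assume "p \<in> {0..T} \<times> UNIV"
    then show "frechet_derivative (\<lambda>(t, x). u t x) (at p within {0..T} \<times> UNIV) (0, axis i 1) = (case p of (t, x) \<Rightarrow> partial i (u t) x)"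
      using partial_eq[OF smooth_field_has_derivative[OF u]] by (auto split: prod.split)
  qed
qed (use periodic_partial smooth_fieldD(2)[OF u] in auto)

lemma smooth_field_slice:
  fixes u :: "real \<Rightarrow> real^'n \<Rightarrow> 'b::real_normed_vector"
  assumes u: "smooth_field T u" and t: "t \<in> {0..T}"
  shows "smooth_on UNIV (u t)"
proof -
  have "bounded_linear (\<lambda>y::real^'n. (0::real, y))"
    by (intro bounded_linear_Pair bounded_linear_zero bounded_linear_ident)
  from smooth_on_compose_affine[OF this axis_accessible_UNIV _ smooth_fieldD(1)[OF u], of "(t, 0)"]
  show ?thesis using t by simp
qed

lemma smooth_field_subinterval:
  assumes "smooth_field T' u" "0 < T" "T \<le> T'"
  shows "smooth_field T u"
  unfolding smooth_field_def
proof
  show "smooth_on ({0..T} \<times> UNIV) (\<lambda>(t, x). u t x)"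
    using assms by (intro smooth_on_subset[OF smooth_fieldD(1)[OF assms(1)]] axis_accessible_slab) auto
qed (use assms in \<open>auto simp: smooth_field_def\<close>)

lemma dt_subinterval:
  assumes "smooth_field T' u" "0 < T" "T \<le> T'" "t \<in> {0..T}"
  shows "dt T u t x = dt T' u t x"
proof (rule dt_eq)
  have "((\<lambda>s. u s x) has_vector_derivative dt T' u t x) (at t within {0..T'})"
    using assms by (intro smooth_field_has_vector_derivative) auto
  then show "((\<lambda>s. u s x) has_vector_derivative dt T' u t x) (at t within {0..T})"
    by (rule has_vector_derivative_within_subset) (use assms in auto)
qed (use assms in auto)

lemma smooth_field_bounded_linear:
  assumes "0 < T" "bounded_linear L" "smooth_field T u"
  shows "smooth_field T (\<lambda>t x. L (u t x))"
  using smooth_on_bounded_linear[OF assms(2) axis_accessible_slab[OF assms(1)] smooth_fieldD(1)[OF assms(3)]]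
    smooth_fieldD(2)[OF assms(3)]
  by (auto simp: smooth_field_def periodic_def case_prod_unfold)

lemma smooth_field_bounded_bilinear:
  assumes "0 < T" "bounded_bilinear pr" "smooth_field T u" "smooth_field T v"
  shows "smooth_field T (\<lambda>t x. pr (u t x) (v t x))"
  using smooth_on_bounded_bilinear[OF assms(2) axis_accessible_slab[OF assms(1)] smooth_fieldD(1)[OF assms(3)] smooth_fieldD(1)[OF assms(4)]]
    smooth_fieldD(2)[OF assms(3)] smooth_fieldD(2)[OF assms(4)]
  by (auto simp: smooth_field_def periodic_def case_prod_unfold)

lemma smooth_field_add:
  assumes "0 < T" "smooth_field T u" "smooth_field T v"
  shows "smooth_field T (\<lambda>t x. u t x + v t x)"
  using smooth_on_add[OF axis_accessible_slab[OF assms(1)] smooth_fieldD(1)[OF assms(2)] smooth_fieldD(1)[OF assms(3)]]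
    smooth_fieldD(2)[OF assms(2)] smooth_fieldD(2)[OF assms(3)]
  by (auto simp: smooth_field_def periodic_def case_prod_unfold)

lemma smooth_field_const: "0 < T \<Longrightarrow> smooth_field T (\<lambda>t x. c)"
  by (auto simp: smooth_field_def periodic_def case_prod_unfold intro!: smooth_on_const axis_accessible_slab)

lemma smooth_field_minus: "0 < T \<Longrightarrow> smooth_field T u \<Longrightarrow> smooth_field T (\<lambda>t x. - u t x)"
  using smooth_field_bounded_linear[OF _ bounded_linear_minus[OF bounded_linear_ident]] .

lemma smooth_field_diff:
  "0 < T \<Longrightarrow> smooth_field T u \<Longrightarrow> smooth_field T v \<Longrightarrow> smooth_field T (\<lambda>t x. u t x - v t x)"
  using smooth_field_add[of T u "\<lambda>t x. - v t x"] smooth_field_minus[of T v] by simp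

lemma smooth_field_sum:
  "finite I \<Longrightarrow> 0 < T \<Longrightarrow> (\<And>i. i \<in> I \<Longrightarrow> smooth_field T (u i)) \<Longrightarrow> smooth_field T (\<lambda>t x. \<Sum>i\<in>I. u i t x)"
proof (induction I rule: finite_induct)
  case (insert i I)
  then show ?case using smooth_field_add[of T "u i" "\<lambda>t x. \<Sum>i\<in>I. u i t x"] by simp
qed (simp add: smooth_field_const)

lemma smooth_field_time:
  assumes "0 < T"
  shows "smooth_field T (\<lambda>t (x :: real^'n). t)"
proof -
  have "(\<lambda>(t, x). t) = (fst :: real \<times> (real^'n) \<Rightarrow> real)" by auto
  then show ?thesis
    using smooth_on_bounded_linear_self[OF bounded_linear_fst axis_accessible_slab[OF assms]]
    by (auto simp: smooth_field_def periodic_def)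
qed

lemma smooth_field_mult:
  fixes u v :: "real \<Rightarrow> real^'n \<Rightarrow> real"
  shows "0 < T \<Longrightarrow> smooth_field T u \<Longrightarrow> smooth_field T v \<Longrightarrow> smooth_field T (\<lambda>t x. u t x * v t x)"
  by (rule smooth_field_bounded_bilinear[OF _ bounded_bilinear_mult])

lemma smooth_field_scaleR:
  "0 < T \<Longrightarrow> smooth_field T u \<Longrightarrow> smooth_field T v \<Longrightarrow> smooth_field T (\<lambda>t x. u t x *\<^sub>R v t x)"
  by (rule smooth_field_bounded_bilinear[OF _ bounded_bilinear_scaleR])

lemma smooth_field_inner:
  "0 < T \<Longrightarrow> smooth_field T u \<Longrightarrow> smooth_field T v \<Longrightarrow> smooth_field T (\<lambda>t x. u t x \<bullet> v t x)"
  by (rule smooth_field_bounded_bilinear[OF _ bounded_bilinear_inner])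

lemma smooth_field_nth:
  fixes u :: "real \<Rightarrow> real^'n \<Rightarrow> 'b::euclidean_space^'m"
  shows "0 < T \<Longrightarrow> smooth_field T u \<Longrightarrow> smooth_field T (\<lambda>t x. u t x $ i)"
  by (rule smooth_field_bounded_linear[OF _ bounded_linear_vec_nth])

lemma bounded_linear_axis: "bounded_linear (\<lambda>v::'b::euclidean_space. axis i v)"
  by (intro linear_conv_bounded_linear[THEN iffD1] linearI) (auto simp: vec_eq_iff axis_def)

lemma smooth_field_vec_lambda:
  fixes u :: "'m::finite \<Rightarrow> real \<Rightarrow> real^'n \<Rightarrow> 'b::euclidean_space"
  assumes "0 < T" "\<And>i. smooth_field T (u i)"
  shows "smooth_field T (\<lambda>t x. \<chi> i. u i t x)"
proof -
  have "(\<chi> i. v i) = (\<Sum>i\<in>UNIV. axis i (v i))" for v :: "'m \<Rightarrow> 'b"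
    by (simp add: vec_eq_iff axis_def if_distrib sum.delta cong: if_cong)
  then show ?thesis
    using assms by (auto intro!: smooth_field_sum smooth_field_bounded_linear[OF _ bounded_linear_axis])
qed

lemma smooth_field_imp_continuous: "smooth_field T u \<Longrightarrow> continuous_field T u"
  by (simp add: smooth_field_def continuous_field_def smooth_on_imp_continuous)

lemma smooth_field_C1_periodic:
  assumes T: "0 < T" and u: "smooth_field T u" and t: "t \<in> {0..T}"
  shows "C1_periodic (u t)"
  unfolding C1_periodic_def
proof (intro conjI allI)
  show "u t differentiable at x" for x
    using smooth_field_has_derivative[OF u t] differentiableI by blast
  show "continuous_on UNIV (partial i (u t))" for i
    using smooth_on_imp_continuous[OF smooth_field_slice[OF smooth_field_partial[OF T u] t]] .
qed (use smooth_fieldD(2)[OF u t] in auto)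

lemma continuous_fieldD:
  assumes "continuous_field T u"
  shows "continuous_on (slab T) (\<lambda>(t, x). u t x)" "t \<in> {0..T} \<Longrightarrow> continuous_on UNIV (u t)"
    "continuous_on ({0..T} \<times> UNIV) (\<lambda>(t, x). u t x)"
proof -
  show c: "continuous_on ({0..T} \<times> UNIV) (\<lambda>(t, x). u t x)"
    using assms by (simp add: continuous_field_def)
  then show "continuous_on (slab T) (\<lambda>(t, x). u t x)"
    by (rule continuous_on_subset) (auto simp: slab_def)
  show "continuous_on UNIV (u t)" if "t \<in> {0..T}"
    using continuous_on_compose2[OF c, where f = "\<lambda>x. (t, x)"] that
      continuous_on_Pair[OF continuous_on_const continuous_on_id, of UNIV t]
    by (auto simp: image_subset_iff)
qed

lemma slab_eq_cbox: "slab T = cbox (0, 0) (T, 1)"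
  unfolding slab_def cube_eq_cbox cbox_Pair_eq by simp

lemma compact_slab: "compact (slab T)"
  by (simp add: slab_eq_cbox)

text \<open>Compactness gives the bound over one period cell only; periodicity extends it to all
  x.\<close>

lemma continuous_field_bounded:
  assumes "continuous_field T u"
  obtains C where "0 < C" "\<And>t x. t \<in> {0..T} \<Longrightarrow> norm (u t x) \<le> C"
proof -
  have "bounded ((\<lambda>(t, x). u t x) ` slab T)"
    using compact_continuous_image[OF continuous_fieldD(1)[OF assms] compact_slab] compact_imp_bounded by blast
  then obtain C where C: "0 < C" "\<And>t x. (t, x) \<in> slab T \<Longrightarrow> norm (u t x) \<le> C"
    unfolding bounded_pos by force
  have "norm (u t x) \<le> C" if t: "t \<in> {0..T}" for t x
  proof -
    obtain y where "y \<in> cube" "u t y = u t x"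
      using periodic_reduce_to_cube[of x] assms t by (metis continuous_field_def)
    with C(2)[of t y] t show ?thesis by (simp add: slab_def)
  qed
  with C(1) show thesis by (rule that)
qed

lemma has_vector_derivative_integral_cube:
  fixes u :: "real \<Rightarrow> real^'n \<Rightarrow> real"
  assumes T: "0 < T" and u: "smooth_field T u" and t: "t \<in> {0..T}"
  shows "((\<lambda>t. integral cube (u t)) has_vector_derivative integral cube (dt T u t)) (at t within {0..T})"
  unfolding cube_eq_cbox
proof (rule leibniz_rule_vector_derivative)
  show "((\<lambda>t. u t x) has_vector_derivative dt T u t x) (at t within {0..T})" if "t \<in> {0..T}" for t x
    by (rule smooth_field_has_vector_derivative[OF T u that])
  show "u t integrable_on cbox 0 1" if "t \<in> {0..T}" for t
    using integrable_continuous_cube[OF smooth_on_imp_continuous[OF smooth_field_slice[OF u that]]]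
    by (simp add: cube_eq_cbox)
  show "continuous_on ({0..T} \<times> cbox 0 1) (\<lambda>(t, x). dt T u t x)"
    using continuous_fieldD(1)[OF smooth_field_imp_continuous[OF smooth_field_dt[OF T u]]]
    by (simp add: slab_def cube_eq_cbox)
qed (use t in auto)

text \<open>Lets purely spatial test fields be treated as fields constant in time, so that the
  calculus of space-time fields applies to them.\<close>

lemma smooth_field_static:
  fixes f :: "real^'n \<Rightarrow> 'b::real_normed_vector"
  assumes "0 < T" "smooth_on UNIV f" "periodic f"
  shows "smooth_field T (\<lambda>t. f)"
  using smooth_on_compose_affine[OF bounded_linear_snd axis_accessible_slab[OF assms(1)] _ assms(2), of 0] assms(3)
  by (auto simp: smooth_field_def case_prod_unfold)

lemma smooth_field_grad:
  assumes "0 < T" "smooth_field T f"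
  shows "smooth_field T (\<lambda>t. grad (f t))"
  unfolding grad_def using assms by (intro smooth_field_vec_lambda smooth_field_partial)

lemma smooth_field_divergence:
  assumes "0 < T" "smooth_field T u"
  shows "smooth_field T (\<lambda>t. divergence (u t))"
  unfolding divergence_def using assms
  by (intro smooth_field_sum smooth_field_partial smooth_field_nth) auto

lemma smooth_field_div_mat:
  assumes "0 < T" "smooth_field T m"
  shows "smooth_field T (\<lambda>t. div_mat (m t))"
  unfolding div_mat_def using assms
  by (intro smooth_field_vec_lambda smooth_field_sum smooth_field_partial smooth_field_nth) auto

lemma smooth_field_sym_grad:
  assumes "0 < T" "smooth_field T u"
  shows "smooth_field T (\<lambda>t. sym_grad (u t))"
  unfolding sym_grad_def divide_inverse using assms
  by (intro smooth_field_vec_lambda smooth_field_mult smooth_field_add smooth_field_partial smooth_field_nth smooth_field_const) auto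

lemma smooth_field_outer:
  assumes "0 < T" "smooth_field T u" "smooth_field T v"
  shows "smooth_field T (\<lambda>t x. outer (u t x) (v t x))"
  unfolding outer_def using assms
  by (intro smooth_field_vec_lambda smooth_field_mult smooth_field_nth)

lemma smooth_field_matrix_vector_mult:
  fixes m :: "real \<Rightarrow> real^'n \<Rightarrow> real^'n^'n"
  assumes "0 < T" "smooth_field T m" "smooth_field T u"
  shows "smooth_field T (\<lambda>t x. m t x *v u t x)"
  unfolding matrix_vector_mult_def using assms
  by (intro smooth_field_vec_lambda smooth_field_sum smooth_field_mult smooth_field_nth) auto

lemma smooth_field_C1_periodic_nth:
  fixes u :: "real \<Rightarrow> real^'n \<Rightarrow> real^'n"
  assumes "0 < T" "smooth_field T u" "t \<in> {0..T}"
  shows "C1_periodic (\<lambda>x. u t x $ i)"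
  using smooth_field_C1_periodic[OF assms(1) smooth_field_nth[OF assms(1,2)] assms(3)] .

lemma dt_diff:
  assumes "0 < T" "smooth_field T u" "smooth_field T v" "t \<in> {0..T}"
  shows "dt T (\<lambda>t x. u t x - v t x) t x = dt T u t x - dt T v t x"
  using dt_eq[where u = "\<lambda>t x. u t x - v t x", OF assms(1,4) has_vector_derivative_diff[OF smooth_field_has_vector_derivative[OF assms(1,2,4)]
      smooth_field_has_vector_derivative[OF assms(1,3,4)]]] .

lemma dt_inner:
  assumes "0 < T" "smooth_field T u" "smooth_field T v" "t \<in> {0..T}"
  shows "dt T (\<lambda>t x. u t x \<bullet> v t x) t x = u t x \<bullet> dt T v t x + dt T u t x \<bullet> v t x"
  using dt_eq[where u = "\<lambda>t x. u t x \<bullet> v t x", OF assms(1,4) bounded_bilinear.has_vector_derivative[OF bounded_bilinear_inner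
      smooth_field_has_vector_derivative[OF assms(1,2,4)]
      smooth_field_has_vector_derivative[OF assms(1,3,4)]]] .

lemma dt_static:
  assumes "0 < T" "t \<in> {0..T}"
  shows "dt T (\<lambda>t. f) t x = 0"
  by (rule dt_eq[OF assms]) (rule has_vector_derivative_const)

lemma has_vector_derivative_integral_inner_static:
  fixes u :: "real \<Rightarrow> real^'n \<Rightarrow> real^'n"
  assumes T: "0 < T" and u: "smooth_field T u" and w: "smooth_field T (\<lambda>t. w)" and t: "t \<in> {0..T}"
  shows "((\<lambda>t. integral cube (\<lambda>x. u t x \<bullet> w x)) has_vector_derivative
    integral cube (\<lambda>x. dt T u t x \<bullet> w x)) (at t within {0..T})"
  using has_vector_derivative_integral_cube[OF T smooth_field_inner[OF T u w] t]
  by (simp add: dt_inner[OF T u w t, THEN ext] dt_static[OF T t])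

text \<open>Symmetry of mixed second derivatives is avoided by duality. With \<eta> the divergence
  of the time derivative, the integral of u . grad \<eta> vanishes at all times. Differentiating it
  in time and integrating by parts gives minus the integral of the square of \<eta>, which must then
  be zero.\<close>

lemma divergence_dt:
  fixes u :: "real \<Rightarrow> real^'n \<Rightarrow> real^'n"
  assumes T: "0 < T" and u: "smooth_field T u" and div: "\<And>t x. t \<in> {0..T} \<Longrightarrow> divergence (u t) x = 0"
    and t: "t \<in> {0..T}"
  shows "divergence (dt T u t) x = 0"
proof -
  define \<eta> where "\<eta> = divergence (dt T u t)"
  have du: "smooth_field T (dt T u)" by (rule smooth_field_dt[OF T u])
  have sm: "smooth_on UNIV \<eta>" "periodic \<eta>"
    using smooth_field_slice[OF smooth_field_divergence[OF T du] t]
      smooth_fieldD(2)[OF smooth_field_divergence[OF T du] t] by (simp_all add: \<eta>_def)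
  have \<eta>: "smooth_field T (\<lambda>t. \<eta>)" by (rule smooth_field_static[OF T sm])
  have c1: "C1_periodic \<eta>" by (rule smooth_field_C1_periodic[OF T \<eta> t])
  have 0: "integral cube (\<lambda>x. u s x \<bullet> grad \<eta> x) = 0" if "s \<in> {0..T}" for s
    using integral_inner_grad_div_free[OF smooth_field_C1_periodic_nth[OF T u that] c1 div[OF that]] .
  have "((\<lambda>s. 0) has_vector_derivative integral cube (\<lambda>x. dt T u t x \<bullet> grad \<eta> x)) (at t within {0..T})"
    by (rule has_vector_derivative_transform[OF t _ has_vector_derivative_integral_inner_static[OF T u smooth_field_grad[OF T \<eta>] t]])
      (use 0 in auto)
  from vector_derivative_unique_within_closed_interval[where a = 0 and b = T, unfolded box_real, OF T t this has_vector_derivative_const]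
  have "integral cube (\<lambda>x. dt T u t x \<bullet> grad \<eta> x) = 0" .
  then have "integral cube (\<lambda>x. \<eta> x * \<eta> x) = 0"
    using integral_inner_grad[OF smooth_field_C1_periodic_nth[OF T du t] c1] by (simp add: \<eta>_def)
  then have "\<eta> x * \<eta> x = 0"
    using C1_periodicD[OF C1_periodic_mult[OF c1 c1]] by (intro integral_cube_eq_0_imp[of "\<lambda>x. \<eta> x * \<eta> x"]) auto
  then show ?thesis by (simp add: \<eta>_def)
qed

lemma partial_inner:
  fixes f g :: "real^'n \<Rightarrow> real^'n"
  assumes "\<And>j. (\<lambda>x. f x $ j) differentiable at x" "\<And>j. (\<lambda>x. g x $ j) differentiable at x"
  shows "partial i (\<lambda>x. f x \<bullet> g x) x =
    (\<Sum>j\<in>UNIV. f x $ j * partial i (\<lambda>x. g x $ j) x + partial i (\<lambda>x. f x $ j) x * g x $ j)"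
proof -
  have "partial i (\<lambda>x. f x \<bullet> g x) x = (\<Sum>j\<in>UNIV. partial i (\<lambda>x. f x $ j * g x $ j) x)"
    unfolding inner_vec_def inner_real_def using assms by (intro partial_sum differentiable_mult) auto
  then show ?thesis using partial_mult[OF assms] by simp
qed

lemma C1_periodic_inner:
  fixes f g :: "real^'n \<Rightarrow> real^'n"
  assumes "\<And>j. C1_periodic (\<lambda>x. f x $ j)" "\<And>j. C1_periodic (\<lambda>x. g x $ j)"
  shows "C1_periodic (\<lambda>x. f x \<bullet> g x)"
  unfolding inner_vec_def inner_real_def using assms by (intro C1_periodic_sum C1_periodic_mult) auto

section \<open>The final-value problem\<close>

lemma mat_plus_sym_grad_mult_nth:
  "((mat 1 + 2 *\<^sub>R sym_grad a x) *v v) $ i =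
    v $ i + (\<Sum>j\<in>UNIV. (partial j (\<lambda>y. a y $ i) x + partial i (\<lambda>y. a y $ j) x) * v $ j)"
  by (simp add: matrix_vector_mult_add_rdistrib scaleR_matrix_vector_assoc[symmetric])
    (simp add: matrix_vector_mult_def sym_grad_def sum_distrib_left)

lemma div_mat_outer:
  fixes v :: "real^'n \<Rightarrow> real^'n"
  assumes "\<And>i. (\<lambda>y. v y $ i) differentiable at x" "divergence v x = 0"
  shows "div_mat (\<lambda>y. outer (v y) (v y)) x $ i = (\<Sum>j\<in>UNIV. partial j (\<lambda>y. v y $ i) x * v x $ j)"
proof -
  have "div_mat (\<lambda>y. outer (v y) (v y)) x $ i =
      (\<Sum>j\<in>UNIV. v x $ i * partial j (\<lambda>y. v y $ j) x + partial j (\<lambda>y. v y $ i) x * v x $ j)"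
    by (simp add: div_mat_def outer_def partial_mult assms(1))
  also have "\<dots> = v x $ i * divergence v x + (\<Sum>j\<in>UNIV. partial j (\<lambda>y. v y $ i) x * v x $ j)"
    by (simp add: sum.distrib sum_distrib_left divergence_def)
  finally show ?thesis using assms(2) by simp
qed

lemma euler_solutionE:
  assumes "euler_solution T P0 V"
  obtains q where "smooth_field T V" "\<And>t x. t \<in> {0..T} \<Longrightarrow> divergence (V t) x = 0" "V 0 = P0"
    "\<And>t. t \<in> {0..T} \<Longrightarrow> periodic (q t)" "\<And>t x. t \<in> {0..T} \<Longrightarrow> q t differentiable at x"
    "\<And>t x. t \<in> {0..T} \<Longrightarrow> dt T V t x + div_mat (\<lambda>y. outer (V t y) (V t y)) x = grad (q t) x"
proof -
  from assms obtain q where "\<forall>t\<in>{0..T}. periodic (q t) \<and> (\<forall>x. q t differentiable at x \<and>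
      dt T V t x + div_mat (\<lambda>y. outer (V t y) (V t y)) x = grad (q t) x)"
    unfolding euler_solution_def by (elim conjE exE)
  with assms show thesis by (intro that[of q]) (simp_all add: euler_solution_def)
qed

lemma euler_solution_subinterval:
  fixes V :: "real \<Rightarrow> real^'n \<Rightarrow> real^'n"
  assumes "euler_solution T' P0 V" "0 < T" "T \<le> T'"
  shows "euler_solution T P0 V"
proof -
  have V: "smooth_field T' V" using assms(1) by (simp add: euler_solution_def)
  have "dt T V t x = dt T' V t x" if "t \<in> {0..T}" for t x
    by (rule dt_subinterval[OF V assms(2,3) that])
  then show ?thesis
    using assms smooth_field_subinterval[OF V assms(2,3)] unfolding euler_solution_def by fastforce
qed

lemma sym_grad_cmult:
  assumes "\<And>i. (\<lambda>y. a y $ i) differentiable at x"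
  shows "sym_grad (\<lambda>y. c *\<^sub>R a y) x = c *\<^sub>R sym_grad a x"
  by (simp add: vec_eq_iff sym_grad_def partial_cmult[OF assms] algebra_simps add_divide_distrib)

lemma final_value_solution_explicit:
  fixes V :: "real \<Rightarrow> real^'n \<Rightarrow> real^'n"
  assumes T: "0 < T" and eul: "euler_solution T P0 V"
  shows "\<exists>\<phi>. final_value_solution T V (\<lambda>t x. (T - t) *\<^sub>R V t x) \<phi>"
proof -
  obtain q where V: "smooth_field T V" and div: "\<And>t x. t \<in> {0..T} \<Longrightarrow> divergence (V t) x = 0"
    and "V 0 = P0" and q: "\<And>t. t \<in> {0..T} \<Longrightarrow> periodic (q t)"
      "\<And>t x. t \<in> {0..T} \<Longrightarrow> q t differentiable at x"
      "\<And>t x. t \<in> {0..T} \<Longrightarrow> dt T V t x + div_mat (\<lambda>y. outer (V t y) (V t y)) x = grad (q t) x"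
    by (rule euler_solutionE[OF eul]) (rule that)
  let ?A = "\<lambda>t x. (T - t) *\<^sub>R V t x"
  \<comment> \<open>In the equation the -V from differentiating T - t cancels the V from the
    identity matrix. What remains is T - t times the gradient of q + |V|^2 / 2, because the Euler
    equation is written with \<open>grad (q t)\<close> on the right; \<phi> is this potential with
    the opposite sign.\<close>
  let ?\<phi> = "\<lambda>t x. (t - T) * (q t x + (V t x \<bullet> V t x) / 2)"
  have c1: "C1_periodic (\<lambda>x. V t x $ i)" if "t \<in> {0..T}" for t i
    by (rule smooth_field_C1_periodic_nth[OF T V that])
  note dV = C1_periodicD(2)[OF c1]
  have "smooth_field T ?A"
    by (intro smooth_field_scaleR smooth_field_diff smooth_field_const smooth_field_time T V)
  moreover have "periodic (?\<phi> t) \<and> (\<forall>x. ?\<phi> t differentiable at x)" if t: "t \<in> {0..T}" for t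
  proof -
    have c: "C1_periodic (\<lambda>x. V t x \<bullet> V t x)" by (intro C1_periodic_inner c1 t)
    have "?\<phi> t = (\<lambda>x. (t - T) * (q t x + (1/2) * (V t x \<bullet> V t x)))" by auto
    moreover have "\<dots> differentiable at x" for x
      by (intro differentiable_mult differentiable_add differentiable_const q(2)[OF t] C1_periodicD(2)[OF c])
    ultimately show ?thesis
      using q(1)[OF t] smooth_fieldD(2)[OF V t] by (auto simp: periodic_def)
  qed
  moreover have "dt T ?A t x + (mat 1 + 2 *\<^sub>R sym_grad (?A t) x) *v V t x + grad (?\<phi> t) x = 0 \<and>
      divergence (?A t) x = 0" if t: "t \<in> {0..T}" for t x
  proof
    have dA: "dt T ?A t x = (T - t) *\<^sub>R dt T V t x - V t x"
    proof (rule dt_eq[OF T t])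
      have "((\<lambda>s. T - s) has_field_derivative -1) (at t within {0..T})"
        by (auto intro!: derivative_eq_intros)
      from has_vector_derivative_scaleR[OF this smooth_field_has_vector_derivative[OF T V t, of x]]
      show "((\<lambda>s. (T - s) *\<^sub>R V s x) has_vector_derivative (T - t) *\<^sub>R dt T V t x - V t x) (at t within {0..T})"
        by simp
    qed
    have g: "grad (?\<phi> t) x $ i = (t - T) * (grad (q t) x $ i + (\<Sum>j\<in>UNIV. V t x $ j * partial i (\<lambda>y. V t y $ j) x))" for i
    proof -
      have c: "(\<lambda>x. V t x \<bullet> V t x) differentiable at x"
        by (intro C1_periodicD(2) C1_periodic_inner c1 t)
      have "partial i (?\<phi> t) x = partial i (\<lambda>x. (t - T) * (q t x + (1/2) * (V t x \<bullet> V t x))) x" by simp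
      also have "\<dots> = (t - T) * (partial i (q t) x + (1/2) * partial i (\<lambda>x. V t x \<bullet> V t x) x)"
        using c q(2)[OF t] by (simp add: partial_cmult partial_add del: times_divide_eq_left)
      also have "partial i (\<lambda>x. V t x \<bullet> V t x) x = 2 * (\<Sum>j\<in>UNIV. V t x $ j * partial i (\<lambda>y. V t y $ j) x)"
        by (subst partial_inner) (simp_all add: dV[OF t] sum_distrib_left mult.commute)
      finally show ?thesis by (simp add: grad_def)
    qed
    show "dt T ?A t x + (mat 1 + 2 *\<^sub>R sym_grad (?A t) x) *v V t x + grad (?\<phi> t) x = 0"
      unfolding vec_eq_iff
    proof
      fix i
      let ?S = "\<Sum>j\<in>UNIV. partial j (\<lambda>y. V t y $ i) x * V t x $ j"
      let ?S' = "\<Sum>j\<in>UNIV. V t x $ j * partial i (\<lambda>y. V t y $ j) x"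
      have "partial j (\<lambda>y. ?A t y $ k) x = (T - t) * partial j (\<lambda>y. V t y $ k) x" for j k
        by (simp add: partial_cmult dV[OF t])
      then have "((mat 1 + 2 *\<^sub>R sym_grad (?A t) x) *v V t x) $ i = V t x $ i +
          (\<Sum>j\<in>UNIV. (T - t) * (partial j (\<lambda>y. V t y $ i) x * V t x $ j) + (T - t) * (V t x $ j * partial i (\<lambda>y. V t y $ j) x))"
        unfolding mat_plus_sym_grad_mult_nth by (simp only:) (simp add: algebra_simps)
      also have "\<dots> = V t x $ i + ((T - t) * ?S + (T - t) * ?S')"
        by (simp only: sum.distrib sum_distrib_left)
      finally have M: "((mat 1 + 2 *\<^sub>R sym_grad (?A t) x) *v V t x) $ i = V t x $ i + ((T - t) * ?S + (T - t) * ?S')" .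
      have "grad (q t) x $ i = dt T V t x $ i + ?S"
        using q(3)[OF t, of x] div_mat_outer[OF dV[OF t] div[OF t], where i = i] by (metis vector_add_component)
      with g[of i] have G: "grad (?\<phi> t) x $ i = (t - T) * (dt T V t x $ i + ?S + ?S')" by simp
      show "(dt T ?A t x + (mat 1 + 2 *\<^sub>R sym_grad (?A t) x) *v V t x + grad (?\<phi> t) x) $ i = 0 $ i"
        unfolding vector_add_component M G dA by (simp add: left_diff_distrib distrib_left)
    qed
    show "divergence (?A t) x = 0"
      using div[OF t, of x] by (simp add: divergence_def partial_cmult dV[OF t] flip: sum_distrib_left)
  qed
  ultimately have "final_value_solution T V ?A ?\<phi>"
    by (simp add: final_value_solution_def)
  then show ?thesis by (intro exI[of _ ?\<phi>])
qed

lemma inner_grad_integrable: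
  fixes u :: "real^'n \<Rightarrow> real^'n"
  assumes "\<And>i. C1_periodic (\<lambda>x. u x $ i)" "C1_periodic f"
  shows "(\<lambda>x. u x \<bullet> grad f x) integrable_on cube"
  unfolding inner_vec_def grad_def inner_real_def vec_lambda_beta
  using assms[THEN C1_periodicD(3)] C1_periodicD(4)[OF assms(2)]
  by (intro integrable_continuous_cube continuous_on_sum continuous_on_mult) auto

text \<open>The integrand equals V . grad(|D|^2 / 2) + D . grad(D . V) minus the quadratic form of
  the derivative of V at D. Both gradient terms integrate to zero, since V and D are
  divergence-free. Thus no derivative of D survives, which is what lets the energy estimate
  close.\<close>

lemma integral_sym_grad_transport:
  fixes D V :: "real^'n \<Rightarrow> real^'n"
  assumes D: "\<And>i. C1_periodic (\<lambda>x. D x $ i)" and V: "\<And>i. C1_periodic (\<lambda>x. V x $ i)"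
    and "\<And>x. divergence D x = 0" "\<And>x. divergence V x = 0"
  shows "integral cube (\<lambda>x. D x \<bullet> ((2 *\<^sub>R sym_grad D x) *v V x)) =
    - integral cube (\<lambda>x. \<Sum>i\<in>UNIV. \<Sum>j\<in>UNIV. D x $ i * D x $ j * partial i (\<lambda>y. V y $ j) x)"
proof -
  note dD = C1_periodicD[OF D] and dV = C1_periodicD[OF V]
  let ?R = "\<lambda>x. \<Sum>i\<in>UNIV. \<Sum>j\<in>UNIV. D x $ i * D x $ j * partial i (\<lambda>y. V y $ j) x"
  have c1: "C1_periodic (\<lambda>x. (1/2) * (D x \<bullet> D x))" and c2: "C1_periodic (\<lambda>x. D x \<bullet> V x)"
    by (intro C1_periodic_cmult C1_periodic_inner D V)+
  have "D x \<bullet> ((2 *\<^sub>R sym_grad D x) *v V x) =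
     V x \<bullet> grad (\<lambda>x. (1/2) * (D x \<bullet> D x)) x + D x \<bullet> grad (\<lambda>x. D x \<bullet> V x) x - ?R x" for x
  proof -
    have "D x \<bullet> ((2 *\<^sub>R sym_grad D x) *v V x) =
      (\<Sum>i\<in>UNIV. \<Sum>j\<in>UNIV. D x $ i * (partial j (\<lambda>y. D y $ i) x + partial i (\<lambda>y. D y $ j) x) * V x $ j)"
      unfolding inner_vec_def matrix_vector_mult_def sym_grad_def
      by (simp add: sum_distrib_left, intro sum.cong refl) (simp add: field_simps)
    also have "\<dots> = (\<Sum>i\<in>UNIV. \<Sum>j\<in>UNIV. V x $ j * (D x $ i * partial j (\<lambda>y. D y $ i) x))
      + (\<Sum>i\<in>UNIV. \<Sum>j\<in>UNIV. D x $ i * (partial i (\<lambda>y. D y $ j) x * V x $ j))"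
      by (simp add: sum.distrib[symmetric] algebra_simps)
    also have "(\<Sum>i\<in>UNIV. \<Sum>j\<in>UNIV. V x $ j * (D x $ i * partial j (\<lambda>y. D y $ i) x)) =
       V x \<bullet> grad (\<lambda>x. (1/2) * (D x \<bullet> D x)) x"
    proof -
      have "partial j (\<lambda>x. (1/2) * (D x \<bullet> D x)) x = (\<Sum>i\<in>UNIV. D x $ i * partial j (\<lambda>y. D y $ i) x)" for j
        by (subst partial_cmult[OF C1_periodicD(2)[OF C1_periodic_inner[OF D D]]], subst partial_inner)
          (simp_all add: dD mult.commute sum_distrib_left)
      then show ?thesis
        by (subst sum.swap) (simp add: inner_vec_def grad_def sum_distrib_left)
    qed
    also have "(\<Sum>i\<in>UNIV. \<Sum>j\<in>UNIV. D x $ i * (partial i (\<lambda>y. D y $ j) x * V x $ j)) =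
       D x \<bullet> grad (\<lambda>x. D x \<bullet> V x) x - ?R x"
      by (simp add: inner_vec_def[of "D x"] grad_def partial_inner dD dV sum_distrib_left sum.distrib algebra_simps)
    finally show ?thesis by simp
  qed
  then have "integral cube (\<lambda>x. D x \<bullet> ((2 *\<^sub>R sym_grad D x) *v V x)) =
     integral cube (\<lambda>x. V x \<bullet> grad (\<lambda>x. (1/2) * (D x \<bullet> D x)) x + D x \<bullet> grad (\<lambda>x. D x \<bullet> V x) x - ?R x)"
    by simp
  also have "\<dots> = integral cube (\<lambda>x. V x \<bullet> grad (\<lambda>x. (1/2) * (D x \<bullet> D x)) x)
     + integral cube (\<lambda>x. D x \<bullet> grad (\<lambda>x. D x \<bullet> V x) x) - integral cube ?R"
  proof -
    have "?R integrable_on cube"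
      using dD dV by (intro integrable_continuous_cube continuous_on_sum continuous_on_mult) auto
    moreover note inner_grad_integrable[OF V c1] inner_grad_integrable[OF D c2]
    ultimately show ?thesis by (simp add: integral_diff integral_add integrable_add del: times_divide_eq_left)
  qed
  also have "\<dots> = - integral cube ?R"
    using integral_inner_grad_div_free[OF V c1 assms(4)] integral_inner_grad_div_free[OF D c2 assms(3)] by simp
  finally show ?thesis .
qed

text \<open>With the integrating factor exp(k t) the function becomes nondecreasing, and it vanishes
  at the final time, so it cannot be positive earlier.\<close>

lemma backward_gronwall_nonpos:
  fixes e :: "real \<Rightarrow> real"
  assumes der: "\<And>t. t \<in> {0..T} \<Longrightarrow> (e has_vector_derivative e' t) (at t within {0..T})"
    and bd: "\<And>t. t \<in> {0..T} \<Longrightarrow> e' t \<ge> - k * e t" and "e T = 0" and t: "t \<in> {0..T}"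
  shows "e t \<le> 0"
proof -
  let ?g = "\<lambda>t. exp (k * t) * e t" and ?g' = "\<lambda>t. exp (k * t) * (k * e t + e' t)"
  have "(?g has_derivative (\<lambda>h. h * ?g' s)) (at s within {t..T})" if "t \<le> s" "s \<le> T" for s
  proof -
    have s: "s \<in> {0..T}" using that t by simp
    have "(e has_field_derivative e' s) (at s within {t..T})"
      using has_vector_derivative_within_subset[OF der[OF s], of "{t..T}"] t
      by (simp add: has_real_derivative_iff_has_vector_derivative)
    then have "(?g has_field_derivative ?g' s) (at s within {t..T})"
      by (auto intro!: derivative_eq_intros simp: algebra_simps)
    then show ?thesis by (simp add: has_field_derivative_def mult_commute_abs)
  qed
  from mvt_very_simple[OF _ this] t obtain s where s: "s \<in> {t..T}" "?g T - ?g t = (T - t) * ?g' s" by auto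
  have "s \<in> {0..T}" using s(1) t by simp
  from bd[OF this] have "0 \<le> ?g' s" by (intro mult_nonneg_nonneg) (auto simp: algebra_simps)
  with t have "0 \<le> (T - t) * ?g' s" by (intro mult_nonneg_nonneg[of "T - t"]) simp_all
  then have "?g t \<le> 0" using s(2) assms(3) by simp
  then show ?thesis by (simp add: mult_le_0_iff)
qed

lemma final_value_solutionD:
  assumes "final_value_solution T V A \<phi>"
  shows "smooth_field T A" "t \<in> {0..T} \<Longrightarrow> periodic (\<phi> t)" "t \<in> {0..T} \<Longrightarrow> \<phi> t differentiable at x"
    "t \<in> {0..T} \<Longrightarrow> dt T A t x + (mat 1 + 2 *\<^sub>R sym_grad (A t) x) *v V t x + grad (\<phi> t) x = 0"
    "t \<in> {0..T} \<Longrightarrow> divergence (A t) x = 0" "A T x = 0"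
  using assms by (auto simp: final_value_solution_def)

lemma sym_grad_diff:
  fixes a b :: "real^'n \<Rightarrow> real^'n"
  assumes "\<And>i. (\<lambda>y. a y $ i) differentiable at x" "\<And>i. (\<lambda>y. b y $ i) differentiable at x"
  shows "sym_grad (\<lambda>y. a y - b y) x = sym_grad a x - sym_grad b x"
  by (simp add: vec_eq_iff sym_grad_def partial_diff assms diff_divide_distrib add_divide_distrib)

text \<open>The difference D of two solutions satisfies the homogeneous equation with the potential
  difference \<open>w\<close>. Pairing with D removes \<open>w\<close>, and the transport term
  reduces to a quadratic form in D with coefficients from the derivative of V. The energy therefore
  satisfies a linear differential inequality, integrated backwards from D(T) = 0.\<close>

lemma final_value_solution_unique:
  fixes V :: "real \<Rightarrow> real^'n \<Rightarrow> real^'n"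
  assumes T: "0 < T" and V: "smooth_field T V" and divV: "\<And>t x. t \<in> {0..T} \<Longrightarrow> divergence (V t) x = 0"
    and fv: "final_value_solution T V A \<phi>" "final_value_solution T V A' \<phi>'" and t: "t \<in> {0..T}"
  shows "A' t x = A t x"
proof -
  define D where "D t x = A' t x - A t x" for t x
  define w where "w t x = \<phi>' t x - \<phi> t x" for t x
  note F = final_value_solutionD[OF fv(1)] and F' = final_value_solutionD[OF fv(2)]
  have D: "smooth_field T D" unfolding D_def by (intro smooth_field_diff T F F')
  have dD: "smooth_field T (dt T D)" by (rule smooth_field_dt[OF T D])
  have c1: "C1_periodic (\<lambda>x. D t x $ i)" "C1_periodic (\<lambda>x. V t x $ i)" if "t \<in> {0..T}" for t i
    using smooth_field_C1_periodic_nth[OF T _ that] D V by blast+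
  have c1': "(\<lambda>x. A t x $ i) differentiable at x" "(\<lambda>x. A' t x $ i) differentiable at x" if "t \<in> {0..T}" for t i x
    using C1_periodicD(2)[OF smooth_field_C1_periodic_nth[OF T _ that]] F(1) F'(1) by blast+
  have divD: "divergence (D t) x = 0" if "t \<in> {0..T}" for t x
    using F(5)[OF that] F'(5)[OF that] by (simp add: D_def divergence_def partial_diff c1'[OF that] sum_subtractf)
  have gchi: "grad (w t) x = - (dt T D t x + (2 *\<^sub>R sym_grad (D t) x) *v V t x)" if t: "t \<in> {0..T}" for t x
  proof -
    have "grad (w t) x = grad (\<phi>' t) x - grad (\<phi> t) x"
      using F(3)[OF t] F'(3)[OF t] by (simp add: vec_eq_iff grad_def w_def[abs_def] partial_diff)
    moreover have "dt T D t x = dt T A' t x - dt T A t x"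
      unfolding D_def[abs_def] by (rule dt_diff[OF T F'(1) F(1) t])
    moreover have "sym_grad (D t) x = sym_grad (A' t) x - sym_grad (A t) x"
      unfolding D_def[abs_def] by (rule sym_grad_diff) (rule c1'[OF t])+
    moreover have "grad (\<phi> t) x = - (dt T A t x + (V t x + (2 *\<^sub>R sym_grad (A t) x) *v V t x))"
      "grad (\<phi>' t) x = - (dt T A' t x + (V t x + (2 *\<^sub>R sym_grad (A' t) x) *v V t x))"
      using F(4)[OF t, of x] F'(4)[OF t, of x]
      by (simp_all only: matrix_vector_mult_add_rdistrib matrix_vector_mul_lid)
        (simp_all only: eq_neg_iff_add_eq_0 add.commute[of "grad _ _"])
    ultimately show ?thesis
      by (simp only: scaleR_right_diff_distrib matrix_vector_mult_diff_rdistrib) simp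
  qed
  \<comment> \<open>The spatial regularity of \<open>w\<close> is not a hypothesis; it holds because
    its gradient equals a smooth field.\<close>
  have c1chi: "C1_periodic (w t)" if t: "t \<in> {0..T}" for t
    unfolding C1_periodic_def
  proof (intro conjI allI)
    show "periodic (w t)" using F(2)[OF t] F'(2)[OF t] by (simp add: periodic_def w_def)
    show "w t differentiable at x" for x
      unfolding w_def[abs_def] by (intro differentiable_diff F(3) F'(3) t)
    have "smooth_field T (\<lambda>t x. - (dt T D t x + (2 *\<^sub>R sym_grad (D t) x) *v V t x))"
      by (intro smooth_field_minus smooth_field_add smooth_field_matrix_vector_mult smooth_field_scaleR
          smooth_field_sym_grad smooth_field_const T D dD V)
    from C1_periodicD(3)[OF smooth_field_C1_periodic_nth[OF T this t]]
    show "continuous_on UNIV (partial i (w t))" for i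
      unfolding gchi[OF t, symmetric] by (simp add: grad_def)
  qed
  have "continuous_field T (\<lambda>t x. \<chi> i j. partial i (\<lambda>y. V t y $ j) x)"
    by (intro smooth_field_imp_continuous smooth_field_vec_lambda smooth_field_partial smooth_field_nth T V)
  then obtain C where C: "0 < C" "\<And>t x. t \<in> {0..T} \<Longrightarrow> norm (\<chi> i j. partial i (\<lambda>y. V t y $ j) x) \<le> C"
    by (rule continuous_field_bounded) (rule that)
  define N where "N = real CARD('n)"
  define e where "e t = integral cube (\<lambda>x. D t x \<bullet> D t x)" for t
  define e' where "e' t = integral cube (\<lambda>x. 2 * (D t x \<bullet> dt T D t x))" for t
  have der: "(e has_vector_derivative e' t) (at t within {0..T})" if t: "t \<in> {0..T}" for t
    using has_vector_derivative_integral_cube[OF T smooth_field_inner[OF T D D] t]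
    by (simp add: e_def[abs_def] e'_def dt_inner[OF T D D t, THEN ext] inner_commute)
  \<comment> \<open>The form \<open>?R\<close> has N * N summands, each at most C |D|^2 in absolute
    value with C a bound for the derivative of V. The factor 2 comes from differentiating
    |D|^2.\<close>
  have bd: "e' t \<ge> - (2 * N * N * C) * e t" if t: "t \<in> {0..T}" for t
  proof -
    let ?R = "\<lambda>x. \<Sum>i\<in>UNIV. \<Sum>j\<in>UNIV. D t x $ i * D t x $ j * partial i (\<lambda>y. V t y $ j) x"
    let ?S = "\<lambda>x. D t x \<bullet> ((2 *\<^sub>R sym_grad (D t) x) *v V t x)"
    have cD: "C1_periodic (\<lambda>x. D t x \<bullet> D t x)" by (intro C1_periodic_inner c1 t)
    have S: "?S integrable_on cube"
      using C1_periodicD(5)[OF smooth_field_C1_periodic[OF T smooth_field_inner[OF T D smooth_field_matrix_vector_mult[OF T smooth_field_scaleR[OF T smooth_field_const[OF T] smooth_field_sym_grad[OF T D]] V]] t]] .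
    note chi = inner_grad_integrable[OF c1(1)[OF t] c1chi[OF t]]
    have "D t x \<bullet> dt T D t x = - ?S x - D t x \<bullet> grad (w t) x" for x
      using gchi[OF t, of x] by (simp add: inner_diff_right)
    then have "e' t = integral cube (\<lambda>x. 2 * (- ?S x - D t x \<bullet> grad (w t) x))"
      by (simp add: e'_def)
    also have "\<dots> = 2 * (- integral cube ?S - integral cube (\<lambda>x. D t x \<bullet> grad (w t) x))"
      using S chi by (simp add: integral_diff integrable_neg)
    also have "\<dots> = 2 * integral cube ?R"
      using integral_sym_grad_transport[OF c1[OF t] divD[OF t] divV[OF t]]
        integral_inner_grad_div_free[OF c1(1)[OF t] c1chi[OF t] divD[OF t]] by simp
    finally have e': "e' t = 2 * integral cube ?R" .
    have R: "?R integrable_on cube"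
      using c1[OF t, THEN C1_periodicD(3)] c1(2)[OF t, THEN C1_periodicD(4)]
      by (intro integrable_continuous_cube continuous_on_sum continuous_on_mult) auto
    have "- (N * N * C) * (D t x \<bullet> D t x) \<le> ?R x" for x
    proof -
      have "\<bar>D t x $ i * D t x $ j * partial i (\<lambda>y. V t y $ j) x\<bar> \<le> (D t x \<bullet> D t x) * C" for i j
      proof -
        have "\<bar>partial i (\<lambda>y. V t y $ j) x\<bar> = \<bar>(\<chi> i j. partial i (\<lambda>y. V t y $ j) x) $ i $ j\<bar>" by simp
        also have "\<dots> \<le> C"
          by (rule order_trans[OF component_le_norm_cart order_trans[OF Finite_Cartesian_Product.norm_nth_le C(2)[OF t]]])
        finally have "\<bar>partial i (\<lambda>y. V t y $ j) x\<bar> \<le> C" .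
        moreover have "\<bar>D t x $ i\<bar> * \<bar>D t x $ j\<bar> \<le> norm (D t x) * norm (D t x)"
          by (intro mult_mono component_le_norm_cart) auto
        ultimately show ?thesis
          unfolding abs_mult by (intro mult_mono) (auto simp: power2_norm_eq_inner[symmetric] power2_eq_square)
      qed
      then have "\<bar>?R x\<bar> \<le> (\<Sum>i\<in>(UNIV::'n set). \<Sum>j\<in>(UNIV::'n set). (D t x \<bullet> D t x) * C)"
        by (intro order_trans[OF sum_abs] sum_mono order_trans[OF sum_abs])
      then show ?thesis by (simp add: N_def algebra_simps abs_le_iff)
    qed
    then have "integral cube (\<lambda>x. - (N * N * C) * (D t x \<bullet> D t x)) \<le> integral cube ?R"
      by (intro integral_le R C1_periodicD(5) C1_periodic_cmult cD)
    moreover have "integral cube (\<lambda>x. - (N * N * C) * (D t x \<bullet> D t x)) = - (N * N * C) * e t"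
      unfolding e_def by (rule integral_mult_right)
    ultimately have "- (N * N * C) * e t \<le> integral cube ?R" by (simp only:)
    then have "2 * (- (N * N * C) * e t) \<le> 2 * integral cube ?R" by (intro mult_left_mono) simp_all
    moreover have "2 * (- (N * N * C) * e t) = - (2 * N * N * C) * e t" by simp
    ultimately show ?thesis unfolding e' by (simp only:)
  qed
  have "e T = 0" using F(6) F'(6) by (simp add: e_def D_def)
  from backward_gronwall_nonpos[OF der bd this t] have "e t \<le> 0" .
  moreover have "0 \<le> e t" unfolding e_def
    using C1_periodicD(5)[OF C1_periodic_inner[OF c1(1)[OF t] c1(1)[OF t]]] by (intro integral_nonneg) auto
  ultimately have "integral cube (\<lambda>x. D t x \<bullet> D t x) = 0" by (simp add: e_def)
  then have "D t x \<bullet> D t x = 0"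
    using C1_periodicD[OF C1_periodic_inner[OF c1(1)[OF t] c1(1)[OF t]]]
    by (intro integral_cube_eq_0_imp[of "\<lambda>x. D t x \<bullet> D t x"]) auto
  then show ?thesis by (simp add: D_def)
qed

section \<open>Space-time integrals and the weak constraint for potentials\<close>

lemma set_integrable_slab:
  fixes F :: "real \<times> (real^'n) \<Rightarrow> 'b::euclidean_space"
  assumes "continuous_on (slab T) F"
  shows "set_integrable lborel (slab T) F"
  using borel_integrable_compact[OF compact_slab assms] by (simp add: set_integrable_def)

lemma LINT_slab_eq:
  fixes F :: "real \<times> (real^'n) \<Rightarrow> real"
  assumes "continuous_on (slab T) F"
  shows "(LINT p:slab T|lborel. F p) = integral {0..T} (\<lambda>t. integral cube (\<lambda>x. F (t, x)))"
proof -
  have "(LINT p:slab T|lborel. F p) = integral (slab T) F"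
    by (rule set_borel_integral_eq_integral(2)[OF set_integrable_slab[OF assms]])
  also have "\<dots> = integral {0..T} (\<lambda>t. integral cube (\<lambda>x. F (t, x)))"
    using integral_prod_continuous[OF assms[unfolded slab_eq_cbox]] by (simp add: slab_eq_cbox cube_eq_cbox)
  finally show ?thesis .
qed

lemma smooth_on_Icc_has_vector_derivative:
  fixes \<zeta> :: "real \<Rightarrow> real"
  assumes T: "0 < T" and z: "smooth_on {0..T} \<zeta>"
  shows "t \<in> {0..T} \<Longrightarrow> (\<zeta> has_vector_derivative vector_derivative \<zeta> (at t within {0..T})) (at t within {0..T})"
    "continuous_on {0..T} (\<lambda>t. vector_derivative \<zeta> (at t within {0..T}))"
proof -
  let ?D = "\<lambda>t. frechet_derivative \<zeta> (at t within {0..T}) 1"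
  have D: "(\<zeta> has_vector_derivative ?D t) (at t within {0..T})" if "t \<in> {0..T}" for t
  proof -
    note d = smooth_on_has_derivative[OF z that]
    have "frechet_derivative \<zeta> (at t within {0..T}) = (\<lambda>h. h *\<^sub>R ?D t)"
    proof
      fix h
      show "frechet_derivative \<zeta> (at t within {0..T}) h = h *\<^sub>R ?D t"
        using linear_cmul[OF has_derivative_linear[OF d], of h 1] by simp
    qed
    with d show ?thesis unfolding has_vector_derivative_def by metis
  qed
  then have eq: "vector_derivative \<zeta> (at t within {0..T}) = ?D t" if "t \<in> {0..T}" for t
    using vector_derivative_within_cbox[of 0 T t \<zeta>] that T by simp
  show "t \<in> {0..T} \<Longrightarrow> (\<zeta> has_vector_derivative vector_derivative \<zeta> (at t within {0..T})) (at t within {0..T})"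
    using D eq by simp
  have "continuous_on {0..T} ?D"
    by (rule smooth_on_imp_continuous[OF smooth_on_frechet_derivative[OF axis_accessible_Icc[OF T] z]])
  then show "continuous_on {0..T} (\<lambda>t. vector_derivative \<zeta> (at t within {0..T}))"
    by (subst continuous_on_cong[OF refl eq])
qed

text \<open>Symmetry of \<psi> merges the two halves of the symmetrized gradient into the plain
  gradient of \<open>a\<close>; integration by parts then moves the derivative onto \<psi>.\<close>

lemma integral_sym_grad_inner:
  fixes a :: "real^'n \<Rightarrow> real^'n" and \<psi> :: "real^'n \<Rightarrow> real^'n^'n"
  assumes a: "\<And>i. C1_periodic (\<lambda>x. a x $ i)" and psi: "\<And>i j. C1_periodic (\<lambda>x. \<psi> x $ i $ j)"
    and sym: "\<And>x. symmetric_matrix (\<psi> x)"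
  shows "integral cube (\<lambda>x. sym_grad a x \<bullet> \<psi> x) = - integral cube (\<lambda>x. a x \<bullet> div_mat \<psi> x)"
proof -
  note A = C1_periodicD[OF a] and P = C1_periodicD[OF psi]
  have sy: "\<psi> x $ j $ i = \<psi> x $ i $ j" for x i j
    using sym[of x] by (simp add: symmetric_matrix_def transpose_def vec_eq_iff)
  have "sym_grad a x \<bullet> \<psi> x = (\<Sum>i\<in>UNIV. \<Sum>j\<in>UNIV. partial j (\<lambda>y. a y $ i) x * \<psi> x $ i $ j)" for x
  proof -
    let ?s = "\<Sum>i\<in>UNIV. \<Sum>j\<in>UNIV. partial j (\<lambda>y. a y $ i) x * \<psi> x $ i $ j"
    have "sym_grad a x \<bullet> \<psi> x = (1/2) * ?s + (1/2) * (\<Sum>i\<in>UNIV. \<Sum>j\<in>UNIV. partial i (\<lambda>y. a y $ j) x * \<psi> x $ i $ j)"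
      by (simp add: inner_vec_def sym_grad_def sum_distrib_left sum.distrib[symmetric] field_simps)
    also have "(\<Sum>i\<in>UNIV. \<Sum>j\<in>UNIV. partial i (\<lambda>y. a y $ j) x * \<psi> x $ i $ j) = ?s"
      by (subst sum.swap) (simp add: sy)
    finally show ?thesis by simp
  qed
  then have "integral cube (\<lambda>x. sym_grad a x \<bullet> \<psi> x) =
     (\<Sum>i\<in>UNIV. \<Sum>j\<in>UNIV. integral cube (\<lambda>x. partial j (\<lambda>y. a y $ i) x * \<psi> x $ i $ j))"
    using A P by (simp add: integral_sum integrable_sum integrable_continuous_cube continuous_on_mult)
  also have "\<dots> = - (\<Sum>i\<in>UNIV. \<Sum>j\<in>UNIV. integral cube (\<lambda>x. a x $ i * partial j (\<lambda>y. \<psi> y $ i $ j) x))"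
    by (simp add: integral_by_parts_torus[OF a psi] sum_negf)
  also have "\<dots> = - integral cube (\<lambda>x. a x \<bullet> div_mat \<psi> x)"
    using A P by (simp add: inner_vec_def div_mat_def sum_distrib_left integral_sum integrable_sum
        integrable_continuous_cube continuous_on_mult)
  finally show ?thesis .
qed

text \<open>Let m(t) be the integral of A . div \<psi>. The B term contributes -\<zeta>' m, and the
  E term -\<zeta> m', because both potentials disappear against divergence-free fields. The
  integrand in time is thus the derivative of -\<zeta> m, whose boundary values vanish by \<zeta>(0)
  = 0 and A(T) = 0.\<close>

lemma weak_constraint_potential:
  fixes A :: "real \<Rightarrow> real^'n \<Rightarrow> real^'n"
  assumes T: "0 < T" and A: "smooth_field T A" and div: "\<And>t x. t \<in> {0..T} \<Longrightarrow> divergence (A t) x = 0"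
    and AT: "\<And>x. A T x = 0" and phi: "\<And>t. t \<in> {0..T} \<Longrightarrow> C1_periodic (\<phi> t)"
    and E: "continuous_on (slab T) (\<lambda>(t, x). dt T A t x + grad (\<phi> t) x)"
  shows "weak_constraint T (\<lambda>t x. dt T A t x + grad (\<phi> t) x) (\<lambda>t x. sym_grad (A t) x)"
  unfolding weak_constraint_def
proof (intro allI impI, elim conjE)
  fix \<zeta> :: "real \<Rightarrow> real" and \<psi> :: "real^'n \<Rightarrow> real^'n^'n" and \<theta> :: "real^'n \<Rightarrow> real"
  assume z: "smooth_on {0..T} \<zeta>" "\<zeta> 0 = 0" and psi: "smooth_on UNIV \<psi>" "periodic \<psi>" "\<forall>x. symmetric_matrix (\<psi> x)"
    and th: "is_inv_neg_laplacian (divergence (div_mat \<psi>)) \<theta>"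
  let ?E = "\<lambda>t x. dt T A t x + grad (\<phi> t) x" and ?z' = "\<lambda>t. vector_derivative \<zeta> (at t within {0..T})"
  define w where "w x = div_mat \<psi> x + grad \<theta> x" for x
  define m where "m t = integral cube (\<lambda>x. A t x \<bullet> div_mat \<psi> x)" for t
  define m' where "m' t = integral cube (\<lambda>x. dt T A t x \<bullet> div_mat \<psi> x)" for t
  have fpsi: "smooth_field T (\<lambda>t. \<psi>)" by (rule smooth_field_static[OF T psi(1,2)])
  have fdiv: "smooth_field T (\<lambda>t. div_mat \<psi>)" by (rule smooth_field_div_mat[OF T fpsi])
  have fth: "smooth_field T (\<lambda>t. \<theta>)"
    using th by (intro smooth_field_static[OF T]) (auto simp: is_inv_neg_laplacian_def)
  have fgr: "smooth_field T (\<lambda>t. grad \<theta>)" by (rule smooth_field_grad[OF T fth])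
  have fw: "smooth_field T (\<lambda>t. w)"
    unfolding w_def[abs_def] by (intro smooth_field_add[OF T] fdiv fgr)
  have dA: "smooth_field T (dt T A)" by (rule smooth_field_dt[OF T A])
  have c0: "0 \<in> {0..T}" using T by simp
  have cth: "C1_periodic \<theta>" by (rule smooth_field_C1_periodic[OF T fth c0])
  have cw: "C1_periodic (\<lambda>x. w x $ i)" for i by (rule smooth_field_C1_periodic_nth[OF T fw c0])
  have cdiv: "C1_periodic (\<lambda>x. div_mat \<psi> x $ i)" for i by (rule smooth_field_C1_periodic_nth[OF T fdiv c0])
  have cgr: "C1_periodic (\<lambda>x. grad \<theta> x $ i)" for i by (rule smooth_field_C1_periodic_nth[OF T fgr c0])
  have cpsi: "C1_periodic (\<lambda>x. \<psi> x $ i $ j)" for i j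
    by (rule smooth_field_C1_periodic[OF T smooth_field_nth[OF T smooth_field_nth[OF T fpsi]] c0])
  \<comment> \<open>The nonlocal term is there for this: \<theta> corrects div \<psi> to a
    divergence-free field, so E is tested only modulo gradients.\<close>
  have divw: "divergence w x = 0" for x
  proof -
    have "divergence w x = divergence (div_mat \<psi>) x + divergence (grad \<theta>) x"
      by (simp add: divergence_def w_def partial_add C1_periodicD(2)[OF cdiv] C1_periodicD(2)[OF cgr] sum.distrib)
    also have "divergence (grad \<theta>) x = laplacian \<theta> x" by (simp add: divergence_def grad_def laplacian_def)
    finally have "divergence w x = divergence (div_mat \<psi>) x + laplacian \<theta> x" .
    moreover have "divergence (div_mat \<psi>) x = - laplacian \<theta> x"
      using th unfolding is_inv_neg_laplacian_def by metis
    ultimately show ?thesis by simp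
  qed
  have cA: "C1_periodic (\<lambda>x. A t x $ i)" "C1_periodic (\<lambda>x. dt T A t x $ i)" if "t \<in> {0..T}" for t i
    using smooth_field_C1_periodic_nth[OF T _ that] A dA by blast+
  have B: "integral cube (\<lambda>x. sym_grad (A t) x \<bullet> \<psi> x) = - m t" if t: "t \<in> {0..T}" for t
    using integral_sym_grad_inner[OF cA(1)[OF t] cpsi] psi(3) by (simp add: m_def)
  have Ew: "integral cube (\<lambda>x. ?E t x \<bullet> w x) = m' t" if t: "t \<in> {0..T}" for t
  proof -
    have i1: "(\<lambda>x. dt T A t x \<bullet> div_mat \<psi> x) integrable_on cube"
      by (intro C1_periodicD(5) C1_periodic_inner cA t cdiv)
    note i2 = inner_grad_integrable[OF cA(2)[OF t] cth] and i3 = inner_grad_integrable[OF cw phi[OF t]]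
    have "?E t x \<bullet> w x = dt T A t x \<bullet> div_mat \<psi> x + dt T A t x \<bullet> grad \<theta> x + w x \<bullet> grad (\<phi> t) x" for x
      by (simp add: w_def inner_add_left inner_add_right inner_commute)
    then have "integral cube (\<lambda>x. ?E t x \<bullet> w x) =
       m' t + integral cube (\<lambda>x. dt T A t x \<bullet> grad \<theta> x) + integral cube (\<lambda>x. w x \<bullet> grad (\<phi> t) x)"
      using i1 i2 i3 by (simp add: integral_add integrable_add m'_def)
    also have "\<dots> = m' t"
      using integral_inner_grad_div_free[OF cA(2)[OF t] cth divergence_dt[OF T A div t]]
        integral_inner_grad_div_free[OF cw phi[OF t] divw] by simp
    finally show ?thesis .
  qed
  have contz: "continuous_on (slab T) (\<lambda>p. \<zeta> (fst p))" "continuous_on (slab T) (\<lambda>p. ?z' (fst p))"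
  proof -
    have f: "continuous_on (slab T) fst" "fst ` slab T \<subseteq> {0..T}"
      by (auto simp: slab_def intro!: continuous_on_fst continuous_on_id)
    show "continuous_on (slab T) (\<lambda>p. \<zeta> (fst p))"
      by (rule continuous_on_compose2[OF smooth_on_imp_continuous[OF z(1)] f])
    show "continuous_on (slab T) (\<lambda>p. ?z' (fst p))"
      by (rule continuous_on_compose2[OF smooth_on_Icc_has_vector_derivative(2)[OF T z(1)] f])
  qed
  have contB: "continuous_on (slab T) (\<lambda>(t, x). sym_grad (A t) x \<bullet> \<psi> x)"
    by (rule continuous_fieldD(1)[OF smooth_field_imp_continuous[OF smooth_field_inner[OF T smooth_field_sym_grad[OF T A] fpsi]]])
  have contE: "continuous_on (slab T) (\<lambda>(t, x). ?E t x \<bullet> w x)"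
    using continuous_on_inner[OF E continuous_fieldD(1)[OF smooth_field_imp_continuous[OF fw]]]
    by (simp add: case_prod_unfold)
  have cont: "continuous_on (slab T) (\<lambda>(t, x). ?z' t * (sym_grad (A t) x \<bullet> \<psi> x) - \<zeta> t * (?E t x \<bullet> w x))"
    using continuous_on_diff[OF continuous_on_mult[OF contz(2) contB] continuous_on_mult[OF contz(1) contE]]
    by (simp add: case_prod_unfold)
  have "(LINT (t, x):slab T|lborel. ?z' t * (sym_grad (A t) x \<bullet> \<psi> x) - \<zeta> t * (?E t x \<bullet> w x)) =
    integral {0..T} (\<lambda>t. integral cube (\<lambda>x. ?z' t * (sym_grad (A t) x \<bullet> \<psi> x) - \<zeta> t * (?E t x \<bullet> w x)))"
    using LINT_slab_eq[OF cont] by simp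
  also have "\<dots> = integral {0..T} (\<lambda>t. - (\<zeta> t * m' t + ?z' t * m t))"
  proof (rule integral_cong)
    fix t assume t: "t \<in> {0..T}"
    have "continuous_on UNIV (\<lambda>x. sym_grad (A t) x \<bullet> \<psi> x)"
      by (rule C1_periodicD(3)[OF smooth_field_C1_periodic[OF T smooth_field_inner[OF T smooth_field_sym_grad[OF T A] fpsi] t]])
    then have i1: "(\<lambda>x. ?z' t * (sym_grad (A t) x \<bullet> \<psi> x)) integrable_on cube"
      by (intro integrable_continuous_cube continuous_on_mult continuous_on_const)
    have "(\<lambda>x. ?E t x \<bullet> w x) integrable_on cube"
      unfolding cube_eq_cbox
    proof (rule integrable_continuous)
      show "continuous_on (cbox 0 1) (\<lambda>x. ?E t x \<bullet> w x)"
        using continuous_on_compose2[OF contE, where f = "\<lambda>x. (t, x)" and s = "cbox 0 1"] t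
          continuous_on_Pair[OF continuous_on_const continuous_on_id, of "cbox 0 1" t]
        by (auto simp: slab_def cube_eq_cbox image_subset_iff)
    qed
    then have i2: "(\<lambda>x. \<zeta> t * (?E t x \<bullet> w x)) integrable_on cube"
      using integrable_cmul[of "\<lambda>x. ?E t x \<bullet> w x" cube "\<zeta> t"] by simp
    show "integral cube (\<lambda>x. ?z' t * (sym_grad (A t) x \<bullet> \<psi> x) - \<zeta> t * (?E t x \<bullet> w x)) = - (\<zeta> t * m' t + ?z' t * m t)"
      unfolding integral_diff[OF i1 i2] by (simp add: B[OF t] Ew[OF t])
  qed
  also have "\<dots> = 0"
  proof -
    have "((\<lambda>t. - (\<zeta> t * m' t + ?z' t * m t)) has_integral (- (\<zeta> T * m T) - - (\<zeta> 0 * m 0))) {0..T}"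
    proof (rule fundamental_theorem_of_calculus)
      fix t assume t: "t \<in> {0..T}"
      have "(m has_vector_derivative m' t) (at t within {0..T})"
        using has_vector_derivative_integral_inner_static[OF T A fdiv t] by (simp add: m_def[abs_def] m'_def)
      from has_vector_derivative_minus[OF bounded_bilinear.has_vector_derivative[OF bounded_bilinear_mult
          smooth_on_Icc_has_vector_derivative(1)[OF T z(1) t] this]]
      show "((\<lambda>t. - (\<zeta> t * m t)) has_vector_derivative - (\<zeta> t * m' t + ?z' t * m t)) (at t within {0..T})" .
    qed (use T in simp)
    moreover have "m T = 0" by (simp add: m_def AT)
    ultimately show ?thesis using z(2) by (simp add: integral_unique)
  qed
  finally show "(LINT (t, x):slab T|lborel. ?z' t * (sym_grad (A t) x \<bullet> \<psi> x) - \<zeta> t * (?E t x \<bullet> (div_mat \<psi> x + grad \<theta> x))) = 0"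
    by (simp add: w_def)
qed

section \<open>Bernstein approximation in time\<close>

lemma smooth_on_mult:
  fixes f g :: "'a::euclidean_space \<Rightarrow> real"
  shows "axis_accessible S \<Longrightarrow> smooth_on S f \<Longrightarrow> smooth_on S g \<Longrightarrow> smooth_on S (\<lambda>x. f x * g x)"
  by (rule smooth_on_bounded_bilinear[OF bounded_bilinear_mult])

lemma smooth_on_power:
  fixes f :: "'a::euclidean_space \<Rightarrow> real"
  shows "axis_accessible S \<Longrightarrow> smooth_on S f \<Longrightarrow> smooth_on S (\<lambda>x. f x ^ n)"
  by (induction n) (auto intro: smooth_on_const smooth_on_mult)

text \<open>A Bernstein basis polynomial rescaled to [0,T] is the derivative; starting the integral
  at 0 gives the zero initial value demanded of time test functions.\<close>

definition bernstein_primitive :: "real \<Rightarrow> nat \<Rightarrow> nat \<Rightarrow> real \<Rightarrow> real" where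
  "bernstein_primitive T n k t = integral {0..t} (\<lambda>s. Bernstein n k (s / T))"

lemma continuous_on_Bernstein: "continuous_on S (\<lambda>s. Bernstein n k (s / T))"
  unfolding Bernstein_def divide_inverse by (intro continuous_intros)

lemma bernstein_primitive_has_vector_derivative:
  assumes "t \<in> {0..T}"
  shows "(bernstein_primitive T n k has_vector_derivative Bernstein n k (t / T)) (at t within {0..T})"
  unfolding bernstein_primitive_def[abs_def]
  by (rule integral_has_vector_derivative[OF continuous_on_Bernstein assms])

lemma smooth_on_bernstein_primitive:
  assumes T: "0 < T"
  shows "smooth_on {0..T} (bernstein_primitive T n k)"
proof (rule smooth_on_SucI[OF axis_accessible_Icc[OF T]])
  show "(bernstein_primitive T n k has_derivative (\<lambda>h. h *\<^sub>R Bernstein n k (t / T))) (at t within {0..T})" if "t \<in> {0..T}" for t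
    using bernstein_primitive_has_vector_derivative[OF that] by (simp add: has_vector_derivative_def)
  have a: "axis_accessible {0..T}" by (rule axis_accessible_Icc[OF T])
  have s: "smooth_on {0..T} (\<lambda>t. t / T)"
    by (rule smooth_on_bounded_linear_self[OF bounded_linear_divide a])
  have "smooth_on {0..T} (\<lambda>t. Bernstein n k (t / T))"
    unfolding Bernstein_def
    by (intro smooth_on_mult smooth_on_power smooth_on_diff smooth_on_const a s)
  then show "smooth_on {0..T} (\<lambda>t. b *\<^sub>R Bernstein n k (t / T))" if "b \<in> Basis" for b
    using that by simp
qed

lemma bernstein_uniform_limit:
  fixes f :: "real \<Rightarrow> real"
  assumes "continuous_on {0..1} f"
  shows "uniform_limit {0..1} (\<lambda>n s. \<Sum>k\<le>n. Bernstein n k s * f (real k / real n)) f sequentially"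
  unfolding uniform_limit_sequentially_iff
proof (intro allI impI)
  fix e :: real assume "e > 0"
  from Bernstein_Weierstrass[OF assms this] obtain N where
    "\<And>n x. N \<le> n \<Longrightarrow> x \<in> {0..1} \<Longrightarrow> \<bar>f x - (\<Sum>k\<le>n. f (real k / real n) * Bernstein n k x)\<bar> < e"
    by blast
  then show "\<exists>N. \<forall>n\<ge>N. \<forall>x\<in>{0..1}. dist (\<Sum>k\<le>n. Bernstein n k x * f (real k / real n)) (f x) < e"
    by (auto simp: dist_real_def abs_minus_commute mult.commute intro!: exI[of _ N])
qed

lemma bernstein_tendsto:
  fixes f :: "real \<Rightarrow> real"
  assumes "continuous_on {0..1} f" "s \<in> {0..1}"
  shows "(\<lambda>n. \<Sum>k\<le>n. Bernstein n k s * f (real k / real n)) \<longlonglongrightarrow> f s"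
  using tendsto_uniform_limitI[OF bernstein_uniform_limit[OF assms(1)] assms(2)] .

text \<open>Bernstein approximation converges uniformly, so it may be integrated in time term by
  term.\<close>

lemma bernstein_primitive_tendsto:
  fixes f :: "real \<Rightarrow> real"
  assumes T: "0 < T" and f: "continuous_on {0..1} f" and t: "t \<in> {0..T}"
  shows "(\<lambda>n. \<Sum>k\<le>n. bernstein_primitive T n k t * f (real k / real n)) \<longlonglongrightarrow> integral {0..t} (\<lambda>s. f (s / T))"
proof -
  have "uniform_limit {0..t} (\<lambda>n s. \<Sum>k\<le>n. Bernstein n k (s / T) * f (real k / real n)) (\<lambda>s. f (s / T)) sequentially"
    using bernstein_uniform_limit[OF f]
    by (rule uniform_limit_compose'[where h = "\<lambda>s. s / T"]) (use T t in \<open>auto simp: field_simps\<close>)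
  moreover have "continuous_on {0..t} (\<lambda>s. \<Sum>k\<le>n. Bernstein n k (s / T) * f (real k / real n))" for n
    by (intro continuous_on_sum continuous_on_mult continuous_on_Bernstein continuous_on_const)
  ultimately obtain I J where I: "\<And>n. ((\<lambda>s. \<Sum>k\<le>n. Bernstein n k (s / T) * f (real k / real n)) has_integral I n) {0..t}"
      and J: "((\<lambda>s. f (s / T)) has_integral J) {0..t}" "I \<longlonglongrightarrow> J"
    by (rule uniform_limit_integral[OF _ _ sequentially_bot]) (rule that)
  have "I n = (\<Sum>k\<le>n. bernstein_primitive T n k t * f (real k / real n))" for n
  proof (rule has_integral_unique[OF I])
    show "((\<lambda>s. \<Sum>k\<le>n. Bernstein n k (s / T) * f (real k / real n)) has_integral
        (\<Sum>k\<le>n. bernstein_primitive T n k t * f (real k / real n))) {0..t}"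
      unfolding bernstein_primitive_def
      by (intro has_integral_sum has_integral_mult_left integrable_integral integrable_continuous_real continuous_on_Bernstein) auto
  qed
  then have "I = (\<lambda>n. \<Sum>k\<le>n. bernstein_primitive T n k t * f (real k / real n))" by (rule ext)
  with J show ?thesis by (simp add: integral_unique)
qed

lemma bernstein_primitive_nonneg:
  assumes "0 < T" "t \<in> {0..T}"
  shows "0 \<le> bernstein_primitive T n k t"
  unfolding bernstein_primitive_def
  using assms by (intro integral_nonneg integrable_continuous_real continuous_on_Bernstein Bernstein_nonneg) (auto simp: field_simps)

text \<open>The partition of unity, integrated. Together with nonnegativity it bounds the weights at
  time t by total mass t, independently of n, and this supplies the dominating function for the
  passage to the limit.\<close>

lemma sum_bernstein_primitive:
  assumes "0 \<le> t"
  shows "(\<Sum>k\<le>n. bernstein_primitive T n k t) = t"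
proof -
  have "(\<Sum>k\<le>n. bernstein_primitive T n k t) = integral {0..t} (\<lambda>s. \<Sum>k\<le>n. Bernstein n k (s / T))"
    unfolding bernstein_primitive_def
    by (rule integral_sum[symmetric]) (auto intro!: integrable_continuous_real continuous_on_Bernstein)
  then show ?thesis using assms by simp
qed

section \<open>Matrices close to the identity\<close>

lemma inner_outer: "m \<bullet> outer v v = v \<bullet> (m *v v)"
  by (simp add: inner_vec_def outer_def matrix_vector_mult_def sum_distrib_left ac_simps)

lemma outer_mult: "outer v w *v z = (w \<bullet> z) *\<^sub>R v"
  by (simp add: vec_eq_iff outer_def matrix_vector_mult_def inner_vec_def sum_distrib_left sum_distrib_right ac_simps)

lemma symmetric_outer: "symmetric_matrix (outer v v)"
  by (simp add: symmetric_matrix_def transpose_def outer_def vec_eq_iff)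

text \<open>Only small perturbations of the identity are needed, so positivity of the pairing with a
  positive semidefinite matrix follows from the diagonal dominating the off-diagonal entries,
  without the spectral theorem.\<close>
lemma psd_inner_near_identity:
  fixes B N :: "real^'n^'n"
  assumes B: "\<And>i j. \<bar>B $ i $ j\<bar> \<le> 1 / (4 * real CARD('n))"
    and sym: "symmetric_matrix N" and psd: "\<And>v. 0 \<le> v \<bullet> (N *v v)"
  shows "(1/2) * trace N \<le> (mat 1 + 2 *\<^sub>R B) \<bullet> N" "0 \<le> trace N"
proof -
  let ?n = "real CARD('n)"
  have sy: "N $ j $ i = N $ i $ j" for i j
    using sym by (simp add: symmetric_matrix_def transpose_def vec_eq_iff)
  have ax: "axis i 1 \<bullet> (N *v axis j 1) = N $ i $ j" for i j
    by (simp add: matrix_vector_mult_basis inner_axis' column_def)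
  have diag: "0 \<le> N $ i $ i" for i using psd[of "axis i 1"] ax by simp
  \<comment> \<open>The quadratic form is evaluated at the sum and at the difference of two basis
    vectors.\<close>
  have off: "\<bar>N $ i $ j\<bar> \<le> (N $ i $ i + N $ j $ j) / 2" for i j
  proof -
    have "0 \<le> N $ i $ i + N $ j $ j + 2 * N $ i $ j"
      using psd[of "axis i 1 + axis j 1"] sy[of i j]
      by (simp add: matrix_vector_right_distrib inner_add_left inner_add_right ax)
    moreover have "0 \<le> N $ i $ i + N $ j $ j - 2 * N $ i $ j"
      using psd[of "axis i 1 - axis j 1"] sy[of i j]
      by (simp add: matrix_vector_mult_diff_distrib inner_diff_left inner_diff_right ax)
    ultimately show ?thesis by (simp add: abs_le_iff)
  qed
  show "0 \<le> trace N" unfolding trace_def by (intro sum_nonneg diag)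
  have "\<bar>B \<bullet> N\<bar> \<le> (\<Sum>i\<in>UNIV. \<Sum>j\<in>UNIV. \<bar>B $ i $ j * N $ i $ j\<bar>)"
    unfolding inner_vec_def inner_real_def by (rule order_trans[OF sum_abs sum_mono[OF sum_abs]])
  \<comment> \<open>Summing (N_ii + N_jj) / 2 over all pairs gives d times the trace. The factor
    1/(4d) turns this into a quarter of the trace, and doubling B leaves half of the trace to
    spare.\<close>
  also have "\<dots> \<le> (\<Sum>i\<in>(UNIV::'n set). \<Sum>j\<in>(UNIV::'n set). 1 / (4 * ?n) * ((N $ i $ i + N $ j $ j) / 2))"
    unfolding abs_mult by (intro sum_mono mult_mono B off) auto
  also have "\<dots> = 1 / (4 * ?n) * (?n * trace N)"
    by (simp add: sum_distrib_left[symmetric] sum_divide_distrib[symmetric] sum.distrib trace_def)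
  also have "\<dots> = (1/4) * trace N" by simp
  finally have "\<bar>B \<bullet> N\<bar> \<le> (1/4) * trace N" .
  moreover have "mat 1 \<bullet> N = trace N"
    by (simp add: inner_vec_def mat_def trace_def if_distrib if_distribR sum.delta cong: if_cong)
  ultimately show "(1/2) * trace N \<le> (mat 1 + 2 *\<^sub>R B) \<bullet> N"
    by (simp add: inner_add_left abs_le_iff)
qed

text \<open>The pairing bound for the rank-one matrix v \<otimes> v, whose trace is |v|^2.\<close>

lemma near_identity_coercive:
  fixes B :: "real^'n^'n"
  assumes B: "\<And>i j. \<bar>B $ i $ j\<bar> \<le> 1 / (4 * real CARD('n))"
  shows "(1/2) * (v \<bullet> v) \<le> v \<bullet> ((mat 1 + 2 *\<^sub>R B) *v v)"
proof -
  have "0 \<le> z \<bullet> (outer v v *v z)" for z by (simp add: outer_mult inner_commute)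
  from psd_inner_near_identity(1)[OF B symmetric_outer this]
  moreover have "trace (outer v v) = v \<bullet> v" by (simp add: trace_def outer_def inner_vec_def)
  ultimately show ?thesis by (simp only: inner_outer)
qed

text \<open>Coercivity makes the kernel trivial, which yields a left inverse and, in finite
  dimension, a two-sided one. Its existence is what gives \<open>matrix_inv\<close>, defined by
  choice, its meaning.\<close>

lemma near_identity_inverse:
  fixes B :: "real^'n^'n"
  assumes B: "\<And>i j. \<bar>B $ i $ j\<bar> \<le> 1 / (4 * real CARD('n))"
  shows "matrix_inv (mat 1 + 2 *\<^sub>R B) *v ((mat 1 + 2 *\<^sub>R B) *v v) = v"
proof -
  let ?G = "mat 1 + 2 *\<^sub>R B"
  have "x = 0" if "?G *v x = 0" for x
    using near_identity_coercive[OF B, of x] that inner_ge_zero[of x] by simp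
  then have "\<exists>G'. G' ** ?G = mat 1" by (subst matrix_left_invertible_ker) blast
  then obtain G' where "G' ** ?G = mat 1" by blast
  then have "?G ** G' = mat 1 \<and> G' ** ?G = mat 1" using matrix_left_right_inverse by blast
  then have "matrix_inv ?G ** ?G = mat 1"
    unfolding matrix_inv_def by (rule someI2) blast
  then show ?thesis by (simp add: matrix_vector_mul_assoc)
qed

lemma symmetric_matrix_inner_commute:
  fixes G :: "real^'n^'n"
  assumes "symmetric_matrix G"
  shows "x \<bullet> (G *v y) = y \<bullet> (G *v x)"
  using assms by (metis dot_lmul_matrix inner_commute symmetric_matrix_def transpose_matrix_vector)

text \<open>Completing the square: the gap is the quadratic form of the matrix at \<open>v + z\<close>.\<close>
lemma legendre_bound:
  fixes B M :: "real^'n^'n"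
  assumes B: "\<And>i j. \<bar>B $ i $ j\<bar> \<le> 1 / (4 * real CARD('n))" and sB: "symmetric_matrix B"
    and M: "symmetric_matrix M" "loewner_le (outer z z) M"
  shows "2 * (- ((mat 1 + 2 *\<^sub>R B) *v v) \<bullet> z) - (mat 1 + 2 *\<^sub>R B) \<bullet> M \<le> v \<bullet> ((mat 1 + 2 *\<^sub>R B) *v v)"
proof -
  let ?G = "mat 1 + 2 *\<^sub>R B"
  have sG: "symmetric_matrix ?G"
    using sB by (auto simp: symmetric_matrix_def transpose_def vec_eq_iff mat_def)
  \<comment> \<open>Replacing M by its lower bound z \<otimes> z can only increase the left-hand
    side, because I + 2B pairs nonnegatively with the positive semidefinite remainder.\<close>
  have sN: "symmetric_matrix (M - outer z z)"
    using M(1) symmetric_outer[of z] by (simp add: symmetric_matrix_def transpose_def vec_eq_iff)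
  have "0 \<le> w \<bullet> ((M - outer z z) *v w)" for w
    using M(2) by (simp add: loewner_le_def matrix_vector_mult_diff_rdistrib inner_diff_right)
  note psd_inner_near_identity[OF B sN this]
  then have "0 \<le> ?G \<bullet> (M - outer z z)" by linarith
  then have "z \<bullet> (?G *v z) \<le> ?G \<bullet> M" by (simp add: inner_diff_right inner_outer)
  moreover have "0 \<le> (v + z) \<bullet> (?G *v (v + z))"
    using near_identity_coercive[OF B, of "v + z"] inner_ge_zero[of "v + z"] by linarith
  moreover have "(v + z) \<bullet> (?G *v (v + z)) = v \<bullet> (?G *v v) + 2 * (z \<bullet> (?G *v v)) + z \<bullet> (?G *v z)"
    using symmetric_matrix_inner_commute[OF sG, of v z]
    by (simp add: matrix_vector_right_distrib inner_add_left inner_add_right)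
  ultimately show ?thesis by (simp add: inner_commute[of z])
qed

section \<open>The weak constraint along an Euler flow\<close>

lemma EB_D:
  assumes "(E, B) \<in> EB T"
  shows "L2_field T E" "Linf_field T B" "t \<in> {0..T} \<Longrightarrow> symmetric_matrix (B t x)" "weak_constraint T E B"
  using assms by (auto simp: EB_def)

lemma slab_sets [measurable]: "slab T \<in> sets borel"
  by (simp add: slab_eq_cbox)

text \<open>The slab has finite measure, so square integrability implies integrability through |v|
  \<le> 1 + |v|^2.\<close>

lemma L2_field_integrable_norm:
  assumes "L2_field T E"
  shows "set_borel_measurable lborel (slab T) (\<lambda>(t, x). E t x)"
    "set_integrable lborel (slab T) (\<lambda>(t, x). norm (E t x))"
proof -
  show m: "set_borel_measurable lborel (slab T) (\<lambda>(t, x). E t x)"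
    using assms by (simp add: L2_field_def)
  have "set_integrable lborel (slab T) (\<lambda>(t, x). 1 + (norm (E t x))\<^sup>2)"
    using set_integral_add(1)[OF set_integrable_slab[OF continuous_on_const[of _ "1::real"]], of T "\<lambda>(t, x). (norm (E t x))\<^sup>2"] assms
    by (simp add: L2_field_def case_prod_unfold)
  moreover have "set_borel_measurable lborel (slab T) (\<lambda>(t, x). norm (E t x))"
  proof -
    have "(\<lambda>p. norm (indicator (slab T) p *\<^sub>R (case p of (t, x) \<Rightarrow> E t x))) \<in> borel_measurable lborel"
      using m unfolding set_borel_measurable_def by (rule measurable_compose[OF _ borel_measurable_norm])
    then show ?thesis by (simp add: set_borel_measurable_def case_prod_unfold)
  qed
  moreover have bd: "norm v \<le> 1 + (norm v)\<^sup>2" for v :: 'b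
  proof -
    have "0 \<le> (norm v - 1/2)\<^sup>2" by simp
    then show ?thesis by (simp add: power2_eq_square algebra_simps)
  qed
  ultimately show "set_integrable lborel (slab T) (\<lambda>(t, x). norm (E t x))"
    by - (rule set_integrable_bound, use bd in \<open>auto simp: case_prod_unfold abs_of_nonneg add_nonneg_nonneg\<close>)
qed

lemma Linf_field_integrable_norm:
  assumes "Linf_field T B"
  shows "set_borel_measurable lborel (slab T) (\<lambda>(t, x). B t x)"
    "set_integrable lborel (slab T) (\<lambda>(t, x). norm (B t x))"
proof -
  show m: "set_borel_measurable lborel (slab T) (\<lambda>(t, x). B t x)"
    using assms by (simp add: Linf_field_def)
  obtain C where C: "AE (t, x) in lborel. (t, x) \<in> slab T \<longrightarrow> norm (B t x) \<le> C"
    using assms by (auto simp: Linf_field_def)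
  have "set_borel_measurable lborel (slab T) (\<lambda>(t, x). norm (B t x))"
  proof -
    have "(\<lambda>p. norm (indicator (slab T) p *\<^sub>R (case p of (t, x) \<Rightarrow> B t x))) \<in> borel_measurable lborel"
      using m unfolding set_borel_measurable_def by (rule measurable_compose[OF _ borel_measurable_norm])
    then show ?thesis by (simp add: set_borel_measurable_def case_prod_unfold)
  qed
  moreover have "AE p in lborel. p \<in> slab T \<longrightarrow> norm (case p of (t, x) \<Rightarrow> norm (B t x)) \<le> norm C"
    by (rule eventually_mono[OF C]) auto
  ultimately show "set_integrable lborel (slab T) (\<lambda>(t, x). norm (B t x))"
    by (rule set_integrable_bound[OF set_integrable_slab[OF continuous_on_const[of _ C]]])
qed

text \<open>Serves E and B alike: on the slab both are integrable in norm, and a continuous factor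
  is bounded there.\<close>

lemma set_integrable_inner_continuous:
  fixes u F :: "real \<times> (real^'n) \<Rightarrow> 'b::euclidean_space"
  assumes m: "set_borel_measurable lborel (slab T) u" and i: "set_integrable lborel (slab T) (\<lambda>p. norm (u p))"
    and F: "continuous_on (slab T) F"
  shows "set_integrable lborel (slab T) (\<lambda>p. u p \<bullet> F p)"
proof -
  have "bounded (F ` slab T)"
    using compact_continuous_image[OF F compact_slab] compact_imp_bounded by blast
  then obtain C where C: "0 < C" "\<And>p. p \<in> slab T \<Longrightarrow> norm (F p) \<le> C"
    unfolding bounded_pos by auto
  have Ci: "set_integrable lborel (slab T) (\<lambda>p. C * norm (u p))" using i by simp
  have Fm: "set_borel_measurable lborel (slab T) (\<lambda>p. u p \<bullet> F p)"
  proof -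
    have "(\<lambda>p. (indicator (slab T) p *\<^sub>R u p) \<bullet> (indicator (slab T) p *\<^sub>R F p)) \<in> borel_measurable lborel"
      using m borel_measurable_integrable[OF borel_integrable_compact[OF compact_slab F]]
      unfolding set_borel_measurable_def by (rule borel_measurable_inner)
    moreover have "(\<lambda>p. (indicator (slab T) p *\<^sub>R u p) \<bullet> (indicator (slab T) p *\<^sub>R F p)) = (\<lambda>p. indicator (slab T) p *\<^sub>R (u p \<bullet> F p))"
      by (auto simp: indicator_def)
    ultimately show ?thesis by (simp only: set_borel_measurable_def)
  qed
  have bd: "\<bar>u p \<bullet> F p\<bar> \<le> C * norm (u p)" if "p \<in> slab T" for p
    using order_trans[OF Cauchy_Schwarz_ineq2 mult_left_mono[OF C(2)[OF that] norm_ge_zero]]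
    by (simp add: mult.commute)
  have "AE p in lborel. p \<in> slab T \<longrightarrow> norm (u p \<bullet> F p) \<le> norm (C * norm (u p))"
  proof (intro AE_I2 impI)
    fix p :: "real \<times> (real^'n)" assume "p \<in> slab T"
    from bd[OF this] C(1) show "norm (u p \<bullet> F p) \<le> norm (C * norm (u p))" by (simp add: abs_mult)
  qed
  then show ?thesis by (rule set_integrable_bound[OF Ci Fm])
qed

lemma EB_set_integrable:
  assumes "(E, B) \<in> EB T"
  shows "continuous_on (slab T) (\<lambda>(t, x). F t x) \<Longrightarrow> set_integrable lborel (slab T) (\<lambda>(t, x). E t x \<bullet> F t x)"
    "continuous_on (slab T) (\<lambda>(t, x). M t x) \<Longrightarrow> set_integrable lborel (slab T) (\<lambda>(t, x). B t x \<bullet> M t x)"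
  using set_integrable_inner_continuous[OF L2_field_integrable_norm[OF EB_D(1)[OF assms], unfolded case_prod_unfold], of "\<lambda>(t, x). F t x"]
    set_integrable_inner_continuous[OF Linf_field_integrable_norm[OF EB_D(2)[OF assms], unfolded case_prod_unfold], of "\<lambda>(t, x). M t x"]
  by (simp_all add: case_prod_unfold)

text \<open>Taking the divergence of the Euler equation removes the time derivative, as V stays
  divergence-free, so the Laplacian of q is the double divergence of V \<otimes> V. Hence \<theta>
  is -q, normalized to zero mean, and the Euler equation itself evaluates the field against which E
  is tested.\<close>

lemma euler_pressure_inverse_laplacian:
  fixes V :: "real \<Rightarrow> real^'n \<Rightarrow> real^'n"
  assumes T: "0 < T" and eul: "euler_solution T P0 V" and t: "t \<in> {0..T}"
  defines "W \<equiv> \<lambda>y. outer (V t y) (V t y)"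
  obtains \<theta> where "is_inv_neg_laplacian (divergence (div_mat W)) \<theta>"
    "\<And>x. div_mat W x + grad \<theta> x = - dt T V t x"
proof -
  obtain q where V: "smooth_field T V" and div: "\<And>t x. t \<in> {0..T} \<Longrightarrow> divergence (V t) x = 0"
    and "V 0 = P0" and q: "\<And>t. t \<in> {0..T} \<Longrightarrow> periodic (q t)"
      "\<And>t x. t \<in> {0..T} \<Longrightarrow> q t differentiable at x"
      "\<And>t x. t \<in> {0..T} \<Longrightarrow> dt T V t x + div_mat (\<lambda>y. outer (V t y) (V t y)) x = grad (q t) x"
    by (rule euler_solutionE[OF eul]) (rule that)
  have dV: "smooth_field T (dt T V)" by (rule smooth_field_dt[OF T V])
  have dW: "smooth_field T (\<lambda>t. div_mat (\<lambda>y. outer (V t y) (V t y)))"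
    by (rule smooth_field_div_mat[OF T smooth_field_outer[OF T V V]])
  have gq: "grad (q t) x = dt T V t x + div_mat W x" for x
    using q(3)[OF t] by (simp add: W_def)
  have gsm: "smooth_on UNIV (\<lambda>x. grad (q t) x $ i)" for i
    using smooth_field_slice[OF smooth_field_nth[OF T smooth_field_add[OF T dV dW]] t]
    by (simp add: gq W_def)
  have pgrad: "partial i (q t) x = grad (q t) x $ i" for i x by (simp add: grad_def)
  have pnegq: "partial i (\<lambda>x. c - q t x) x = - grad (q t) x $ i" for i x c
    using partial_diff[OF differentiable_const[of c] q(2)[OF t]] by (simp add: pgrad)
  \<comment> \<open>The mean of q, since the cube has volume 1.\<close>
  define c where "c = (LINT x:cube|lborel. q t x)"
  define \<theta> where "\<theta> x = c - q t x" for x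
  have gth: "grad \<theta> x = - grad (q t) x" for x
    using pnegq by (simp add: vec_eq_iff grad_def \<theta>_def[abs_def])
  \<comment> \<open>Differentiability of q is upgraded to smoothness: by the Euler equation its
    gradient is a sum of smooth fields.\<close>
  have sth: "smooth_on UNIV \<theta>"
  proof (rule smooth_on_SucI[OF axis_accessible_UNIV])
    show "(\<theta> has_derivative (\<lambda>h. \<Sum>i\<in>UNIV. h $ i * partial i \<theta> x)) (at x within UNIV)" for x
      unfolding \<theta>_def[abs_def] by (intro has_derivative_partial differentiable_diff differentiable_const q(2) t)
    show "smooth_on UNIV (\<lambda>x. \<Sum>i\<in>UNIV. b $ i * partial i \<theta> x)" for b
      unfolding \<theta>_def[abs_def] pnegq
      by (intro smooth_on_sum smooth_on_mult smooth_on_const smooth_on_minus gsm axis_accessible_UNIV) auto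
  qed
  have ic: "set_integrable lborel cube f" if "continuous_on UNIV f" for f :: "real^'n \<Rightarrow> real"
    using borel_integrable_compact[of cube f] continuous_on_subset[OF that]
    by (simp add: set_integrable_def cube_eq_cbox)
  have cq: "continuous_on UNIV (q t)"
    using q(2)[OF t] by (auto simp: continuous_on_eq_continuous_at differentiable_imp_continuous_within)
  have "is_inv_neg_laplacian (divergence (div_mat W)) \<theta>"
    unfolding is_inv_neg_laplacian_def
  proof (intro conjI allI)
    show "smooth_on UNIV \<theta>" by (rule sth)
    show "periodic \<theta>" using q(1)[OF t] by (simp add: periodic_def \<theta>_def)
    have "(LINT x:cube|lborel. \<theta> x) = (LINT x:(cube::(real^'n) set)|lborel. c) - c"
      unfolding \<theta>_def by (subst set_integral_diff(2)[OF ic[OF continuous_on_const] ic[OF cq]]) (simp add: c_def)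
    also have "(LINT x:(cube::(real^'n) set)|lborel. c) = c"
    proof -
      have "measure lborel (cube::(real^'n) set) = 1"
        unfolding cube_eq_cbox using content_cbox_cart[of 0 "1::real^'n"] box_01_nonempty box_subset_cbox[of 0 "1::real^'n"]
      by auto
      moreover have "(LINT x:(cube::(real^'n) set)|lborel. c) = measure lborel (cube::(real^'n) set) *\<^sub>R c"
        unfolding cube_eq_cbox by (rule set_integral_const) (use emeasure_lborel_cbox_finite[of 0 "1::real^'n"] in auto)
      ultimately show ?thesis by simp
    qed
    finally show "(LINT x:cube|lborel. \<theta> x) = 0" by simp
    fix x
    have "- laplacian \<theta> x = (\<Sum>i\<in>UNIV. partial i (\<lambda>x. grad (q t) x $ i) x)"
    proof -
      have "partial i (partial i \<theta>) x = - partial i (\<lambda>x. grad (q t) x $ i) x" for i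
      proof -
        have "partial i \<theta> = (\<lambda>x. - (grad (q t) x $ i))" by (rule ext) (simp add: \<theta>_def[abs_def] pnegq)
        moreover have "(\<lambda>x. grad (q t) x $ i) differentiable at x"
          using smooth_on_has_derivative[OF gsm] differentiableI by fastforce
        ultimately show ?thesis by (simp add: partial_minus)
      qed
      then show ?thesis by (simp add: laplacian_def sum_negf)
    qed
    also have "\<dots> = divergence (dt T V t) x + divergence (div_mat W) x"
      using C1_periodicD(2)[OF smooth_field_C1_periodic_nth[OF T dV t]]
        C1_periodicD(2)[OF smooth_field_C1_periodic_nth[OF T dW t]]
      by (simp add: gq divergence_def partial_add sum.distrib W_def)
    also have "divergence (dt T V t) x = 0" by (rule divergence_dt[OF T V div t])
    finally show "- laplacian \<theta> x = divergence (div_mat W) x" by simp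
  qed
  moreover have "div_mat W x + grad \<theta> x = - dt T V t x" for x
    by (simp add: gth gq)
  ultimately show thesis by (rule that)
qed

lemma set_integral_sum:
  fixes f :: "'i \<Rightarrow> 'a \<Rightarrow> 'b::{banach, second_countable_topology}"
  assumes "finite I" "\<And>i. i \<in> I \<Longrightarrow> set_integrable M A (f i)"
  shows "set_integrable M A (\<lambda>x. \<Sum>i\<in>I. f i x)"
    "(LINT x:A|M. (\<Sum>i\<in>I. f i x)) = (\<Sum>i\<in>I. LINT x:A|M. f i x)"
proof -
  have i: "integrable M (\<lambda>x. indicator A x *\<^sub>R f i x)" if "i \<in> I" for i
    using assms(2)[OF that] by (simp only: set_integrable_def)
  show "set_integrable M A (\<lambda>x. \<Sum>i\<in>I. f i x)"
    unfolding set_integrable_def scaleR_sum_right by (rule Bochner_Integration.integrable_sum[OF i])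
  show "(LINT x:A|M. (\<Sum>i\<in>I. f i x)) = (\<Sum>i\<in>I. LINT x:A|M. f i x)"
    unfolding set_lebesgue_integral_def scaleR_sum_right by (rule Bochner_Integration.integral_sum[OF i])
qed

lemma time_dt_integral:
  fixes V :: "real \<Rightarrow> real^'n \<Rightarrow> real^'n"
  assumes T: "0 < T" and V: "smooth_field T V" and t: "t \<in> {0..T}"
  shows "((\<lambda>s. e \<bullet> dt T V s x) has_integral e \<bullet> (V t x - V 0 x)) {0..t}"
proof -
  have "((\<lambda>s. e \<bullet> dt T V s x) has_integral (e \<bullet> V t x - e \<bullet> V 0 x)) {0..t}"
  proof (rule fundamental_theorem_of_calculus)
    fix s assume "s \<in> {0..t}"
    then have "s \<in> {0..T}" using t by simp
    from has_vector_derivative_within_subset[OF smooth_field_has_vector_derivative[OF T V this]]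
    have "((\<lambda>s. V s x) has_vector_derivative dt T V s x) (at s within {0..t})"
      using t by simp
    then show "((\<lambda>s. e \<bullet> V s x) has_vector_derivative e \<bullet> dt T V s x) (at s within {0..t})"
      by (rule bounded_linear.has_vector_derivative[OF bounded_linear_inner_right])
  qed (use t in simp)
  then show ?thesis by (simp add: inner_diff_right)
qed

text \<open>The weak constraint only admits test fields of the form \<open>\<zeta>(t)\<psi>(x)\<close>. Bernstein
  approximation in time of \<open>V \<otimes> V\<close>, with the frozen fields \<open>V(t\<^sub>k) \<otimes> V(t\<^sub>k)\<close> as spatial test
  fields, extends it to the primitive in time of \<open>V \<otimes> V\<close>.\<close>
lemma weak_constraint_euler:
  fixes V :: "real \<Rightarrow> real^'n \<Rightarrow> real^'n"
  assumes T: "0 < T" and eul: "euler_solution T P0 V" and EB: "(E, B) \<in> EB T"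
  shows "(LINT (t, x):slab T|lborel. B t x \<bullet> outer (V t x) (V t x) + E t x \<bullet> (V t x - P0 x)) = 0"
proof -
  have V: "smooth_field T V" and V0: "V 0 = P0"
    using eul by (auto simp: euler_solution_def)
  define W where "W t x = outer (V t x) (V t x)" for t x
  define \<tau> where "\<tau> n k = T * (real k / real n)" for n k :: nat
  let ?b = "\<lambda>n k t. Bernstein n k (t / T)" and ?\<zeta> = "\<lambda>n k t. bernstein_primitive T n k t"
  \<comment> \<open>The sum over the nodes of the constraint integrands, each with a primitive in
    time and a frozen spatial field. Its integral is zero for every n, and it converges pointwise to
    \<open>H\<close>.\<close>
  define G where "G n p = (case p of (t, x) \<Rightarrow>
     (\<Sum>k\<le>n. ?b n k t * (B t x \<bullet> W (\<tau> n k) x) + ?\<zeta> n k t * (E t x \<bullet> dt T V (\<tau> n k) x)))" for n p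
  define H where "H = (\<lambda>(t, x). B t x \<bullet> W t x + E t x \<bullet> (V t x - P0 x))"
  have fW: "smooth_field T W"
    unfolding W_def[abs_def] by (rule smooth_field_outer[OF T V V])
  have dV: "smooth_field T (dt T V)" by (rule smooth_field_dt[OF T V])
  have tau: "\<tau> n k \<in> {0..T}" if "k \<le> n" for n k
  proof -
    \<comment> \<open>For n = 0 division by zero puts the only node at time 0, which still lies in
      the interval, so this degenerate index does no harm.\<close>
    have "real k / real n \<le> 1" using that by (cases "n = 0") (auto simp: divide_le_eq_1)
    then show ?thesis using T mult_left_mono[of "real k / real n" 1 T] by (simp add: \<tau>_def)
  qed
  obtain CW where CW: "0 < CW" "\<And>t x. t \<in> {0..T} \<Longrightarrow> norm (W t x) \<le> CW"
    by (rule continuous_field_bounded[OF smooth_field_imp_continuous[OF fW]]) (rule that)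
  obtain CV where CV: "0 < CV" "\<And>t x. t \<in> {0..T} \<Longrightarrow> norm (dt T V t x) \<le> CV"
    by (rule continuous_field_bounded[OF smooth_field_imp_continuous[OF dV]]) (rule that)
  have fst: "continuous_on (slab T) fst" "fst ` slab T \<subseteq> {0..T}"
    by (auto simp: slab_def intro!: continuous_on_fst continuous_on_id)
  have zcont: "continuous_on {0..T} (?\<zeta> n k)" for n k
    by (rule smooth_on_imp_continuous[OF smooth_on_bernstein_primitive[OF T]])
  have slice: "continuous_on (slab T) (\<lambda>(t, x). u s x)" if "smooth_field T u" "s \<in> {0..T}"
    for s and u :: "real \<Rightarrow> real^'n \<Rightarrow> 'c::euclidean_space"
    using continuous_fieldD(1)[OF smooth_field_imp_continuous[OF smooth_field_static[OF T smooth_field_slice[OF that] smooth_fieldD(2)[OF that]]]] .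
  have term_int: "set_integrable lborel (slab T) (\<lambda>(t, x). ?b n k t * (B t x \<bullet> W (\<tau> n k) x) + ?\<zeta> n k t * (E t x \<bullet> dt T V (\<tau> n k) x))"
    if "k \<le> n" for n k
  proof -
    have "continuous_on (slab T) (\<lambda>(t, x). ?b n k t *\<^sub>R W (\<tau> n k) x)"
      using continuous_on_scaleR[OF continuous_on_compose2[OF continuous_on_Bernstein fst] slice[OF fW tau[OF that]]]
      by (simp add: case_prod_unfold)
    moreover have "continuous_on (slab T) (\<lambda>(t, x). ?\<zeta> n k t *\<^sub>R dt T V (\<tau> n k) x)"
      using continuous_on_scaleR[OF continuous_on_compose2[OF zcont fst] slice[OF dV tau[OF that]]]
      by (simp add: case_prod_unfold)
    ultimately show ?thesis
      using set_integral_add(1)[OF EB_set_integrable(2)[OF EB, of "\<lambda>t x. ?b n k t *\<^sub>R W (\<tau> n k) x"]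
        EB_set_integrable(1)[OF EB, of "\<lambda>t x. ?\<zeta> n k t *\<^sub>R dt T V (\<tau> n k) x"]]
      by (simp add: case_prod_unfold)
  qed
  \<comment> \<open>One instance of the weak constraint. The field tested against E is the negative
    time derivative of V at the node, which turns the minus sign of the constraint into a
    plus.\<close>
  have term_0: "(LINT (t, x):slab T|lborel. ?b n k t * (B t x \<bullet> W (\<tau> n k) x) + ?\<zeta> n k t * (E t x \<bullet> dt T V (\<tau> n k) x)) = 0"
    if k: "k \<le> n" for n k
  proof -
    have Wk: "W (\<tau> n k) = (\<lambda>y. outer (V (\<tau> n k) y) (V (\<tau> n k) y))" by (simp add: W_def fun_eq_iff)
    obtain \<theta> where th: "is_inv_neg_laplacian (divergence (div_mat (W (\<tau> n k)))) \<theta>"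
        "\<And>x. div_mat (W (\<tau> n k)) x + grad \<theta> x = - dt T V (\<tau> n k) x"
      by (rule euler_pressure_inverse_laplacian[OF T eul tau[OF k], folded Wk]) (rule that)
    have "(LINT (t, x):slab T|lborel. vector_derivative (?\<zeta> n k) (at t within {0..T}) * (B t x \<bullet> W (\<tau> n k) x)
           - ?\<zeta> n k t * (E t x \<bullet> (div_mat (W (\<tau> n k)) x + grad \<theta> x))) = 0"
    proof (rule EB_D(4)[OF EB, unfolded weak_constraint_def, rule_format], intro conjI allI)
      show "smooth_on {0..T} (?\<zeta> n k)" by (rule smooth_on_bernstein_primitive[OF T])
      show "?\<zeta> n k 0 = 0" by (simp add: bernstein_primitive_def)
      show "smooth_on UNIV (W (\<tau> n k))" by (rule smooth_field_slice[OF fW tau[OF k]])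
      show "periodic (W (\<tau> n k))" by (rule smooth_fieldD(2)[OF fW tau[OF k]])
      show "symmetric_matrix (W (\<tau> n k) x)" for x by (simp add: W_def symmetric_outer)
    qed (rule th(1))
    moreover have "vector_derivative (?\<zeta> n k) (at t within {0..T}) = ?b n k t" if "t \<in> {0..T}" for t
      using vector_derivative_within_cbox[of 0 T t "?\<zeta> n k"] bernstein_primitive_has_vector_derivative[OF that] that T by simp
    moreover have "(LINT (t, x):slab T|lborel. ?b n k t * (B t x \<bullet> W (\<tau> n k) x) + ?\<zeta> n k t * (E t x \<bullet> dt T V (\<tau> n k) x)) =
      (LINT (t, x):slab T|lborel. vector_derivative (?\<zeta> n k) (at t within {0..T}) * (B t x \<bullet> W (\<tau> n k) x)
           - ?\<zeta> n k t * (E t x \<bullet> (div_mat (W (\<tau> n k)) x + grad \<theta> x)))"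
      using calculation(2) by (intro set_lebesgue_integral_cong) (auto simp: th(2) slab_def slab_sets[unfolded slab_def])
    ultimately show ?thesis by simp
  qed
  have G0: "(LINT p:slab T|lborel. G n p) = 0" for n
  proof -
    have "(LINT p:slab T|lborel. G n p) = (\<Sum>k\<in>{..n}. LINT (t, x):slab T|lborel. ?b n k t * (B t x \<bullet> W (\<tau> n k) x) + ?\<zeta> n k t * (E t x \<bullet> dt T V (\<tau> n k) x))"
      using set_integral_sum(2)[of "{..n}" lborel "slab T", OF _ term_int] by (simp add: G_def case_prod_unfold)
    then show ?thesis using term_0 by simp
  qed
  have Gi: "set_integrable lborel (slab T) (G n)" for n
  proof -
    have "set_integrable lborel (slab T) (\<lambda>p. \<Sum>k\<le>n. case p of (t, x) \<Rightarrow>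
        ?b n k t * (B t x \<bullet> W (\<tau> n k) x) + ?\<zeta> n k t * (E t x \<bullet> dt T V (\<tau> n k) x))"
      by (rule set_integral_sum(1)) (use term_int in auto)
    then show ?thesis by (simp add: G_def[abs_def] case_prod_unfold)
  qed
  have Hi: "set_integrable lborel (slab T) H"
  proof -
    have "continuous_on (slab T) (\<lambda>(t, x). V t x - P0 x)"
      using continuous_on_diff[OF continuous_fieldD(1)[OF smooth_field_imp_continuous[OF V]] slice[OF V, of 0]] T V0
      by (simp add: case_prod_unfold)
    from set_integral_add(1)[OF EB_set_integrable(2)[OF EB continuous_fieldD(1)[OF smooth_field_imp_continuous[OF fW]]]
      EB_set_integrable(1)[OF EB this]]
    show ?thesis by (simp add: H_def case_prod_unfold)
  qed
  \<comment> \<open>The Bernstein weights sum to 1 and their primitives to t, which is at most T; so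
    this function dominates every \<open>G n\<close>. It is integrable because B and E are
    integrable in norm.\<close>
  define w where "w = (\<lambda>(t, x). CW * norm (B t x) + (T * CV) * norm (E t x))"
  have wi: "set_integrable lborel (slab T) w"
    using set_integral_add(1)[OF set_integrable_mult_right[of CW, OF Linf_field_integrable_norm(2)[OF EB_D(2)[OF EB]]]
      set_integrable_mult_right[of "T * CV", OF L2_field_integrable_norm(2)[OF EB_D(1)[OF EB]]]]
    by (simp add: w_def case_prod_unfold)
  have lim: "(\<lambda>n. G n p) \<longlonglongrightarrow> H p" if ps: "p \<in> slab T" for p
  proof -
    obtain t x where p: "p = (t, x)" and t: "t \<in> {0..T}" using ps by (cases p) (auto simp: slab_def)
    have time: "continuous_on {0..1} (\<lambda>s. c \<bullet> u (T * s) x)" if "smooth_field T u"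
      for u :: "real \<Rightarrow> real^'n \<Rightarrow> 'c::euclidean_space" and c
    proof -
      have "continuous_on {0..1} (\<lambda>s. (T * s, x))" by (intro continuous_intros)
      moreover have "(\<lambda>s. (T * s, x)) ` {0..1} \<subseteq> {0..T} \<times> UNIV"
        using T by (auto simp: mult_left_le)
      ultimately have "continuous_on {0..1} (\<lambda>s. u (T * s) x)"
        using continuous_on_compose2[OF continuous_fieldD(3)[OF smooth_field_imp_continuous[OF that]], of "{0..1}" "\<lambda>s. (T * s, x)"] by simp
      then show ?thesis by (intro continuous_intros)
    qed
    have s: "t / T \<in> {0..1}" using t T by simp
    have "(\<lambda>n. \<Sum>k\<le>n. ?b n k t * (B t x \<bullet> W (\<tau> n k) x)) \<longlonglongrightarrow> B t x \<bullet> W t x"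
      using bernstein_tendsto[OF time[OF fW, of "B t x"] s] T by (simp add: \<tau>_def)
    \<comment> \<open>The primitives integrate the time derivative of V from 0 to t, and this is
      where the initial value P0 enters.\<close>
    moreover have "(\<lambda>n. \<Sum>k\<le>n. ?\<zeta> n k t * (E t x \<bullet> dt T V (\<tau> n k) x)) \<longlonglongrightarrow> E t x \<bullet> (V t x - P0 x)"
      using bernstein_primitive_tendsto[OF T time[OF dV, of "E t x"] t] T
        integral_unique[OF time_dt_integral[OF T V t, of "E t x" x]] V0 by (simp add: \<tau>_def)
    ultimately show ?thesis
      using tendsto_add by (fastforce simp: G_def H_def p sum.distrib)
  qed
  have bound: "\<bar>G n p\<bar> \<le> w p" if ps: "p \<in> slab T" for n p
  proof -
    obtain t x where p: "p = (t, x)" and t: "t \<in> {0..T}" using ps by (cases p) (auto simp: slab_def)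
    have b: "0 \<le> ?b n k t" for k using t T by (intro Bernstein_nonneg) auto
    have z: "0 \<le> ?\<zeta> n k t" for k by (rule bernstein_primitive_nonneg[OF T t])
    have "\<bar>G n p\<bar> \<le> (\<Sum>k\<le>n. \<bar>?b n k t * (B t x \<bullet> W (\<tau> n k) x) + ?\<zeta> n k t * (E t x \<bullet> dt T V (\<tau> n k) x)\<bar>)"
      unfolding G_def p by (simp add: sum_abs)
    also have "\<dots> \<le> (\<Sum>k\<le>n. ?b n k t * (norm (B t x) * CW) + ?\<zeta> n k t * (norm (E t x) * CV))"
    proof (rule sum_mono)
      fix k assume k: "k \<in> {..n}"
      have "\<bar>B t x \<bullet> W (\<tau> n k) x\<bar> \<le> norm (B t x) * CW"
        by (rule order_trans[OF Cauchy_Schwarz_ineq2 mult_left_mono[OF CW(2)[OF tau] norm_ge_zero]]) (use k in simp)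
      moreover have "\<bar>E t x \<bullet> dt T V (\<tau> n k) x\<bar> \<le> norm (E t x) * CV"
        by (rule order_trans[OF Cauchy_Schwarz_ineq2 mult_left_mono[OF CV(2)[OF tau] norm_ge_zero]]) (use k in simp)
      ultimately show "\<bar>?b n k t * (B t x \<bullet> W (\<tau> n k) x) + ?\<zeta> n k t * (E t x \<bullet> dt T V (\<tau> n k) x)\<bar>
         \<le> ?b n k t * (norm (B t x) * CW) + ?\<zeta> n k t * (norm (E t x) * CV)"
        using b[of k] z[of k] by (intro order_trans[OF abs_triangle_ineq] add_mono) (auto simp: abs_mult intro: mult_left_mono)
    qed
    also have "\<dots> = norm (B t x) * CW + t * (norm (E t x) * CV)"
      using sum_bernstein_primitive[of t T n] t by (simp add: sum.distrib sum_distrib_right[symmetric])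
    also have "\<dots> \<le> w p"
      using mult_right_mono[of t T "norm (E t x) * CV"] CV(1) t by (simp add: w_def p ac_simps)
    finally show ?thesis .
  qed
  have "(\<lambda>n. LINT p:slab T|lborel. G n p) \<longlonglongrightarrow> (LINT p:slab T|lborel. H p)"
    unfolding set_lebesgue_integral_def
  proof (rule integral_dominated_convergence[where w = "\<lambda>p. indicator (slab T) p *\<^sub>R w p"])
    show "(\<lambda>p. indicator (slab T) p *\<^sub>R H p) \<in> borel_measurable lborel"
      using Hi borel_measurable_integrable unfolding set_integrable_def by blast
    show "(\<lambda>p. indicator (slab T) p *\<^sub>R G n p) \<in> borel_measurable lborel" for n
      using Gi borel_measurable_integrable unfolding set_integrable_def by blast
    show "integrable lborel (\<lambda>p. indicator (slab T) p *\<^sub>R w p)"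
      using wi by (simp add: set_integrable_def)
    show "AE p in lborel. (\<lambda>n. indicator (slab T) p *\<^sub>R G n p) \<longlonglongrightarrow> indicator (slab T) p *\<^sub>R H p"
      using lim by (intro AE_I2) (auto simp: indicator_def)
    show "AE p in lborel. norm (indicator (slab T) p *\<^sub>R G n p) \<le> indicator (slab T) p *\<^sub>R w p" for n
      using bound by (intro AE_I2) (auto simp: indicator_def)
  qed
  then have "(LINT p:slab T|lborel. H p) = 0"
    unfolding G0 by (simp add: LIMSEQ_const_iff)
  then show ?thesis by (simp add: H_def W_def)
qed

section \<open>Duality\<close>

lemma L2_field_continuous:
  assumes "continuous_on (slab T) (\<lambda>(t, x). u t x)" "\<And>t. t \<in> {0..T} \<Longrightarrow> periodic (u t)"
  shows "L2_field T u"
  unfolding L2_field_def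
proof (intro conjI ballI)
  show "set_borel_measurable lborel (slab T) (\<lambda>(t, x). u t x)"
    using borel_measurable_integrable[OF borel_integrable_compact[OF compact_slab assms(1)]]
    by (simp only: set_borel_measurable_def)
  have "continuous_on (slab T) (\<lambda>p. (norm (case p of (t, x) \<Rightarrow> u t x))\<^sup>2)"
    by (intro continuous_intros assms(1))
  from set_integrable_slab[OF this]
  show "set_integrable lborel (slab T) (\<lambda>(t, x). (norm (u t x))\<^sup>2)"
    by (simp add: case_prod_unfold)
qed (use assms(2) in auto)

lemma Linf_field_continuous:
  assumes "continuous_field T u"
  shows "Linf_field T u"
  unfolding Linf_field_def
proof (intro conjI ballI)
  show "set_borel_measurable lborel (slab T) (\<lambda>(t, x). u t x)"
    using borel_measurable_integrable[OF borel_integrable_compact[OF compact_slab continuous_fieldD(1)[OF assms]]]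
    by (simp only: set_borel_measurable_def)
  obtain C where "0 < C" "\<And>t x. t \<in> {0..T} \<Longrightarrow> norm (u t x) \<le> C"
    by (rule continuous_field_bounded[OF assms]) (rule that)
  then have "AE (t, x) in lborel. (t, x) \<in> slab T \<longrightarrow> norm (u t x) \<le> C"
    by (intro AE_I2) (auto simp: slab_def)
  then show "\<exists>C. AE (t, x) in lborel. (t, x) \<in> slab T \<longrightarrow> norm (u t x) \<le> C" ..
qed (use assms in \<open>auto simp: continuous_field_def\<close>)

lemma outer_minus_minus: "outer (- v) (- w) = outer v w"
  by (simp add: outer_def)

lemma mat_1_inner_outer: "mat 1 \<bullet> outer v v = v \<bullet> v"
  by (simp add: inner_outer)

lemma inner_mat_mult: "v \<bullet> (mat c *v v) = c * (v \<bullet> v)" for v :: "real^'n"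
  by (simp add: inner_vec_def matrix_vector_mult_def mat_def if_distrib if_distribR sum.delta sum_distrib_left ac_simps cong: if_cong)

text \<open>Covers the value \<infinity> of K, for which the objective is -\<infinity>.\<close>

lemma ereal_uminus_diff_le: "ereal k \<le> x \<Longrightarrow> - x - ereal b \<le> ereal (- k - b)"
  by (cases x) auto

lemma ereal_uminus_diff_ge: "x \<le> ereal k \<Longrightarrow> ereal (- k - b) \<le> - x - ereal b"
  by (cases x) auto

text \<open>Writing a, b, d, e for the integrals of E . V, B . (V \<otimes> V), E . P0 and |V|^2,
  the test pair gives K \<ge> -a - e/2 - b, so the objective is at most a + b - d + e/2. The weak
  constraint along the flow says a + b - d = 0, which leaves e/2 whatever E and B are.\<close>

lemma objective_le:
  fixes V :: "real \<Rightarrow> real^'n \<Rightarrow> real^'n"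
  assumes T: "0 < T" and eul: "euler_solution T P0 V" and EB: "(E, B) \<in> EB T"
  shows "objective T P0 (E, B) \<le> ereal (1/2 * (LINT (t, x):slab T|lborel. V t x \<bullet> V t x))"
proof -
  have V: "smooth_field T V" and V0: "V 0 = P0" using eul by (auto simp: euler_solution_def)
  let ?W = "\<lambda>t x. outer (V t x) (V t x)"
  have W: "smooth_field T ?W" by (rule smooth_field_outer[OF T V V])
  have P0: "smooth_field T (\<lambda>t. P0)"
    using smooth_field_static[OF T smooth_field_slice[OF V, of 0] smooth_fieldD(2)[OF V, of 0]] T V0 by simp
  note c = continuous_fieldD(1)[OF smooth_field_imp_continuous]
  have iV: "set_integrable lborel (slab T) (\<lambda>p. E (fst p) (snd p) \<bullet> V (fst p) (snd p))"
    using EB_set_integrable(1)[OF EB c[OF V]] by (simp add: case_prod_unfold)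
  have iW: "set_integrable lborel (slab T) (\<lambda>p. B (fst p) (snd p) \<bullet> ?W (fst p) (snd p))"
    using EB_set_integrable(2)[OF EB c[OF W]] by (simp add: case_prod_unfold)
  have iP: "set_integrable lborel (slab T) (\<lambda>p. E (fst p) (snd p) \<bullet> P0 (snd p))"
    using EB_set_integrable(1)[OF EB c[OF P0]] by (simp add: case_prod_unfold)
  have i2: "set_integrable lborel (slab T) (\<lambda>p. V (fst p) (snd p) \<bullet> V (fst p) (snd p))"
    using set_integrable_slab[OF c[OF smooth_field_inner[OF T V V]]] by (simp add: case_prod_unfold)
  define a where "a = (LINT p:slab T|lborel. E (fst p) (snd p) \<bullet> V (fst p) (snd p))"
  define b where "b = (LINT p:slab T|lborel. B (fst p) (snd p) \<bullet> ?W (fst p) (snd p))"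
  define d where "d = (LINT p:slab T|lborel. E (fst p) (snd p) \<bullet> P0 (snd p))"
  define e where "e = (LINT p:slab T|lborel. V (fst p) (snd p) \<bullet> V (fst p) (snd p))"
  have weak: "b + (a - d) = 0"
    using weak_constraint_euler[OF T eul EB]
    by (simp add: case_prod_unfold inner_diff_right set_integral_add(2)[OF iW set_integral_diff(1)[OF iV iP]]
        set_integral_diff(2)[OF iV iP] a_def b_def d_def)
  \<comment> \<open>Formally the supremum in K is reached at the inverse of I + 2B applied to E,
    which is -V for the expected maximizer; the sign cancels in the outer product.\<close>
  let ?Z = "\<lambda>t x. - V t x"
  have "(?Z, ?W) \<in> admissible_ZM T"
    using smooth_field_imp_continuous[OF smooth_field_minus[OF T V]] smooth_field_imp_continuous[OF W]
    by (simp add: admissible_ZM_def symmetric_outer loewner_le_def outer_minus_minus)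
  then have "ereal (1/2 * (LINT (t, x):slab T|lborel. 2 * (E t x \<bullet> ?Z t x) - (mat 1 + 2 *\<^sub>R B t x) \<bullet> ?W t x)) \<le> K T E B"
    unfolding K_def by (intro SUP_upper2[of "(?Z, ?W)"]) auto
  moreover have "(LINT (t, x):slab T|lborel. 2 * (E t x \<bullet> ?Z t x) - (mat 1 + 2 *\<^sub>R B t x) \<bullet> ?W t x) = - 2 * a - (e + 2 * b)"
  proof -
    have "(LINT (t, x):slab T|lborel. 2 * (E t x \<bullet> ?Z t x) - (mat 1 + 2 *\<^sub>R B t x) \<bullet> ?W t x) =
      (LINT p:slab T|lborel. (-2) * (E (fst p) (snd p) \<bullet> V (fst p) (snd p)) -
         (V (fst p) (snd p) \<bullet> V (fst p) (snd p) + 2 * (B (fst p) (snd p) \<bullet> ?W (fst p) (snd p))))"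
      by (simp add: case_prod_unfold inner_add_left mat_1_inner_outer)
    also have "\<dots> = (LINT p:slab T|lborel. (-2) * (E (fst p) (snd p) \<bullet> V (fst p) (snd p))) -
       (LINT p:slab T|lborel. V (fst p) (snd p) \<bullet> V (fst p) (snd p) + 2 * (B (fst p) (snd p) \<bullet> ?W (fst p) (snd p)))"
      by (rule set_integral_diff(2)) (intro set_integral_add(1) set_integrable_mult_right iV iW i2)+
    also have "(LINT p:slab T|lborel. V (fst p) (snd p) \<bullet> V (fst p) (snd p) + 2 * (B (fst p) (snd p) \<bullet> ?W (fst p) (snd p))) =
       e + (LINT p:slab T|lborel. 2 * (B (fst p) (snd p) \<bullet> ?W (fst p) (snd p)))"
      unfolding e_def by (rule set_integral_add(2)) (intro set_integrable_mult_right iW i2)+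
    finally show ?thesis by (simp only: set_integral_mult_right a_def b_def)
  qed
  ultimately have "ereal (1/2 * (- 2 * a - (e + 2 * b))) \<le> K T E B" by simp
  from ereal_uminus_diff_le[OF this, of d]
  have "objective T P0 (E, B) \<le> ereal (- (1/2 * (- 2 * a - (e + 2 * b))) - d)"
    by (simp add: objective_def d_def case_prod_unfold inner_commute)
  also have "- (1/2 * (- 2 * a - (e + 2 * b))) - d = 1/2 * e"
  proof -
    have "d = a + b" using weak by simp
    then show ?thesis by (simp add: field_simps)
  qed
  finally show ?thesis by (simp add: e_def case_prod_unfold)
qed

text \<open>Let e and f be the integrals of |V|^2 and V . BV, and d that of E . P0. Completing the
  square bounds K by e/2 + f. As E . V = -|V|^2 - 2 V . BV, the weak constraint along the flow for
  this very pair gives d = -e - f, and the objective is at least -(e/2 + f) + e + f = e/2.\<close>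

lemma objective_ge:
  fixes V E :: "real \<Rightarrow> real^'n \<Rightarrow> real^'n" and B :: "real \<Rightarrow> real^'n \<Rightarrow> real^'n^'n"
  assumes T: "0 < T" and eul: "euler_solution T P0 V" and B: "smooth_field T B"
    and small: "\<And>t x i j. t \<in> {0..T} \<Longrightarrow> \<bar>B t x $ i $ j\<bar> \<le> 1 / (4 * real CARD('n))"
    and E: "\<And>t x. t \<in> {0..T} \<Longrightarrow> E t x = - ((mat 1 + 2 *\<^sub>R B t x) *v V t x)"
    and EB: "(E, B) \<in> EB T"
  shows "ereal (1/2 * (LINT (t, x):slab T|lborel. V t x \<bullet> V t x)) \<le> objective T P0 (E, B)"
proof -
  have V: "smooth_field T V" and V0: "V 0 = P0" using eul by (auto simp: euler_solution_def)
  let ?W = "\<lambda>t x. outer (V t x) (V t x)" and ?G = "\<lambda>t x. mat 1 + 2 *\<^sub>R B t x"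
  have W: "smooth_field T ?W" by (rule smooth_field_outer[OF T V V])
  have P0: "smooth_field T (\<lambda>t. P0)"
    using smooth_field_static[OF T smooth_field_slice[OF V, of 0] smooth_fieldD(2)[OF V, of 0]] T V0 by simp
  have BV: "smooth_field T (\<lambda>t x. V t x \<bullet> (B t x *v V t x))"
    by (intro smooth_field_inner smooth_field_matrix_vector_mult T V B)
  have VGV: "smooth_field T (\<lambda>t x. V t x \<bullet> (?G t x *v V t x))"
    by (intro smooth_field_inner smooth_field_matrix_vector_mult smooth_field_add smooth_field_scaleR smooth_field_const T V B)
  note c = continuous_fieldD(1)[OF smooth_field_imp_continuous]
  define e where "e = (LINT p:slab T|lborel. V (fst p) (snd p) \<bullet> V (fst p) (snd p))"
  define f where "f = (LINT p:slab T|lborel. V (fst p) (snd p) \<bullet> (B (fst p) (snd p) *v V (fst p) (snd p)))"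
  define d where "d = (LINT p:slab T|lborel. E (fst p) (snd p) \<bullet> P0 (snd p))"
  have i2: "set_integrable lborel (slab T) (\<lambda>p. V (fst p) (snd p) \<bullet> V (fst p) (snd p))"
    using set_integrable_slab[OF c[OF smooth_field_inner[OF T V V]]] by (simp add: case_prod_unfold)
  have iB: "set_integrable lborel (slab T) (\<lambda>p. V (fst p) (snd p) \<bullet> (B (fst p) (snd p) *v V (fst p) (snd p)))"
    using set_integrable_slab[OF c[OF BV]] by (simp add: case_prod_unfold)
  have iP: "set_integrable lborel (slab T) (\<lambda>p. E (fst p) (snd p) \<bullet> P0 (snd p))"
    using EB_set_integrable(1)[OF EB c[OF P0]] by (simp add: case_prod_unfold)
  have GV: "V t x \<bullet> (?G t x *v V t x) = V t x \<bullet> V t x + 2 * (V t x \<bullet> (B t x *v V t x))" for t x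
    by (simp add: matrix_vector_mult_add_rdistrib inner_add_right scaleR_matrix_vector_assoc[symmetric])
  have d: "- e - f - d = 0"
  proof -
    let ?f = "\<lambda>p. V (fst p) (snd p) \<bullet> V (fst p) (snd p) +
        V (fst p) (snd p) \<bullet> (B (fst p) (snd p) *v V (fst p) (snd p)) + E (fst p) (snd p) \<bullet> P0 (snd p)"
    have "0 = (LINT p:slab T|lborel. - ?f p)"
      unfolding weak_constraint_euler[OF T eul EB, symmetric]
    proof (rule set_lebesgue_integral_cong)
      show "\<forall>p. p \<in> slab T \<longrightarrow> (case p of (t, x) \<Rightarrow> B t x \<bullet> ?W t x + E t x \<bullet> (V t x - P0 x)) = - ?f p"
      proof (intro allI impI)
        fix p :: "real \<times> (real^'n)" assume "p \<in> slab T"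
        then obtain t x where p: "p = (t, x)" "t \<in> {0..T}" by (cases p) (auto simp: slab_def)
        have "E t x \<bullet> V t x = - (V t x \<bullet> V t x) - 2 * (V t x \<bullet> (B t x *v V t x))"
          using GV[of t x] E[OF p(2), of x] by (simp add: inner_commute)
        then show "(case p of (t, x) \<Rightarrow> B t x \<bullet> ?W t x + E t x \<bullet> (V t x - P0 x)) = - ?f p"
          by (simp add: p inner_outer inner_diff_right)
      qed
    qed (simp add: slab_sets)
    also have "\<dots> = - (LINT p:slab T|lborel. ?f p)"
      by (rule set_integral_uminus) (intro set_integral_add(1) i2 iB iP)
    also have "(LINT p:slab T|lborel. ?f p) = e + f + d"
      unfolding e_def f_def d_def
      by (simp only: set_integral_add(2)[OF set_integral_add(1)[OF i2 iB] iP] set_integral_add(2)[OF i2 iB])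
    finally show ?thesis by simp
  qed
  have "K T E B \<le> ereal (1/2 * (e + 2 * f))"
    unfolding K_def
  proof (rule SUP_least)
    fix ZM :: "(real \<Rightarrow> real^'n \<Rightarrow> real^'n) \<times> (real \<Rightarrow> real^'n \<Rightarrow> real^'n^'n)"
    assume "ZM \<in> admissible_ZM T"
    then obtain Z M where ZM: "ZM = (Z, M)" "(Z, M) \<in> admissible_ZM T" by (cases ZM) auto
    then have cZ: "continuous_field T Z" and cM: "continuous_field T M"
      and ad: "\<And>t x. t \<in> {0..T} \<Longrightarrow> symmetric_matrix (M t x)"
        "\<And>t x. t \<in> {0..T} \<Longrightarrow> loewner_le (outer (Z t x) (Z t x)) (M t x)"
      by (auto simp: admissible_ZM_def)
    have iM: "set_integrable lborel (slab T) (\<lambda>p. 2 * (E (fst p) (snd p) \<bullet> Z (fst p) (snd p)) - ?G (fst p) (snd p) \<bullet> M (fst p) (snd p))"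
    proof (rule set_integral_diff(1))
      show "set_integrable lborel (slab T) (\<lambda>p. 2 * (E (fst p) (snd p) \<bullet> Z (fst p) (snd p)))"
        using EB_set_integrable(1)[OF EB continuous_fieldD(1)[OF cZ]] by (simp add: case_prod_unfold)
      have "smooth_field T ?G" by (intro smooth_field_add smooth_field_scaleR smooth_field_const T B)
      from set_integrable_slab[OF continuous_on_inner[OF c[OF this] continuous_fieldD(1)[OF cM]]]
      show "set_integrable lborel (slab T) (\<lambda>p. ?G (fst p) (snd p) \<bullet> M (fst p) (snd p))"
        by (simp add: case_prod_unfold)
    qed
    have "(LINT p:slab T|lborel. 2 * (E (fst p) (snd p) \<bullet> Z (fst p) (snd p)) - ?G (fst p) (snd p) \<bullet> M (fst p) (snd p))
       \<le> (LINT p:slab T|lborel. V (fst p) (snd p) \<bullet> V (fst p) (snd p) + 2 * (V (fst p) (snd p) \<bullet> (B (fst p) (snd p) *v V (fst p) (snd p))))"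
    proof (rule set_integral_mono[OF iM])
      \<comment> \<open>The bound for the integrand is pointwise in (t, x) and does not involve Z or
        M, so it survives the supremum.\<close>
      show "set_integrable lborel (slab T) (\<lambda>p. V (fst p) (snd p) \<bullet> V (fst p) (snd p) + 2 * (V (fst p) (snd p) \<bullet> (B (fst p) (snd p) *v V (fst p) (snd p))))"
        by (intro set_integral_add(1) set_integrable_mult_right i2 iB)
      fix p :: "real \<times> (real^'n)" assume "p \<in> slab T"
      then obtain t x where p: "p = (t, x)" "t \<in> {0..T}" by (cases p) (auto simp: slab_def)
      show "2 * (E (fst p) (snd p) \<bullet> Z (fst p) (snd p)) - ?G (fst p) (snd p) \<bullet> M (fst p) (snd p)
        \<le> V (fst p) (snd p) \<bullet> V (fst p) (snd p) + 2 * (V (fst p) (snd p) \<bullet> (B (fst p) (snd p) *v V (fst p) (snd p)))"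
        using legendre_bound[OF small[OF p(2), of x] EB_D(3)[OF EB p(2), of x] ad(1)[OF p(2), of x] ad(2)[OF p(2), of x], of "V t x"]
        unfolding GV by (simp add: p(1) E[OF p(2)])
    qed
    also have "\<dots> = e + 2 * f"
      unfolding e_def f_def set_integral_mult_right[symmetric]
      by (rule set_integral_add(2)) (intro set_integrable_mult_right i2 iB)+
    finally show "(case ZM of (Z, M) \<Rightarrow> ereal (1/2 * (LINT (t, x):slab T|lborel. 2 * (E t x \<bullet> Z t x) - ?G t x \<bullet> M t x))) \<le> ereal (1/2 * (e + 2 * f))"
      by (simp add: ZM(1) case_prod_unfold)
  qed
  from ereal_uminus_diff_ge[OF this, of d]
  have "ereal (- (1/2 * (e + 2 * f)) - d) \<le> objective T P0 (E, B)"
    by (simp add: objective_def d_def case_prod_unfold inner_commute)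
  moreover have "- (1/2 * (e + 2 * f)) - d = 1/2 * e"
  proof -
    have "d = - e - f" using d by simp
    then show ?thesis by (simp add: field_simps)
  qed
  ultimately have "ereal (1/2 * e) \<le> objective T P0 (E, B)" by (simp only:)
  then show ?thesis by (simp add: e_def case_prod_unfold)
qed

section \<open>The final-value solution as a maximizer\<close>

lemma final_value_solution_E_eq:
  assumes "final_value_solution T V A \<phi>" "t \<in> {0..T}"
  shows "dt T A t x + grad (\<phi> t) x = - ((mat 1 + 2 *\<^sub>R sym_grad (A t) x) *v V t x)"
  using final_value_solutionD(4)[OF assms(1,2), of x] by (simp add: eq_neg_iff_add_eq_0 ac_simps)

text \<open>The given form of E contains grad \<phi>, for which no continuity is assumed. On the
  time interval the equation identifies E with -(I + 2B)V, which is smooth, and the regularity of E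
  and of \<phi> in space is taken from there.\<close>

lemma final_value_solution_in_EB:
  fixes V :: "real \<Rightarrow> real^'n \<Rightarrow> real^'n"
  assumes T: "0 < T" and V: "smooth_field T V" and fv: "final_value_solution T V A \<phi>"
  shows "(\<lambda>t x. dt T A t x + grad (\<phi> t) x, \<lambda>t x. sym_grad (A t) x) \<in> EB T"
proof -
  note F = final_value_solutionD[OF fv]
  let ?E = "\<lambda>t x. dt T A t x + grad (\<phi> t) x"
  let ?E' = "\<lambda>t x. - ((mat 1 + 2 *\<^sub>R sym_grad (A t) x) *v V t x)"
  have E: "?E t x = ?E' t x" if "t \<in> {0..T}" for t x by (rule final_value_solution_E_eq[OF fv that])
  have sA: "smooth_field T (\<lambda>t. sym_grad (A t))" by (rule smooth_field_sym_grad[OF T F(1)])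
  have sE: "smooth_field T ?E'"
    by (intro smooth_field_minus smooth_field_matrix_vector_mult smooth_field_add smooth_field_scaleR smooth_field_const T V sA)
  have dA: "smooth_field T (dt T A)" by (rule smooth_field_dt[OF T F(1)])
  have gphi: "grad (\<phi> t) x = ?E' t x - dt T A t x" if "t \<in> {0..T}" for t x
    using E[OF that, of x] by (simp add: algebra_simps)
  have cE: "continuous_on (slab T) (\<lambda>(t, x). ?E t x)"
    by (rule continuous_on_cong[THEN iffD1, OF refl _ continuous_fieldD(1)[OF smooth_field_imp_continuous[OF sE]]])
      (use E in \<open>auto simp: slab_def\<close>)
  have "C1_periodic (\<phi> t)" if t: "t \<in> {0..T}" for t
    unfolding C1_periodic_def
  proof (intro conjI allI)
    have "continuous_on UNIV (\<lambda>x. (?E' t x - dt T A t x) $ i)" for i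
      by (rule C1_periodicD(3)[OF smooth_field_C1_periodic_nth[OF T smooth_field_diff[OF T sE dA] t]])
    then show "continuous_on UNIV (partial i (\<phi> t))" for i
      unfolding gphi[OF t, symmetric] by (simp add: grad_def)
  qed (use F t in auto)
  then have "weak_constraint T ?E (\<lambda>t x. sym_grad (A t) x)"
    by (intro weak_constraint_potential T F(1) F(5) F(6) cE)
  moreover have "L2_field T ?E"
  proof (rule L2_field_continuous[OF cE])
    fix t assume t: "t \<in> {0..T}"
    have "?E t = ?E' t" using E[OF t] by (rule ext)
    then show "periodic (?E t)" using smooth_fieldD(2)[OF sE t] by simp
  qed
  moreover have "Linf_field T (\<lambda>t x. sym_grad (A t) x)"
    by (rule Linf_field_continuous[OF smooth_field_imp_continuous[OF sA]])
  moreover have "symmetric_matrix (sym_grad (A t) x)" for t x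
    by (simp add: symmetric_matrix_def transpose_def sym_grad_def vec_eq_iff add.commute)
  ultimately show ?thesis by (simp add: EB_def)
qed

theorem theorem3p1:
  fixes V :: "real \<Rightarrow> real^'n \<Rightarrow> real^'n" and P0 :: "real^'n \<Rightarrow> real^'n" and Tstar :: real
  assumes "Tstar > 0"
    and "periodic P0"
    and "\<And>x. divergence P0 x = 0"
    and "(LINT x:cube|lborel. P0 x) = 0"
    and "euler_solution Tstar P0 V"
  shows "(\<forall>T\<in>{0<..Tstar}. \<exists>A \<phi>. final_value_solution T V A \<phi> \<and>
            (\<forall>A' \<phi>'. final_value_solution T V A' \<phi>' \<longrightarrow> (\<forall>t\<in>{0..T}. \<forall>x. A' t x = A t x))) \<and>
         (\<exists>T0\<in>{0<..Tstar}. \<forall>T\<in>{0<..T0}. \<forall>A \<phi> E B.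
            final_value_solution T V A \<phi> \<and>
            E = (\<lambda>t x. dt T A t x + grad (\<phi> t) x) \<and>
            B = (\<lambda>t x. sym_grad (A t) x) \<longrightarrow>
              (\<exists>c>0. \<forall>t\<in>{0..T}. \<forall>x. loewner_le (mat c) (mat 1 + 2 *\<^sub>R sym_grad (A t) x)) \<and>
              is_arg_max (objective T P0) (\<lambda>p. p \<in> EB T) (E, B) \<and>
              (\<forall>t\<in>{0..T}. \<forall>x. V t x = - (matrix_inv (mat 1 + 2 *\<^sub>R B t x) *v E t x)))"
proof -
  have eul: "euler_solution T P0 V" if "0 < T" "T \<le> Tstar" for T
    by (rule euler_solution_subinterval[OF assms(5) that])
  have V: "smooth_field T V" and divV: "\<And>t x. t \<in> {0..T} \<Longrightarrow> divergence (V t) x = 0" if "0 < T" "T \<le> Tstar" for T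
    using eul[OF that] by (auto simp: euler_solution_def)
  have uniq: "A' t x = A t x"
    if "0 < T" "T \<le> Tstar" "final_value_solution T V A \<phi>" "final_value_solution T V A' \<phi>'" "t \<in> {0..T}"
    for T A A' \<phi> \<phi>' t x
    using final_value_solution_unique[OF that(1) V[OF that(1,2)] divV[OF that(1,2)] that(3,4,5)] .
  have "\<exists>A \<phi>. final_value_solution T V A \<phi> \<and>
      (\<forall>A' \<phi>'. final_value_solution T V A' \<phi>' \<longrightarrow> (\<forall>t\<in>{0..T}. \<forall>x. A' t x = A t x))" if T: "T \<in> {0<..Tstar}" for T
  proof -
    have T': "0 < T" "T \<le> Tstar" using T by auto
    obtain \<phi> where fv: "final_value_solution T V (\<lambda>t x. (T - t) *\<^sub>R V t x) \<phi>"
      using final_value_solution_explicit[OF T'(1) eul[OF T']] by blast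
    show ?thesis
      by (rule exI, rule exI[of _ \<phi>], rule conjI[OF fv]) (auto intro: uniq[OF T' fv])
  qed
  moreover have "\<exists>T0\<in>{0<..Tstar}. \<forall>T\<in>{0<..T0}. \<forall>A \<phi> E B.
            final_value_solution T V A \<phi> \<and>
            E = (\<lambda>t x. dt T A t x + grad (\<phi> t) x) \<and>
            B = (\<lambda>t x. sym_grad (A t) x) \<longrightarrow>
              (\<exists>c>0. \<forall>t\<in>{0..T}. \<forall>x. loewner_le (mat c) (mat 1 + 2 *\<^sub>R sym_grad (A t) x)) \<and>
              is_arg_max (objective T P0) (\<lambda>p. p \<in> EB T) (E, B) \<and>
              (\<forall>t\<in>{0..T}. \<forall>x. V t x = - (matrix_inv (mat 1 + 2 *\<^sub>R B t x) *v E t x))"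
  proof -
    have V': "smooth_field Tstar V" using V[OF assms(1)] by simp
    obtain C where C: "0 < C" "\<And>t x. t \<in> {0..Tstar} \<Longrightarrow> norm (sym_grad (V t) x) \<le> C"
      by (rule continuous_field_bounded[OF smooth_field_imp_continuous[OF smooth_field_sym_grad[OF assms(1) V']]]) (rule that)
    \<comment> \<open>The entrywise threshold below which I + 2B is at least half the identity; this
      also gives the constant c = 1/2 later.\<close>
    define \<epsilon> where "\<epsilon> = 1 / (4 * real CARD('n))"
    have eps: "0 < \<epsilon>" by (simp add: \<epsilon>_def)
    \<comment> \<open>Chosen so that T C \<le> \<epsilon>: for A = (T - t) V the entries of B are at
      most T times the bound C on the symmetrized gradient of V.\<close>
    define T0 where "T0 = min Tstar (\<epsilon> / C)"
    have T0: "T0 \<in> {0<..Tstar}" using assms(1) C(1) eps by (simp add: T0_def)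
    show ?thesis
    proof (rule bexI[OF _ T0], intro ballI allI impI, elim conjE)
      fix T A \<phi> E B
      assume T: "T \<in> {0<..T0}" and fv: "final_value_solution T V A \<phi>"
        and E: "E = (\<lambda>t x. dt T A t x + grad (\<phi> t) x)" and B: "B = (\<lambda>t x. sym_grad (A t) x)"
      have T': "0 < T" "T \<le> Tstar" and TC: "T * C \<le> \<epsilon>"
        using T C(1) by (auto simp: T0_def field_simps)
      note F = final_value_solutionD[OF fv]
      \<comment> \<open>The given A is arbitrary. By uniqueness it equals the explicit solution,
        whose potential may be another one, and this makes the size of B visible.\<close>
      obtain \<phi>' where fv': "final_value_solution T V (\<lambda>t x. (T - t) *\<^sub>R V t x) \<phi>'"
        using final_value_solution_explicit[OF T'(1) eul[OF T']] by blast
      have small: "\<bar>B t x $ i $ j\<bar> \<le> \<epsilon>" if t: "t \<in> {0..T}" for t x i j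
      proof -
        have "A t = (\<lambda>x. (T - t) *\<^sub>R V t x)"
          using uniq[OF T' fv' fv t] by (rule ext)
        then have "sym_grad (A t) x = (T - t) *\<^sub>R sym_grad (V t) x"
          using sym_grad_cmult[OF C1_periodicD(2)[OF smooth_field_C1_periodic_nth[OF T'(1) V[OF T'] t]]] by simp
        then have "\<bar>B t x $ i $ j\<bar> = (T - t) * \<bar>sym_grad (V t) x $ i $ j\<bar>"
          using t by (simp add: B abs_mult)
        also have "\<dots> \<le> T * C"
        proof (rule mult_mono)
          show "\<bar>sym_grad (V t) x $ i $ j\<bar> \<le> C"
            by (rule order_trans[OF component_le_norm_cart order_trans[OF Finite_Cartesian_Product.norm_nth_le C(2)]])
              (use t T' in simp)
        qed (use t C(1) in auto)
        finally show ?thesis using TC by simp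
      qed
      have EG: "E t x = - ((mat 1 + 2 *\<^sub>R B t x) *v V t x)" if "t \<in> {0..T}" for t x
        unfolding E B by (rule final_value_solution_E_eq[OF fv that])
      have EB: "(E, B) \<in> EB T"
        unfolding E B by (rule final_value_solution_in_EB[OF T'(1) V[OF T'] fv])
      have sB: "smooth_field T B"
        unfolding B by (rule smooth_field_sym_grad[OF T'(1) F(1)])
      have "\<exists>c>0. \<forall>t\<in>{0..T}. \<forall>x. loewner_le (mat c) (mat 1 + 2 *\<^sub>R sym_grad (A t) x)"
      proof (intro exI[of _ "1/2"] conjI ballI allI)
        show "loewner_le (mat (1/2)) (mat 1 + 2 *\<^sub>R sym_grad (A t) x)" if "t \<in> {0..T}" for t x
          unfolding loewner_le_def inner_mat_mult
          using near_identity_coercive[of "sym_grad (A t) x"] small[OF that, of x] by (simp add: B \<epsilon>_def)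
      qed simp
      moreover have "is_arg_max (objective T P0) (\<lambda>p. p \<in> EB T) (E, B)"
        unfolding is_arg_max_def
      proof (intro conjI EB notI)
        assume "\<exists>p. p \<in> EB T \<and> objective T P0 p > objective T P0 (E, B)"
        then obtain E' B' where EB': "(E', B') \<in> EB T" "objective T P0 (E', B') > objective T P0 (E, B)"
          by auto
        from objective_le[OF T'(1) eul[OF T'] EB'(1)]
          objective_ge[OF T'(1) eul[OF T'] sB small[unfolded \<epsilon>_def] EG EB] EB'(2)
        show False by (meson leD order_trans)
      qed
      moreover have "V t x = - (matrix_inv (mat 1 + 2 *\<^sub>R B t x) *v E t x)" if t: "t \<in> {0..T}" for t x
      proof -
        have neg: "M *v (- y) = - (M *v y)" for M :: "real^'n^'n" and y
          using matrix_vector_mult_diff_distrib[of M 0 y] by simp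
        have "matrix_inv (mat 1 + 2 *\<^sub>R B t x) *v (- ((mat 1 + 2 *\<^sub>R B t x) *v V t x)) = - V t x"
          unfolding neg near_identity_inverse[OF small[OF t, unfolded \<epsilon>_def]] ..
        then show ?thesis by (simp add: EG[OF t])
      qed
      ultimately show "(\<exists>c>0. \<forall>t\<in>{0..T}. \<forall>x. loewner_le (mat c) (mat 1 + 2 *\<^sub>R sym_grad (A t) x)) \<and>
              is_arg_max (objective T P0) (\<lambda>p. p \<in> EB T) (E, B) \<and>
              (\<forall>t\<in>{0..T}. \<forall>x. V t x = - (matrix_inv (mat 1 + 2 *\<^sub>R B t x) *v E t x))"
        by blast
    qed
  qed
  ultimately show ?thesis by blast
qed

end
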